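(* Let $k,n,r$ be integers with $0\le r\le k$ and $2k\le r+n$. Fix the reverse lexicographic term order $>$ on the polynomial ring $S=\mathbb{C}[\mathbf{x}]$, where $x_{11}>x_{12}>\cdots>x_{n-k+r,n}$; this is a diagonal term order, i.e. for each minor of $\mathbf{x}$ the initial monomial is the product of the entries on its diagonal. The $2\binom nk$ minors $\phi(\langle I\rangle)$ and $\phi([J])$, where $I,J$ range over the $k$-element subsets of $[n]=\{1,\dots,n\}$, are a Khovanskii basis for the coordinate ring $\phi(R)$ of the spinor-helicity variety $\mathrm{SH}(k,n,r)$; i.e. their initial monomials $\mathrm{in}_>\phi(\langle I\rangle)$ and $\mathrm{in}_>\phi([J])$ generate the initial algebra $$\mathrm{in}_>(\phi(R))=\mathbb{C}[\,\mathrm{in}_>(f): f\in\phi(R)\,].$$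
   Context: $\mathrm{Gr}(k,n)\subset\mathbb{P}^{\binom nk-1}$ is the Grassmannian of $k$-dimensional subspaces of $\mathbb{C}^n$ in its Plücker embedding. The spinor-helicity variety is $\mathrm{SH}(k,n,r)=\{(V,W)\in\mathrm{Gr}(k,n)\times\mathrm{Gr}(k,n):\dim(V\cap W^\perp)\ge k-r\}\subset\mathbb{P}^{\binom nk-1}\times\mathbb{P}^{\binom nk-1}$, where $W^\perp$ is the space orthogonal to $W$ with respect to the standard inner product on $\mathbb{C}^n$. $R=\mathbb{C}[\langle i_1\cdots i_k\rangle,[j_1\cdots j_k]]$ is the polynomial ring in $2\binom nk$ bracket variables indexed by $1\le i_1<\dots<i_k\le n$ and $1\le j_1<\dots<j_k\le n$; the brackets $\langle I\rangle$ represent the Plücker coordinates of $V$ and the brackets $[J]$ those of $W$. $S=\mathbb{C}[\mathbf{x}]$ is the polynomial ring in the entries of an $(n-k+r)\times n$ matrix $\mathbf{x}=(x_{ij})$. The ring homomorphism $\phi=\phi_{k,n,r}:R\to S$ maps $\langle I\rangle=\langle i_1\cdots i_k\rangle$ to the $k\times k$ minor of $\mathbf{x}$ with rows $1,2,\dots,k$ and columns $I$, and maps $[J]=[j_1\cdots j_k]$ to $(-1)^{j_1+\cdots+j_k}$ times the $(n-k)\times(n-k)$ minor of $\mathbf{x}$ with rows $r+1,\dots,n-k+r$ and columns $[n]\setminus J$. The kernel of $\phi$ is a homogeneous prime ideal whose zero set is $\mathrm{SH}(k,n,r)$, and the subalgebra $\phi(R)$ of $S$ is isomorphic to the coordinate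 ring of $\mathrm{SH}(k,n,r)$.
   Formalization: The claim that reverse lex with x11>x12>… is a diagonal term order is false (x12·x21 > x11·x22) and is not asserted; instead the Khovanskii basis property is proved both for this reverse lexicographic order and for every diagonal term order. *)

theory Defs
  imports "HOL-Library.Poly_Mapping" "Jordan_Normal_Form.Determinant"
begin

section \<open>Polynomials over the complex numbers\<close>

text \<open>A polynomial is a finitely supported map from monomials to coefficients, a monomial a finitely
  supported map from variables to exponents.  A polynomial ring in finitely many variables is
  the set of polynomials that only involve the variables from a given set.\<close>

type_synonym 'v monom = "'v \<Rightarrow>\<^sub>0 nat"
type_synonym 'v cpoly = "'v monom \<Rightarrow>\<^sub>0 complex"

definition monoms :: "'v set \<Rightarrow> 'v monom set" where
  "monoms V = {\<alpha>. Poly_Mapping.keys \<alpha> \<subseteq> V}"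

definition poly_ring :: "'v set \<Rightarrow> 'v cpoly set" where
  "poly_ring V = {p. Poly_Mapping.keys p \<subseteq> monoms V}"

definition Const :: "complex \<Rightarrow> 'v cpoly" where
  "Const c = Poly_Mapping.single 0 c"

definition Var :: "'v \<Rightarrow> 'v cpoly" where
  "Var v = Poly_Mapping.single (Poly_Mapping.single v 1) 1"

text \<open>The homomorphism of complex algebras that sends each variable \<open>v\<close> to \<open>g v\<close>.\<close>

definition subst_hom :: "('v \<Rightarrow> 'w cpoly) \<Rightarrow> 'v cpoly \<Rightarrow> 'w cpoly" where
  "subst_hom g p =
    (\<Sum>\<alpha>\<in>Poly_Mapping.keys p. Const (Poly_Mapping.lookup p \<alpha>) *
      (\<Prod>v\<in>Poly_Mapping.keys \<alpha>. g v ^ Poly_Mapping.lookup \<alpha> v))"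

definition is_subalgebra :: "'v cpoly set \<Rightarrow> bool" where
  "is_subalgebra A \<longleftrightarrow> (\<forall>c. Const c \<in> A) \<and> (\<forall>p\<in>A. \<forall>q\<in>A. p + q \<in> A \<and> p * q \<in> A)"

definition algebra_gen :: "'v cpoly set \<Rightarrow> 'v cpoly set" where
  "algebra_gen X = is_subalgebra hull X"


section \<open>Term orders and Khovanskii bases\<close>

text \<open>Term orders are given by their strict part: \<open>lt \<alpha> \<beta>\<close> means that \<open>\<beta>\<close> is the larger monomial.
  Only the restriction to the monomials of the polynomial ring at hand matters.\<close>

definition term_order :: "'v set \<Rightarrow> ('v monom \<Rightarrow> 'v monom \<Rightarrow> bool) \<Rightarrow> bool" where
  "term_order V lt \<longleftrightarrow>
     irreflp_on (monoms V) lt \<and> transp_on (monoms V) lt \<and> totalp_on (monoms V) lt \<and>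
     (\<forall>\<alpha>\<in>monoms V. \<alpha> \<noteq> 0 \<longrightarrow> lt 0 \<alpha>) \<and>
     (\<forall>\<alpha>\<in>monoms V. \<forall>\<beta>\<in>monoms V. \<forall>\<gamma>\<in>monoms V. lt \<alpha> \<beta> \<longrightarrow> lt (\<alpha> + \<gamma>) (\<beta> + \<gamma>))"

text \<open>The initial monomial carries the coefficient 1; it is meaningful for nonzero \<open>f\<close> only.\<close>

definition init :: "('v monom \<Rightarrow> 'v monom \<Rightarrow> bool) \<Rightarrow> 'v cpoly \<Rightarrow> 'v cpoly" where
  "init lt f =
     Poly_Mapping.single
       (THE \<alpha>. \<alpha> \<in> Poly_Mapping.keys f \<and> (\<forall>\<beta>\<in>Poly_Mapping.keys f. \<beta> \<noteq> \<alpha> \<longrightarrow> lt \<beta> \<alpha>)) 1"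

definition init_algebra :: "('v monom \<Rightarrow> 'v monom \<Rightarrow> bool) \<Rightarrow> 'v cpoly set \<Rightarrow> 'v cpoly set" where
  "init_algebra lt A = algebra_gen {init lt f | f. f \<in> A \<and> f \<noteq> 0}"

definition khovanskii_basis ::
    "('v monom \<Rightarrow> 'v monom \<Rightarrow> bool) \<Rightarrow> 'v cpoly set \<Rightarrow> 'v cpoly set \<Rightarrow> bool" where
  "khovanskii_basis lt A F \<longleftrightarrow>
     F \<subseteq> A \<and> algebra_gen {init lt f | f. f \<in> F \<and> f \<noteq> 0} = init_algebra lt A"


section \<open>The generic matrix, its minors and diagonal term orders\<close>

text \<open>Rows and columns are numbered from 1; \<open>Var (i, j)\<close> is the matrix entry \<open>x\<^sub>i\<^sub>j\<close>.\<close>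

abbreviation entries :: "nat \<Rightarrow> nat \<Rightarrow> (nat \<times> nat) set" where
  "entries m n \<equiv> {1..m} \<times> {1..n}"

text \<open>\<open>nth_elem A a\<close> is the \<open>a\<close>-th smallest element of \<open>A\<close>, counted from 0 as in
  Jordan-Normal-Form matrices.\<close>

definition nth_elem :: "nat set \<Rightarrow> nat \<Rightarrow> nat" where
  "nth_elem A a = sorted_list_of_set A ! a"

definition minor :: "nat set \<Rightarrow> nat set \<Rightarrow> (nat \<times> nat) cpoly" where
  "minor A B = det (mat (card A) (card B) (\<lambda>(a, b). Var (nth_elem A a, nth_elem B b)))"

definition diagonal_order ::
    "nat \<Rightarrow> nat \<Rightarrow> ((nat \<times> nat) monom \<Rightarrow> (nat \<times> nat) monom \<Rightarrow> bool) \<Rightarrow> bool" where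
  "diagonal_order m n lt \<longleftrightarrow>
     (\<forall>A B. A \<subseteq> {1..m} \<longrightarrow> B \<subseteq> {1..n} \<longrightarrow> card A = card B \<longrightarrow>
        init lt (minor A B) = (\<Prod>a<card A. Var (nth_elem A a, nth_elem B a)))"

text \<open>\<open>row_major v w\<close> expresses that \<open>x\<^sub>v > x\<^sub>w\<close> in \<open>x\<^sub>1\<^sub>1 > x\<^sub>1\<^sub>2 > \<dots> > x\<^sub>m\<^sub>n\<close>.\<close>

definition row_major :: "nat \<times> nat \<Rightarrow> nat \<times> nat \<Rightarrow> bool" where
  "row_major v w \<longleftrightarrow> fst v < fst w \<or> fst v = fst w \<and> snd v < snd w"

definition mdeg :: "'v monom \<Rightarrow> nat" where
  "mdeg \<alpha> = (\<Sum>v\<in>Poly_Mapping.keys \<alpha>. Poly_Mapping.lookup \<alpha> v)"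

text \<open>The (degree) reverse lexicographic order: among monomials of equal degree, the one with the
  larger exponent at the smallest variable where they differ is the smaller one.  With the
  variables ordered row by row it picks the antidiagonal of a minor and so is not a diagonal
  order (\<open>revlex_not_diagonal\<close> below); the lexicographic order \<open>lex_less\<close> for the same order of
  the variables is diagonal (\<open>lex_diagonal\<close>).\<close>

definition revlex :: "(nat \<times> nat) monom \<Rightarrow> (nat \<times> nat) monom \<Rightarrow> bool" where
  "revlex \<alpha> \<beta> \<longleftrightarrow> mdeg \<alpha> < mdeg \<beta> \<or>
     mdeg \<alpha> = mdeg \<beta> \<and>
     (\<exists>v. Poly_Mapping.lookup \<alpha> v > Poly_Mapping.lookup \<beta> v \<and>
       (\<forall>w. row_major v w \<longrightarrow> Poly_Mapping.lookup \<alpha> w = Poly_Mapping.lookup \<beta> w))"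


section \<open>The coordinate ring of the spinor-helicity variety\<close>

datatype bracket = Angle "nat set" | Square "nat set"

definition index_sets :: "nat \<Rightarrow> nat \<Rightarrow> nat set set" where
  "index_sets k n = {I. I \<subseteq> {1..n} \<and> card I = k}"

definition brackets :: "nat \<Rightarrow> nat \<Rightarrow> bracket set" where
  "brackets k n = Angle ` index_sets k n \<union> Square ` index_sets k n"

fun bracket_image :: "nat \<Rightarrow> nat \<Rightarrow> nat \<Rightarrow> bracket \<Rightarrow> (nat \<times> nat) cpoly" where
  "bracket_image k n r (Angle I) = minor {1..k} I"
| "bracket_image k n r (Square J) = (-1) ^ (\<Sum>J) * minor {r + 1..n - k + r} ({1..n} - J)"

definition \<phi> :: "nat \<Rightarrow> nat \<Rightarrow> nat \<Rightarrow> bracket cpoly \<Rightarrow> (nat \<times> nat) cpoly" where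
  "\<phi> k n r = subst_hom (bracket_image k n r)"

lemma \<phi>_Var: "\<phi> k n r (Var b) = bracket_image k n r b"
  unfolding \<phi>_def subst_hom_def Var_def Const_def by simp

definition SH_ring :: "nat \<Rightarrow> nat \<Rightarrow> nat \<Rightarrow> (nat \<times> nat) cpoly set" where
  "SH_ring k n r = \<phi> k n r ` poly_ring (brackets k n)"

definition SH_minors :: "nat \<Rightarrow> nat \<Rightarrow> nat \<Rightarrow> (nat \<times> nat) cpoly set" where
  "SH_minors k n r =
     {\<phi> k n r (Var (Angle I)) | I. I \<in> index_sets k n} \<union>
     {\<phi> k n r (Var (Square J)) | J. J \<in> index_sets k n}"


section \<open>The row-major lexicographic and reverse lexicographic orders\<close>

abbreviation "lk \<equiv> Poly_Mapping.lookup"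

lemma row_major_trans: "row_major u v \<Longrightarrow> row_major v w \<Longrightarrow> row_major u w"
  unfolding row_major_def by auto

lemma row_major_total: "u \<noteq> v \<Longrightarrow> row_major u v \<or> row_major v u"
  unfolding row_major_def by (auto simp: prod_eq_iff)

lemma row_major_irrefl: "\<not> row_major u u"
  unfolding row_major_def by auto

lemma finite_minimal:
  assumes tr: "\<And>x y z. R x y \<Longrightarrow> R y z \<Longrightarrow> R x z" and irr: "\<And>x. \<not> R x x"
    and "finite D" "D \<noteq> {}"
  shows "\<exists>v\<in>D. \<forall>w. R w v \<longrightarrow> w \<notin> D"
  using assms(3,4)
proof (induction rule: finite_ne_induct)
  case (singleton x)
  then show ?case using irr by blast
next
  case (insert x F)
  then obtain v where v: "v \<in> F" "\<forall>w. R w v \<longrightarrow> w \<notin> F" by blast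
  show ?case
  proof (cases "R x v")
    case True
    have "\<forall>w. R w x \<longrightarrow> w \<notin> insert x F"
      using v tr[OF _ True] irr by blast
    then show ?thesis by blast
  next
    case False
    then show ?thesis using v by auto
  qed
qed

lemma first_diff_trans:
  fixes f g h :: "'a \<Rightarrow> nat"
  assumes tr: "\<And>x y z. R x y \<Longrightarrow> R y z \<Longrightarrow> R x z"
    and tot: "\<And>x y. x \<noteq> y \<Longrightarrow> R x y \<or> R y x"
    and fg: "\<exists>v. f v < g v \<and> (\<forall>w. R w v \<longrightarrow> f w = g w)"
    and gh: "\<exists>v. g v < h v \<and> (\<forall>w. R w v \<longrightarrow> g w = h w)"
  shows "\<exists>v. f v < h v \<and> (\<forall>w. R w v \<longrightarrow> f w = h w)"
proof -
  obtain v w where v: "f v < g v" "\<And>u. R u v \<Longrightarrow> f u = g u"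
    and w: "g w < h w" "\<And>u. R u w \<Longrightarrow> g u = h u"
    using fg gh by blast
  consider "v = w" | "R v w" | "R w v" using tot by blast
  then show ?thesis
  proof cases
    case 1
    then show ?thesis using v w by (intro exI[of _ v]) auto
  next
    case 2
    then show ?thesis using v w tr[OF _ 2] by (intro exI[of _ v]) auto
  next
    case 3
    then show ?thesis using v w tr[OF _ 3] by (intro exI[of _ w]) auto
  qed
qed

lemma first_diff_total:
  fixes \<alpha> \<beta> :: "'v monom"
  assumes tr: "\<And>x y z. R x y \<Longrightarrow> R y z \<Longrightarrow> R x z" and irr: "\<And>x. \<not> R x x"
    and "\<alpha> \<noteq> \<beta>"
  shows "(\<exists>v. lk \<alpha> v < lk \<beta> v \<and> (\<forall>w. R w v \<longrightarrow> lk \<alpha> w = lk \<beta> w)) \<or>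
    (\<exists>v. lk \<beta> v < lk \<alpha> v \<and> (\<forall>w. R w v \<longrightarrow> lk \<beta> w = lk \<alpha> w))"
proof -
  let ?D = "{v. lk \<alpha> v \<noteq> lk \<beta> v}"
  have "?D \<subseteq> Poly_Mapping.keys \<alpha> \<union> Poly_Mapping.keys \<beta>"
    by (auto simp: in_keys_iff)
  then have "finite ?D" by (rule finite_subset) simp
  moreover have "?D \<noteq> {}" using \<open>\<alpha> \<noteq> \<beta>\<close> by (auto intro: poly_mapping_eqI)
  ultimately have "\<exists>v\<in>?D. \<forall>w. R w v \<longrightarrow> w \<notin> ?D"
    by (intro finite_minimal) (use tr irr in blast)+
  then obtain v where v: "lk \<alpha> v \<noteq> lk \<beta> v" "\<And>w. R w v \<Longrightarrow> lk \<alpha> w = lk \<beta> w" by blast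
  show ?thesis
  proof (cases "lk \<alpha> v < lk \<beta> v")
    case True
    then show ?thesis using v(2) by (intro disjI1 exI[of _ v]) simp
  next
    case False
    then show ?thesis using v by (intro disjI2 exI[of _ v]) simp
  qed
qed

lemma mdeg_superset: "finite V \<Longrightarrow> Poly_Mapping.keys \<alpha> \<subseteq> V \<Longrightarrow> mdeg \<alpha> = (\<Sum>v\<in>V. lk \<alpha> v)"
  unfolding mdeg_def by (intro sum.mono_neutral_left) (auto simp: in_keys_iff)

lemma mdeg_add: "mdeg (\<alpha> + \<beta>) = mdeg \<alpha> + mdeg \<beta>"
proof -
  let ?V = "Poly_Mapping.keys \<alpha> \<union> Poly_Mapping.keys \<beta>"
  have "mdeg (\<alpha> + \<beta>) = (\<Sum>v\<in>?V. lk (\<alpha>+\<beta>) v)" 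
    by (intro mdeg_superset) (auto simp: Poly_Mapping.keys_add)
  also have "\<dots> = (\<Sum>v\<in>?V. lk \<alpha> v) + (\<Sum>v\<in>?V. lk \<beta> v)" by (simp add: lookup_add sum.distrib)
  also have "\<dots> = mdeg \<alpha> + mdeg \<beta>" using mdeg_superset[of ?V] by simp
  finally show ?thesis .
qed

lemma mdeg_pos:
  assumes "\<alpha> \<noteq> 0" shows "0 < mdeg \<alpha>"
proof -
  from assms obtain v where v: "v \<in> Poly_Mapping.keys \<alpha>" by fastforce
  then have "lk \<alpha> v \<le> mdeg \<alpha>" unfolding mdeg_def by (intro member_le_sum) auto
  with v show ?thesis by (simp add: in_keys_iff)
qed

lemma revlex_iff:
  "revlex \<alpha> \<beta> \<longleftrightarrow> mdeg \<alpha> < mdeg \<beta> \<or>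
     mdeg \<alpha> = mdeg \<beta> \<and>
     (\<exists>v. lk \<beta> v < lk \<alpha> v \<and> (\<forall>w. row_major v w \<longrightarrow> lk \<beta> w = lk \<alpha> w))"
  unfolding revlex_def by (simp only: eq_commute)

lemma revlex_trans:
  assumes ab: "revlex \<alpha> \<beta>" and bc: "revlex \<beta> \<gamma>"
  shows "revlex \<alpha> \<gamma>"
proof (cases "mdeg \<alpha> < mdeg \<beta> \<or> mdeg \<beta> < mdeg \<gamma>")
  case True
  moreover have "mdeg \<alpha> \<le> mdeg \<beta>" "mdeg \<beta> \<le> mdeg \<gamma>"
    using ab bc unfolding revlex_def by auto
  ultimately have "mdeg \<alpha> < mdeg \<gamma>" by linarith
  then show ?thesis unfolding revlex_def ..
next
  case False
  let ?P = "\<lambda>\<alpha> \<beta>. \<exists>v. lk \<beta> v < lk \<alpha> v \<and> (\<forall>w. row_major v w \<longrightarrow> lk \<beta> w = lk \<alpha> w)"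
  have P: "?P \<alpha> \<beta>" "?P \<beta> \<gamma>" and eq: "mdeg \<alpha> = mdeg \<gamma>"
    using False ab bc unfolding revlex_iff by argo+
  have "?P \<alpha> \<gamma>"
    by (rule first_diff_trans[where R = "\<lambda>u v. row_major v u", OF _ _ P(2) P(1)])
      (use row_major_trans row_major_total in blast)+
  with eq show ?thesis unfolding revlex_iff by argo
qed

lemma revlex_term_order: "term_order (entries m n) revlex"
  unfolding term_order_def
proof (intro conjI ballI impI)
  show "irreflp_on (monoms (entries m n)) revlex" unfolding irreflp_on_def revlex_def by auto
  show "transp_on (monoms (entries m n)) revlex" unfolding transp_on_def using revlex_trans by blast
  show "totalp_on (monoms (entries m n)) revlex"
    unfolding totalp_on_def
  proof (intro ballI impI)
    fix \<alpha> \<beta> :: "(nat \<times> nat) monom" assume "\<alpha> \<noteq> \<beta>"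
    have "(\<exists>v. lk \<alpha> v < lk \<beta> v \<and> (\<forall>w. row_major v w \<longrightarrow> lk \<alpha> w = lk \<beta> w)) \<or>
        (\<exists>v. lk \<beta> v < lk \<alpha> v \<and> (\<forall>w. row_major v w \<longrightarrow> lk \<beta> w = lk \<alpha> w))"
      by (rule first_diff_total[where R = "\<lambda>u v. row_major v u", OF _ _ \<open>\<alpha> \<noteq> \<beta>\<close>])
        (use row_major_trans row_major_irrefl in blast)+
    then show "revlex \<alpha> \<beta> \<or> revlex \<beta> \<alpha>"
      unfolding revlex_iff using linorder_less_linear[of "mdeg \<alpha>" "mdeg \<beta>"] by presburger
  qed
  show "revlex 0 \<alpha>" if "\<alpha> \<noteq> 0" for \<alpha> using mdeg_pos[OF that] by (simp add: revlex_def mdeg_def)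
  show "revlex (\<alpha> + \<gamma>) (\<beta> + \<gamma>)" if "revlex \<alpha> \<beta>" for \<alpha> \<beta> \<gamma>
    using that by (auto simp: revlex_def mdeg_add lookup_add)
qed

definition lex_less :: "(nat \<times> nat) monom \<Rightarrow> (nat \<times> nat) monom \<Rightarrow> bool" where
  "lex_less \<alpha> \<beta> \<longleftrightarrow>
     (\<exists>v. Poly_Mapping.lookup \<alpha> v < Poly_Mapping.lookup \<beta> v \<and> (\<forall>w. row_major w v \<longrightarrow> Poly_Mapping.lookup \<alpha> w = Poly_Mapping.lookup \<beta> w))"

lemma lex_irrefl: "\<not> lex_less \<alpha> \<alpha>" unfolding lex_less_def by auto

lemma lex_trans: "lex_less \<alpha> \<beta> \<Longrightarrow> lex_less \<beta> \<gamma> \<Longrightarrow> lex_less \<alpha> \<gamma>"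
  unfolding lex_less_def
  by (rule first_diff_trans[where R = row_major, OF row_major_trans row_major_total])

lemma lex_term_order: "term_order (entries m n) lex_less"
  unfolding term_order_def
proof (intro conjI ballI impI)
  show "irreflp_on (monoms (entries m n)) lex_less" unfolding irreflp_on_def lex_less_def by auto
  show "transp_on (monoms (entries m n)) lex_less" unfolding transp_on_def using lex_trans by blast
  have tot: "lex_less \<alpha> \<beta> \<or> lex_less \<beta> \<alpha>" if "\<alpha> \<noteq> \<beta>" for \<alpha> \<beta>
    unfolding lex_less_def
    by (rule first_diff_total[where R = row_major, OF row_major_trans row_major_irrefl that])
  then show "totalp_on (monoms (entries m n)) lex_less" unfolding totalp_on_def by blast
  show "lex_less 0 \<alpha>" if "\<alpha> \<noteq> 0" for \<alpha> using tot[OF that] by (auto simp: lex_less_def)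
  show "lex_less (\<alpha> + \<gamma>) (\<beta> + \<gamma>)" if "lex_less \<alpha> \<beta>" for \<alpha> \<beta> \<gamma>
    using that by (auto simp: lex_less_def lookup_add)
qed

definition perm_mon :: "nat set \<Rightarrow> nat set \<Rightarrow> (nat \<Rightarrow> nat) \<Rightarrow> (nat \<times> nat) monom" where
 "perm_mon A B p = (\<Sum>a<card A. Poly_Mapping.single (nth_elem A a, nth_elem B (p a)) 1)"

lemma prod_Var: "finite S \<Longrightarrow> (\<Prod>a\<in>S. Var (f a)) = Poly_Mapping.single (\<Sum>a\<in>S. Poly_Mapping.single (f a) 1) 1"
  by (induction rule: finite_induct) (auto simp: Var_def mult_single)

lemma nth_elem_mono: "finite B \<Longrightarrow> a < b \<Longrightarrow> b < card B \<Longrightarrow> nth_elem B a < nth_elem B b"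
  unfolding nth_elem_def using sorted_wrt_nth_less[OF strict_sorted_list_of_set[of B]] by simp

lemma minor_eq:
  assumes "card A = card B"
  shows "minor A B = (\<Sum>p | p permutes {0..<card A}. Poly_Mapping.single (perm_mon A B p) (of_int (sign p)))"
proof -
  have "signof p * (\<Prod>i = 0..<card A. mat (card A) (card B) (\<lambda>(a, b). Var (nth_elem A a, nth_elem B b)) $$ (i, p i))
      = Poly_Mapping.single (perm_mon A B p) (of_int (sign p))" if p: "p permutes {0..<card A}" for p
  proof -
    have "(\<Prod>i = 0..<card A. mat (card A) (card B) (\<lambda>(a, b). Var (nth_elem A a, nth_elem B b)) $$ (i, p i))
       = (\<Prod>i = 0..<card A. Var (nth_elem A i, nth_elem B (p i)))"
      using assms permutes_in_image[OF p] by (intro prod.cong) auto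
    also have "\<dots> = Poly_Mapping.single (perm_mon A B p) 1"
      unfolding perm_mon_def atLeast0LessThan by (rule prod_Var) simp
    finally show ?thesis
      by (cases p rule: sign_cases) (simp_all add: single_uminus[symmetric] del: single_uminus)
  qed
  then show ?thesis unfolding minor_def Determinant.det_def using assms by simp
qed

lemma lk_perm_mon: "lk (perm_mon A B p) v = card {a. a < card A \<and> (nth_elem A a, nth_elem B (p a)) = v}"
proof -
  have "lk (perm_mon A B p) v =
      (\<Sum>a\<in>{..<card A}. if (nth_elem A a, nth_elem B (p a)) = v then 1 else 0)"
    unfolding perm_mon_def lookup_sum lookup_single when_def ..
  also have "\<dots> = (\<Sum>a\<in>{a \<in> {..<card A}. (nth_elem A a, nth_elem B (p a)) = v}. 1)"
    by (rule sum.inter_filter[symmetric]) simp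
  finally show ?thesis unfolding lessThan_iff sum_constant by (simp only: mult_1_right of_nat_id)
qed

lemma perm_mon_lex:
  assumes fin: "finite A" "finite B" and c: "card A = card B" and p: "p permutes {0..<card A}" "p \<noteq> id"
  shows "lex_less (perm_mon A B p) (perm_mon A B id)"
proof -
  define i where "i = (LEAST i. p i \<noteq> i)"
  have ex: "\<exists>i. p i \<noteq> i" using p by (auto simp: fun_eq_iff)
  have i: "p i \<noteq> i" "\<And>j. j < i \<Longrightarrow> p j = j" unfolding i_def using LeastI_ex[OF ex] not_less_Least by blast+
  have ic: "i < card A" using i(1) p(1) unfolding permutes_def by auto
  have pi: "p i > i"
  proof (rule ccontr)
    assume "\<not> p i > i"
    with i(1) have "p i < i" by simp
    then have "p (p i) = p i" by (rule i(2))
    then have "p i = i" by (rule injD[OF permutes_inj[OF p(1)]])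
    with i(1) show False ..
  qed
  have injA: "nth_elem A a = nth_elem A b \<longleftrightarrow> a = b" if "a < card A" "b < card A" for a b
    using that nth_elem_mono[OF fin(1)] by (cases a b rule: linorder_cases) force+
  have piB: "p i < card B" using permutes_in_image[OF p(1), of i] ic c by auto
  show ?thesis unfolding lex_less_def
  proof (intro exI conjI allI impI)
    let ?v = "(nth_elem A i, nth_elem B i)"
    have "nth_elem B (p i) \<noteq> nth_elem B i" using nth_elem_mono[OF fin(2) pi piB] by simp
    then have "{a. a < card A \<and> (nth_elem A a, nth_elem B (p a)) = ?v} = {}"
      using injA ic by blast
    then have "lk (perm_mon A B p) ?v = 0" unfolding lk_perm_mon by (simp only: card.empty)
    moreover have "i \<in> {a. a < card A \<and> (nth_elem A a, nth_elem B (id a)) = ?v}" using ic by auto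
    ultimately show "lk (perm_mon A B p) ?v < lk (perm_mon A B id) ?v"
      unfolding lk_perm_mon[of A B id] by (simp only: card_gt_0_iff) auto
    fix w assume w: "row_major w ?v"
    have "a < i" if "a < card A" "nth_elem A a = fst w" "nth_elem B (p a) = snd w \<or> nth_elem B a = snd w" for a
    proof (rule ccontr)
      assume "\<not> a < i"
      then consider "a = i" | "i < a" by linarith
      then show False
      proof cases
        case 1 then show False using w that nth_elem_mono[OF fin(2) pi piB] by (auto simp: row_major_def)
      next
        case 2 then show False using w that nth_elem_mono[OF fin(1) 2] by (auto simp: row_major_def)
      qed
    qed
    then have "{a. a < card A \<and> (nth_elem A a, nth_elem B (p a)) = w} = {a. a < card A \<and> (nth_elem A a, nth_elem B (id a)) = w}"
      unfolding id_apply using i(2) by (intro Collect_cong) (metis fst_conv snd_conv)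
    then show "lk (perm_mon A B p) w = lk (perm_mon A B id) w" unfolding lk_perm_mon by simp
  qed
qed

lemma lex_diagonal: "diagonal_order m n lex_less"
  unfolding diagonal_order_def
proof (intro allI impI)
  fix A B assume AB: "A \<subseteq> {1..m}" "B \<subseteq> {1..n}" and c: "card A = card B"
  have fin: "finite A" "finite B" using AB finite_subset by auto
  let ?P = "{p. p permutes {0..<card A}}"
  have fP: "finite ?P" by (simp add: finite_permutations)
  note me = minor_eq[OF c]
  have "lk (minor A B) (perm_mon A B id) = (\<Sum>p\<in>?P. if p = id then 1 else 0)"
    unfolding me lookup_sum lookup_single
  proof (intro sum.cong refl)
    fix p assume "p \<in> ?P"
    then show "(of_int (sign p) when perm_mon A B p = perm_mon A B id) = (if p = id then 1 else 0 :: complex)"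
      using perm_mon_lex[OF fin c, of p] lex_irrefl[of "perm_mon A B id"] by (cases "p = id") (auto simp: when_def sign_id)
  qed
  also have "\<dots> = 1" using fP permutes_id by (subst sum.delta) auto
  finally have 1: "perm_mon A B id \<in> Poly_Mapping.keys (minor A B)" by (simp add: in_keys_iff)
  have 2: "lex_less \<beta> (perm_mon A B id)" if "\<beta> \<in> Poly_Mapping.keys (minor A B)" "\<beta> \<noteq> perm_mon A B id" for \<beta>
  proof -
    from that(1) obtain p where "p \<in> ?P" "\<beta> = perm_mon A B p"
      unfolding me in_keys_iff lookup_sum lookup_single
      by (elim sum.not_neutral_contains_not_neutral) (auto simp: when_def split: if_splits)
    with that perm_mon_lex[OF fin c, of p] show ?thesis by (cases "p = id") auto
  qed
  have "(THE \<alpha>. \<alpha> \<in> Poly_Mapping.keys (minor A B) \<and> (\<forall>\<beta>\<in>Poly_Mapping.keys (minor A B). \<beta> \<noteq> \<alpha> \<longrightarrow> lex_less \<beta> \<alpha>)) = perm_mon A B id"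
  proof (rule the_equality)
    fix \<alpha>
    assume a: "\<alpha> \<in> Poly_Mapping.keys (minor A B) \<and>
      (\<forall>\<beta>\<in>Poly_Mapping.keys (minor A B). \<beta> \<noteq> \<alpha> \<longrightarrow> lex_less \<beta> \<alpha>)"
    show "\<alpha> = perm_mon A B id"
    proof (rule ccontr)
      assume n: "\<alpha> \<noteq> perm_mon A B id"
      from a have "\<alpha> \<in> Poly_Mapping.keys (minor A B)" ..
      from 2[OF this n] have "lex_less \<alpha> (perm_mon A B id)" .
      moreover from a 1 n have "lex_less (perm_mon A B id) \<alpha>" by metis
      ultimately show False using lex_trans lex_irrefl by metis
    qed
  qed (use 1 2 in auto)
  then have "init lex_less (minor A B) = Poly_Mapping.single (perm_mon A B id) 1"
    unfolding init_def by (rule arg_cong)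
  also have "\<dots> = (\<Prod>a<card A. Var (nth_elem A a, nth_elem B a))"
    unfolding perm_mon_def id_apply by (rule prod_Var[symmetric]) simp
  finally show "init lex_less (minor A B) = (\<Prod>a<card A. Var (nth_elem A a, nth_elem B a))" .
qed

lemma the_larger:
  assumes "P d e" "\<not> P e d" "d \<noteq> e"
  shows "(THE a. a \<in> {d, e} \<and> (\<forall>b\<in>{d, e}. b \<noteq> a \<longrightarrow> P b a)) = e"
  by (rule the_equality) (use assms in auto)

lemma keys_two:
  assumes "d \<noteq> e"
  shows "Poly_Mapping.keys (Poly_Mapping.single d 1 + Poly_Mapping.single e (- 1) :: 'v cpoly) = {d, e}"
  using assms by (auto simp: in_keys_iff lookup_add lookup_single when_def split: if_splits)

lemma single_one_inject:
  "Poly_Mapping.single a (1::complex) = Poly_Mapping.single b 1 \<Longrightarrow> a = b"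
  by (metis keys_single singleton_inject zero_neq_one)

lemma revlex_not_diagonal:
  assumes "2 \<le> m" "2 \<le> n"
  shows "\<not> diagonal_order m n revlex"
proof
  let ?A = "{1, 2} :: nat set"
  let ?q = "Transposition.transpose 0 (Suc 0)"
  let ?d = "perm_mon ?A ?A id" and ?e = "perm_mon ?A ?A ?q"
  assume "diagonal_order m n revlex"
  moreover have "?A \<subseteq> {1..m}" "?A \<subseteq> {1..n}" using assms by auto
  ultimately have *: "init revlex (minor ?A ?A) = Poly_Mapping.single ?d 1"
    unfolding diagonal_order_def by (simp add: prod_Var perm_mon_def)
  have srt: "sorted_list_of_set ?A = [1, 2]" by simp
  have d: "?d = Poly_Mapping.single (1, 1) 1 + Poly_Mapping.single (2, 2) 1"
    by (simp add: perm_mon_def nth_elem_def numeral_2_eq_2 lessThan_Suc add.commute)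
  have e: "?e = Poly_Mapping.single (1, 2) 1 + Poly_Mapping.single (2, 1) 1"
    by (simp add: perm_mon_def nth_elem_def numeral_2_eq_2 lessThan_Suc add.commute)
  have "lk ?d (2, 2) = 1" "lk ?e (2, 2) = 0" unfolding d e by (simp_all add: lookup_add lookup_single)
  then have ne: "?d \<noteq> ?e" by (rule_tac notI) (simp only: zero_neq_one)
  have de: "revlex ?d ?e" unfolding revlex_def
  proof (intro disjI2 conjI exI[of _ "(2, 2)"] allI impI)
    show "mdeg ?d = mdeg ?e" unfolding d e by (simp add: mdeg_add) (simp add: mdeg_def)
    show "lk ?e (2, 2) < lk ?d (2, 2)" unfolding d e by (simp add: lookup_add lookup_single)
    show "lk ?d w = lk ?e w" if "row_major (2, 2) w" for w
      using that unfolding d e by (auto simp: row_major_def lookup_add lookup_single when_def)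
  qed
  have ps: "{p. p permutes {0..<card ?A}} = {id, ?q}"
  proof -
    have "{0..<card ?A} = {0, Suc 0}" by auto
    then show ?thesis by (auto simp: permutes_doubleton_iff)
  qed
  have idq: "id \<noteq> ?q"
  proof
    assume "id = ?q"
    then have "id 0 = ?q 0" by (rule fun_cong)
    then show False by simp
  qed
  have "minor ?A ?A = Poly_Mapping.single ?d 1 + Poly_Mapping.single ?e (- 1)"
    unfolding minor_eq[OF refl] ps by (subst sum.insert) (use idq in \<open>simp_all add: sign_id sign_swap_id\<close>)
  then have keys: "Poly_Mapping.keys (minor ?A ?A) = {?d, ?e}"
    using keys_two[OF ne] by (rule ssubst)
  have nde: "\<not> revlex ?e ?d" using de revlex_trans[OF de, of ?d] by (auto simp: revlex_def)
  have "(THE \<alpha>. \<alpha> \<in> {?d, ?e} \<and> (\<forall>\<beta>\<in>{?d, ?e}. \<beta> \<noteq> \<alpha> \<longrightarrow> revlex \<beta> \<alpha>)) = ?e"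
    by (rule the_larger[OF de nde ne])
  then have "init revlex (minor ?A ?A) = Poly_Mapping.single ?e 1"
    unfolding init_def keys by (rule arg_cong)
  from trans[OF sym[OF this] *]
  have "?e = ?d" by (rule single_one_inject)
  with ne show False by (rule notE[OF _ sym])
qed

end

theory Submission
  imports Defs
begin

text \<open>
  Let \<open>m = n - k + r\<close>.  The generators are the maximal minors of the rows \<open>1..k\<close> and, up to sign,
  those of the rows \<open>r + 1..m\<close>.  For a diagonal order the leading monomial of a minor has one
  variable in each of its rows, in strictly increasing columns; for \<open>revlex\<close>, which picks
  antidiagonals, the same holds after the columns are reversed.  Both cases are treated together by
  carrying along a column permutation \<open>\<sigma>\<close>, the identity or the reversal.  The task is to show that
  the leading monomial of every \<open>f\<close> in the algebra is a product of such monomials, that is, the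
  content of a skew tableau.

  Straightening relations between minors are avoided.  Let \<open>D\<^sub>z\<^sub>y\<close> be the derivation that replaces
  the variables of row \<open>z\<close> by those of row \<open>y\<close> in the same column.  It kills a minor whose rows
  contain \<open>y\<close> if they contain \<open>z\<close>, because it then produces a determinant with two equal rows
  (\<open>row_der_minor\<close>).  Hence the whole algebra is killed by \<open>D\<close> from row \<open>i + 1\<close> to row \<open>i\<close> for
  \<open>i > r\<close>, and by \<open>D\<close> from row \<open>i\<close> to row \<open>i + 1\<close> for \<open>i \<le> r\<close>, \<open>i < k\<close>.  The homogeneous elements of the
  kernel of such a \<open>D\<close> are highest weight vectors for an action of \<open>sl\<^sub>2\<close>, and a highest weight
  vector has nonnegative weight (\<open>polar_kernel_zero\<close>).  Applied to the first columns only, this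
  yields ballot inequalities for the exponents of a leading monomial (\<open>kernel_top_ballot\<close>),
  provided that the order compares the columns of the two rows in the right direction; the order \<open>block_lex\<close> does so for all the
  derivations at once.  The ballot inequalities are exactly what is needed to split a monomial
  greedily into strictly increasing columns (\<open>tableau_exists\<close>), so the leading monomial of \<open>f\<close> for
  \<open>block_lex\<close> is also the leading monomial of a product of minors.

  Subtracting multiples of such products repeatedly writes every \<open>f\<close> as a linear combination of
  products \<open>P\<^sub>u\<close> of minors, one for each tableau monomial \<open>u\<close> (\<open>admissible_product_comb\<close>).  This
  statement no longer refers to \<open>block_lex\<close>.  For any term order for which the minors have the
  expected leading monomials, \<open>P\<^sub>u\<close> has leading monomial \<open>u\<close>; these are distinct, so nothing
  cancels and the leading monomial of \<open>f\<close> is the largest \<open>u\<close> that occurs (\<open>product_comb_top\<close>).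
\<close>

section \<open>Highest weight vectors and ballot inequalities\<close>

text \<open>Monomials are represented by their exponent functions here, so that moving a unit of
  exponent is a pair of function updates.\<close>

definition shift :: "'v \<Rightarrow> 'v \<Rightarrow> ('v \<Rightarrow> nat) \<Rightarrow> 'v \<Rightarrow> nat" where
  "shift x y M = M(x := M x - 1, y := M y + 1)"

text \<open>If \<open>g\<close> is the coefficient function of a polynomial \<open>F\<close>, then \<open>polar J Y Z g\<close> is the coefficient
  function of \<open>\<Sum>j\<in>J. Y\<^sub>j \<partial>F/\<partial>Z\<^sub>j\<close>.  Exchanging \<open>Y\<close> and \<open>Z\<close> gives the opposite operator; together they
  generate an action of \<open>sl\<^sub>2\<close>.\<close>

definition polar ::
    "'j set \<Rightarrow> ('j \<Rightarrow> 'v) \<Rightarrow> ('j \<Rightarrow> 'v) \<Rightarrow> (('v \<Rightarrow> nat) \<Rightarrow> complex) \<Rightarrow> ('v \<Rightarrow> nat) \<Rightarrow> complex" where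
  "polar J Y Z g M =
    (\<Sum>j\<in>J. if 0 < M (Y j) then of_nat (M (Z j) + 1) * g (shift (Y j) (Z j) M) else 0)"

lemma polar_scale: "polar J Y Z (\<lambda>M. c * g M) M = c * polar J Y Z g M"
  unfolding polar_def sum_distrib_left by (intro sum.cong) auto

lemma shift_same: "x \<noteq> y \<Longrightarrow> 0 < M x \<Longrightarrow> shift y x (shift x y M) = M"
  by (auto simp: shift_def fun_eq_iff)

text \<open>Moves in two different columns commute, so only the terms of a single column survive in the
  commutator.  It is the weight operator.\<close>

lemma polar_commutator:
  assumes J: "finite J" "inj_on Y J" "inj_on Z J" "Y ` J \<inter> Z ` J = {}"
  shows "polar J Y Z (polar J Z Y g) M =
    polar J Z Y (polar J Y Z g) M + (of_nat (\<Sum>j\<in>J. M (Y j)) - of_nat (\<Sum>j\<in>J. M (Z j))) * g M"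
proof -
  define T where "T Y Z j l = (if 0 < M (Y j) then of_nat (M (Z j) + 1) *
    (if 0 < shift (Y j) (Z j) M (Z l)
     then of_nat (shift (Y j) (Z j) M (Y l) + 1) * g (shift (Z l) (Y l) (shift (Y j) (Z j) M))
     else 0) else (0 :: complex))" for Y Z :: "'a \<Rightarrow> 'b" and j l
  have exp: "polar J Y Z (polar J Z Y g) M = (\<Sum>j\<in>J. \<Sum>l\<in>J. T Y Z j l)" for Y Z
    unfolding polar_def T_def sum_distrib_left
    by (intro sum.cong refl) (auto simp: sum_distrib_left)
  have YZ: "Y j \<noteq> Z l" if "j \<in> J" "l \<in> J" for j l using that J(4) by blast
  have d: "T Y Z j l - T Z Y l j =
      (if l = j then (of_nat (M (Y j)) - of_nat (M (Z j))) * g M else 0)"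
    if jl: "j \<in> J" "l \<in> J" for j l
  proof (cases "l = j")
    case True
    have s1: "shift (Z j) (Y j) (shift (Y j) (Z j) M) = M" if "0 < M (Y j)"
      using YZ[OF jl(1) jl(1)] that by (simp add: shift_same)
    have s2: "shift (Y j) (Z j) (shift (Z j) (Y j) M) = M" if "0 < M (Z j)"
      using YZ[OF jl(1) jl(1)] that by (simp add: shift_same)
    have v: "shift (Y j) (Z j) M (Z j) = M (Z j) + 1" "shift (Y j) (Z j) M (Y j) = M (Y j) - 1"
      "shift (Z j) (Y j) M (Z j) = M (Z j) - 1" "shift (Z j) (Y j) M (Y j) = M (Y j) + 1"
      using YZ[OF jl(1) jl(1)] by (auto simp: shift_def)
    have a: "T Y Z j j = of_nat (M (Y j)) * of_nat (M (Z j) + 1) * g M"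
      using s1 unfolding T_def v by auto
    have b: "T Z Y j j = of_nat (M (Z j)) * of_nat (M (Y j) + 1) * g M"
      using s2 unfolding T_def v by auto
    show ?thesis unfolding True a b by (simp add: algebra_simps)
  next
    case False
    then have ne: "Y j \<noteq> Y l" "Z j \<noteq> Z l" "Y j \<noteq> Z l" "Y l \<noteq> Z j" "Y j \<noteq> Z j" "Y l \<noteq> Z l"
      using J jl YZ by (auto dest: inj_onD)
    have sh: "shift (Z l) (Y l) (shift (Y j) (Z j) M) = shift (Y j) (Z j) (shift (Z l) (Y l) M)"
      using ne by (auto simp: shift_def fun_eq_iff)
    have v: "shift (Y j) (Z j) M (Z l) = M (Z l)" "shift (Y j) (Z j) M (Y l) = M (Y l)"
      "shift (Z l) (Y l) M (Y j) = M (Y j)" "shift (Z l) (Y l) M (Z j) = M (Z j)"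
      using ne by (auto simp: shift_def)
    show ?thesis using False unfolding T_def v sh by simp
  qed
  have "(\<Sum>j\<in>J. \<Sum>l\<in>J. T Y Z j l) - (\<Sum>l\<in>J. \<Sum>j\<in>J. T Z Y l j) =
      (\<Sum>j\<in>J. \<Sum>l\<in>J. T Y Z j l - T Z Y l j)"
    by (subst sum.swap[of "\<lambda>l j. T Z Y l j"]) (simp add: sum_subtractf)
  also have "\<dots> = (\<Sum>j\<in>J. (of_nat (M (Y j)) - of_nat (M (Z j))) * g M)"
    using J(1) d by (intro sum.cong refl) (simp add: sum.delta')
  also have "\<dots> = (of_nat (\<Sum>j\<in>J. M (Y j)) - of_nat (\<Sum>j\<in>J. M (Z j))) * g M"
    by (simp add: sum_distrib_right sum_subtractf left_diff_distrib)
  finally show ?thesis unfolding exp by (simp add: algebra_simps)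
qed

lemma sum_shift:
  assumes J: "finite J" "inj_on Y J" "Y ` J \<inter> Z ` J = {}" and j: "j \<in> J" and "0 < M (Y j)"
  shows "(\<Sum>i\<in>J. shift (Y j) (Z j) M (Y i)) + 1 = (\<Sum>i\<in>J. M (Y i))"
    and "inj_on Z J \<Longrightarrow> (\<Sum>i\<in>J. shift (Y j) (Z j) M (Z i)) = (\<Sum>i\<in>J. M (Z i)) + 1"
proof -
  have YZ: "Y i \<noteq> Z l" if "i \<in> J" "l \<in> J" for i l using that J(3) by blast
  have "shift (Y j) (Z j) M (Y i) + (if i = j then 1 else 0) = M (Y i)" if "i \<in> J" for i
    using that j YZ assms(5) inj_onD[OF J(2), of i j] by (auto simp: shift_def)
  then have "(\<Sum>i\<in>J. shift (Y j) (Z j) M (Y i) + (if i = j then 1 else 0)) = (\<Sum>i\<in>J. M (Y i))"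
    by (intro sum.cong) auto
  then show "(\<Sum>i\<in>J. shift (Y j) (Z j) M (Y i)) + 1 = (\<Sum>i\<in>J. M (Y i))"
    using J(1) j by (simp add: sum.distrib)
  assume Z: "inj_on Z J"
  have "shift (Y j) (Z j) M (Z i) = M (Z i) + (if i = j then 1 else 0)" if "i \<in> J" for i
    using that j YZ[OF j that] YZ[OF j j] inj_onD[OF Z, of i j] by (auto simp: shift_def)
  then have "(\<Sum>i\<in>J. shift (Y j) (Z j) M (Z i)) = (\<Sum>i\<in>J. M (Z i) + (if i = j then 1 else 0))"
    by (intro sum.cong) auto
  then show "(\<Sum>i\<in>J. shift (Y j) (Z j) M (Z i)) = (\<Sum>i\<in>J. M (Z i)) + 1"
    using J(1) j by (simp add: sum.distrib)
qed

lemma polar_nonzero: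
  assumes "polar J Y Z g M \<noteq> 0"
  obtains j where "j \<in> J" "0 < M (Y j)" "g (shift (Y j) (Z j) M) \<noteq> 0"
proof -
  obtain j where "j \<in> J"
    "(if 0 < M (Y j) then of_nat (M (Z j) + 1) * g (shift (Y j) (Z j) M) else 0) \<noteq> 0"
    using assms unfolding polar_def by (rule sum.not_neutral_contains_not_neutral)
  then show ?thesis using that[of j] by (auto split: if_splits)
qed

text \<open>A highest weight vector of negative weight vanishes.  Write \<open>D\<close> and \<open>E\<close> for the two polarization
  operators and \<open>w = \<alpha> - \<beta>\<close> for the weight of \<open>g\<close>.  From \<open>D g = 0\<close> and the commutator relation,
  \<open>D (E\<^sup>k\<^sup>+\<^sup>1 g) = (k + 1) (w - k) E\<^sup>k g\<close>, where the factor is nonzero because \<open>w < 0\<close>.  Since \<open>E\<close> lowers the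
  degree in \<open>Y\<close>, some power of \<open>E\<close> kills \<open>g\<close>, and descending from there shows \<open>g = 0\<close>.\<close>

lemma polar_kernel_zero:
  assumes J: "finite J" "inj_on Y J" "inj_on Z J" "Y ` J \<inter> Z ` J = {}"
    and ker: "\<And>M. polar J Y Z g M = 0"
    and deg: "\<And>M. g M \<noteq> 0 \<Longrightarrow> (\<Sum>j\<in>J. M (Y j)) = \<alpha> \<and> (\<Sum>j\<in>J. M (Z j)) = \<beta>"
    and less: "\<alpha> < \<beta>"
  shows "g M = 0"
proof -
  define e where "e k = (polar J Z Y ^^ k) g" for k
  have e0: "e 0 = g" and eS: "e (Suc k) = polar J Z Y (e k)" for k by (simp_all add: e_def)
  have dg: "e k M \<noteq> 0 \<Longrightarrow> (\<Sum>j\<in>J. M (Y j)) + k = \<alpha> \<and> (\<Sum>j\<in>J. M (Z j)) = \<beta> + k" for k M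
  proof (induction k arbitrary: M)
    case 0
    then show ?case using deg by (simp add: e0)
  next
    case (Suc k)
    obtain j where j: "j \<in> J" "0 < M (Z j)" "e k (shift (Z j) (Y j) M) \<noteq> 0"
      using Suc.prems unfolding eS by (rule polar_nonzero)
    have dj: "Z ` J \<inter> Y ` J = {}" using J(4) by blast
    show ?case
      using Suc.IH[OF j(3)] sum_shift[of J Z Y j M, OF J(1) J(3) dj j(1,2)] J(2) by simp
  qed
  let ?w = "int \<alpha> - int \<beta>"
  have step: "polar J Y Z (e (Suc k)) M = of_int ((int k + 1) * (?w - int k)) * e k M" for k M
  proof (induction k arbitrary: M)
    case 0
    have z: "polar J Z Y (polar J Y Z g) M = 0" unfolding polar_def[of J Z Y] by (intro sum.neutral) (auto simp: ker)
    have "of_nat (\<Sum>j\<in>J. M (Y j)) - of_nat (\<Sum>j\<in>J. M (Z j)) = (of_int ?w :: complex)" if "g M \<noteq> 0"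
      using deg[OF that] by simp
    then have "(of_nat (\<Sum>j\<in>J. M (Y j)) - of_nat (\<Sum>j\<in>J. M (Z j))) * g M = of_int ?w * g M"
      by (cases "g M = 0") simp_all
    then have "polar J Y Z (polar J Z Y g) M = of_int ?w * g M"
      using polar_commutator[OF J, of g M] z by (simp only: add_0_left)
    then show ?case by (simp add: eS e0)
  next
    case (Suc k)
    have "polar J Y Z (e (Suc k)) = (\<lambda>M. of_int ((int k + 1) * (?w - int k)) * e k M)"
      using Suc.IH by (rule ext)
    then have "polar J Z Y (polar J Y Z (e (Suc k))) M =
        of_int ((int k + 1) * (?w - int k)) * e (Suc k) M"
      by (simp only: polar_scale eS)
    moreover {have "of_nat (\<Sum>j\<in>J. M (Y j)) - of_nat (\<Sum>j\<in>J. M (Z j)) =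
        (of_int (?w - 2 * int (Suc k)) :: complex)" if "e (Suc k) M \<noteq> 0"
    proof -
      have "int (\<Sum>j\<in>J. M (Y j)) - int (\<Sum>j\<in>J. M (Z j)) = ?w - 2 * int (Suc k)"
      proof -
        have "int a - int b = ?w - 2 * int l" if "a + l = \<alpha> \<and> b = \<beta> + l" for a b l :: nat
          using that by linarith
        from this[OF dg[OF that]] show ?thesis .
      qed
      then have "of_int (int (\<Sum>j\<in>J. M (Y j)) - int (\<Sum>j\<in>J. M (Z j))) =
          (of_int (?w - 2 * int (Suc k)) :: complex)"
        by (rule arg_cong)
      then show ?thesis by (simp only: of_int_diff of_int_of_nat_eq)
    qed
    then have "(of_nat (\<Sum>j\<in>J. M (Y j)) - of_nat (\<Sum>j\<in>J. M (Z j))) * e (Suc k) M =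
        of_int (?w - 2 * int (Suc k)) * e (Suc k) M"
      by (cases "e (Suc k) M = 0") (simp_all only: mult_zero_right simp_thms)}
    ultimately have "polar J Y Z (e (Suc (Suc k))) M =
        (of_int ((int k + 1) * (?w - int k)) + of_int (?w - 2 * int (Suc k))) * e (Suc k) M"
      using polar_commutator[OF J, of "e (Suc k)" M]
      unfolding eS[of "Suc k"] by (simp only: distrib_right)
    also have "(of_int ((int k + 1) * (?w - int k)) + of_int (?w - 2 * int (Suc k)) :: complex) =
        of_int ((int (Suc k) + 1) * (?w - int (Suc k)))"
      unfolding of_int_add[symmetric] by (rule arg_cong[of _ _ of_int]) (simp add: algebra_simps)
    finally show ?case .
  qed
  have "\<forall>M. e (Suc \<alpha> - i) M = 0" for i
  proof (induction i)
    case 0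
    then show ?case using dg[of "Suc \<alpha>"] by fastforce
  next
    case (Suc i)
    show ?case
    proof (cases "i \<le> \<alpha>")
      case True
      then have eq: "Suc \<alpha> - i = Suc (Suc \<alpha> - Suc i)" by simp
      have "polar J Y Z (e (Suc \<alpha> - i)) M = 0" for M
        using Suc unfolding polar_def by (intro sum.neutral) auto
      then have "of_int ((int (Suc \<alpha> - Suc i) + 1) * (?w - int (Suc \<alpha> - Suc i))) *
          e (Suc \<alpha> - Suc i) M = 0" for M
        unfolding eq step .
      moreover have "(int (Suc \<alpha> - Suc i) + 1) * (?w - int (Suc \<alpha> - Suc i)) \<noteq> 0"
        using less by simp
      ultimately show ?thesis unfolding mult_eq_0_iff of_int_eq_0_iff by blast
    next
      case False
      then show ?thesis using Suc by simp
    qed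
  qed
  from this[of "Suc \<alpha>"] show ?thesis by (simp add: e0)
qed

text \<open>The hypothesis \<open>top\<close> says that \<open>u\<close> is maximal among the monomials of \<open>F\<close> when exponents of the
  \<open>Z\<^sub>c\<close> are compared from the last column to the first.  Keep only the monomials that agree with \<open>u\<close>
  outside the first \<open>c\<close> columns of the two rows and have the same degrees as \<open>u\<close> inside; maximality
  makes this part lie in the kernel of the operator for the first \<open>c\<close> columns.  Maximality also bounds
  the exponent of \<open>Z\<^sub>c\<close> from above, hence that of \<open>Y\<^sub>c\<close> from below, so \<open>Y\<^sub>c\<close> to the power \<open>u (Y c)\<close> can be
  divided out.  The quotient is a nonzero highest weight vector, and nonnegativity of its weight is
  the stated inequality; the division is what makes the right-hand sum stop before \<open>c\<close>.\<close>

lemma kernel_top_ballot: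
  fixes Y Z :: "nat \<Rightarrow> 'v" and F :: "('v \<Rightarrow> nat) \<Rightarrow> complex"
  assumes J: "inj_on Y {1..n}" "inj_on Z {1..n}" "Y ` {1..n} \<inter> Z ` {1..n} = {}"
    and ker: "\<And>M. polar {1..n} Y Z F M = 0"
    and Fu: "F u \<noteq> 0"
    and top: "\<And>M c. c \<in> {1..n} \<Longrightarrow> (\<And>v. v \<notin> Y ` {1..n} \<union> Z ` {1..n} \<Longrightarrow> M v = u v) \<Longrightarrow>
      (\<And>l. l \<in> {c<..n} \<Longrightarrow> M (Z l) = u (Z l)) \<Longrightarrow> u (Z c) < M (Z c) \<Longrightarrow> F M = 0"
    and c: "c \<in> {1..n}"
  shows "(\<Sum>j=1..c. u (Z j)) \<le> (\<Sum>j=1..<c. u (Y j))"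
proof (rule ccontr)
  define W where "W = Y ` {1..c} \<union> Z ` {1..c}"
  \<comment> \<open>The monomial \<open>M\<close> in the first \<open>c\<close> columns, completed by \<open>u\<close> elsewhere and multiplied by the power of \<open>Y\<^sub>c\<close> that was divided out.\<close>
  define lift where "lift M v = (if v \<in> W then M v + (if v = Y c then u (Y c) else 0) else u v)" for M v
  define \<alpha> where "\<alpha> = (\<Sum>j=1..<c. u (Y j))"
  define \<beta> where "\<beta> = (\<Sum>j=1..c. u (Z j))"
  define Q where "Q M s t \<longleftrightarrow> (\<forall>v. v \<notin> W \<longrightarrow> M v = 0) \<and> (\<Sum>j=1..c. M (Y j)) = s \<and>
    (\<Sum>j=1..c. M (Z j)) = t \<and> M (Y c) + M (Z c) = u (Z c)" for M s t
  \<comment> \<open>The coefficient function of the part of \<open>F\<close> that is compared with \<open>u\<close>, after the division.\<close>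
  define g where "g M = (if Q M \<alpha> \<beta> then F (lift M) else 0)" for M
  assume "\<not> ?thesis"
  then have less: "\<alpha> < \<beta>" by (simp add: \<alpha>_def \<beta>_def)
  have sub: "{1..c} \<subseteq> {1..n}" using c by auto
  have Jc: "finite {1..c}" "inj_on Y {1..c}" "inj_on Z {1..c}" "Y ` {1..c} \<inter> Z ` {1..c} = {}"
    using inj_on_subset[OF J(1) sub] inj_on_subset[OF J(2) sub] J(3) image_mono[OF sub, of Y]
      image_mono[OF sub, of Z] by (simp, simp, simp, blast)
  have YZ: "Y i \<noteq> Z l" if "i \<in> {1..n}" "l \<in> {1..n}" for i l using that J(3) by blast
  have Yi: "Y i = Y l \<longleftrightarrow> i = l" and Zi: "Z i = Z l \<longleftrightarrow> i = l"
    if "i \<in> {1..n}" "l \<in> {1..n}" for i l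
    using that J(1,2) by (auto dest: inj_onD)
  have YW: "Y l \<in> W \<longleftrightarrow> l \<le> c" and ZW: "Z l \<in> W \<longleftrightarrow> l \<le> c" if "l \<in> {1..n}" for l
  proof -
    have mem: "x \<in> {1..n}" if "x \<in> {1..c}" for x using that sub by blast
    have l: "l \<in> {1..c} \<longleftrightarrow> l \<le> c" using that by simp
    have "Y l \<in> W \<longleftrightarrow> (\<exists>x\<in>{1..c}. Y l = Y x)"
      unfolding W_def using YZ[OF that mem] by blast
    then show "Y l \<in> W \<longleftrightarrow> l \<le> c" using Yi[OF that mem] l by metis
    have "Z l \<in> W \<longleftrightarrow> (\<exists>x\<in>{1..c}. Z l = Z x)"
      unfolding W_def using YZ[OF mem that, symmetric] by blast
    then show "Z l \<in> W \<longleftrightarrow> l \<le> c" using Zi[OF that mem] l by metis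
  qed
  have cc: "c \<in> {1..c}" "c \<in> {1..n}" using c by auto
  have kg: "polar {1..c} Y Z g M = 0" for M
  proof (cases "Q M (\<alpha> + 1) (\<beta> - 1) \<and> 0 < \<beta>")
    case True
    have tj: "(if 0 < M (Y j) then of_nat (M (Z j) + 1) * g (shift (Y j) (Z j) M) else 0) =
      (if 0 < lift M (Y j) then of_nat (lift M (Z j) + 1) * F (shift (Y j) (Z j) (lift M)) else 0)"
      if j: "j \<in> {1..c}" for j
    proof -
      have jn: "j \<in> {1..n}" using j sub by blast
      have lZ: "lift M (Z j) = M (Z j)" using ZW[OF jn] j YZ[OF cc(2) jn] by (auto simp: lift_def)
      have lY: "lift M (Y j) = M (Y j) + (if j = c then u (Y c) else 0)"
        using YW[OF jn] j Yi[OF jn cc(2)] by (auto simp: lift_def)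
      show ?thesis
      proof (cases "0 < M (Y j)")
        case pos: True
        have ls: "lift (shift (Y j) (Z j) M) = shift (Y j) (Z j) (lift M)"
        proof
          fix v
          show "lift (shift (Y j) (Z j) M) v = shift (Y j) (Z j) (lift M) v"
            using j jn YW[OF jn] ZW[OF jn] pos YZ[OF jn jn] YZ[OF cc(2) jn] Yi[OF jn cc(2)]
            by (auto simp: lift_def shift_def)
        qed
        have "Q (shift (Y j) (Z j) M) \<alpha> \<beta>"
        proof -
          have "shift (Y j) (Z j) M v = 0" if "v \<notin> W" for v
          proof -
            have "v \<noteq> Y j" "v \<noteq> Z j" using that j unfolding W_def by blast+
            then show ?thesis using True that unfolding Q_def by (simp add: shift_def)
          qed
          moreover have "(\<Sum>i\<in>{1..c}. shift (Y j) (Z j) M (Y i)) = \<alpha>"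
            using sum_shift(1)[of "{1..c}" Y Z j M, OF Jc(1,2,4) j pos] True unfolding Q_def by simp
          moreover have "(\<Sum>i\<in>{1..c}. shift (Y j) (Z j) M (Z i)) = \<beta>"
            using sum_shift(2)[of "{1..c}" Y Z j M, OF Jc(1,2,4) j pos Jc(3)] True
            unfolding Q_def by simp
          moreover have "shift (Y j) (Z j) M (Y c) + shift (Y j) (Z j) M (Z c) = M (Y c) + M (Z c)"
            using pos YZ[OF jn cc(2)] YZ[OF cc(2) jn] YZ[OF cc(2) cc(2)] Yi[OF jn cc(2)]
              Zi[OF jn cc(2)] by (auto simp: shift_def)
          ultimately show ?thesis using True unfolding Q_def by simp
        qed
        then show ?thesis using pos lZ lY by (simp add: g_def ls)
      next
        case z: False
        \<comment> \<open>This can only be column \<open>c\<close>, where the exponent left in \<open>M\<close> is \<open>0\<close>; the move would raise the exponent of \<open>Z\<^sub>c\<close> above that of \<open>u\<close>.\<close>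
        have "F (shift (Y j) (Z j) (lift M)) = 0" if "0 < lift M (Y j)"
        proof -
          have jc: "j = c" using that z lY by (auto split: if_splits)
          show ?thesis
          proof (rule top[OF cc(2)])
            show "shift (Y j) (Z j) (lift M) v = u v" if "v \<notin> Y ` {1..n} \<union> Z ` {1..n}" for v
            proof -
              have "v \<notin> W" "v \<noteq> Y j" "v \<noteq> Z j" using that sub jn unfolding W_def by blast+
              then show ?thesis by (simp add: shift_def lift_def)
            qed
            show "shift (Y j) (Z j) (lift M) (Z l) = u (Z l)" if "l \<in> {c<..n}" for l
            proof -
              have l: "l \<in> {1..n}" using that by auto
              then have "Z l \<notin> W" "Z l \<noteq> Y j" "Z l \<noteq> Z j"
                using ZW that jc YZ[OF jn l] Zi[OF jn l] by auto
              then show ?thesis by (simp add: shift_def lift_def)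
            qed
            have "M (Z c) = u (Z c)" using True z jc unfolding Q_def by simp
            then show "u (Z c) < shift (Y j) (Z j) (lift M) (Z c)"
              using lZ jc by (simp add: shift_def)
          qed
        qed
        then show ?thesis using z by simp
      qed
    qed
    \<comment> \<open>The terms of the later columns vanish: they belong to monomials that beat \<open>u\<close>.\<close>
    have rest: "(if 0 < lift M (Y j) then of_nat (lift M (Z j) + 1) * F (shift (Y j) (Z j) (lift M)) else 0) = 0"
      if j: "j \<in> {c<..n}" for j
    proof -
      have jn: "j \<in> {1..n}" using j by auto
      have "F (shift (Y j) (Z j) (lift M)) = 0"
      proof (rule top[OF jn])
        show "shift (Y j) (Z j) (lift M) v = u v" if "v \<notin> Y ` {1..n} \<union> Z ` {1..n}" for v
        proof -
          have "v \<notin> W" "v \<noteq> Y j" "v \<noteq> Z j" using that sub jn unfolding W_def by blast+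
          then show ?thesis by (simp add: shift_def lift_def)
        qed
        show "shift (Y j) (Z j) (lift M) (Z l) = u (Z l)" if "l \<in> {j<..n}" for l
        proof -
          have l: "l \<in> {1..n}" using that by auto
          then have "Z l \<notin> W" "Z l \<noteq> Y j" "Z l \<noteq> Z j"
            using ZW that j YZ[OF jn l] Zi[OF jn l] by auto
          then show ?thesis by (simp add: shift_def lift_def)
        qed
        show "u (Z j) < shift (Y j) (Z j) (lift M) (Z j)"
          using ZW[OF jn] j by (simp add: shift_def lift_def)
      qed
      then show ?thesis by simp
    qed
    have "polar {1..c} Y Z g M = (\<Sum>j=1..c. if 0 < lift M (Y j)
        then of_nat (lift M (Z j) + 1) * F (shift (Y j) (Z j) (lift M)) else 0)"
      unfolding polar_def by (intro sum.cong refl tj)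
    also have "\<dots> = polar {1..n} Y Z F (lift M)"
      unfolding polar_def
    proof (intro sum.mono_neutral_left ballI)
      show "(if 0 < lift M (Y j) then of_nat (lift M (Z j) + 1) * F (shift (Y j) (Z j) (lift M)) else 0) = 0"
        if "j \<in> {1..n} - {1..c}" for j
        by (rule rest) (use that in auto)
    qed (use sub in auto)
    finally show ?thesis using ker by simp
  next
    case False
    have "g (shift (Y j) (Z j) M) = 0" if j: "j \<in> {1..c}" and pos: "0 < M (Y j)" for j
    proof (rule ccontr)
      have jn: "j \<in> {1..n}" using j sub by blast
      assume "g (shift (Y j) (Z j) M) \<noteq> 0"
      then have q: "Q (shift (Y j) (Z j) M) \<alpha> \<beta>" by (auto simp: g_def split: if_splits)
      have "M v = 0" if "v \<notin> W" for v
      proof -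
        have "v \<noteq> Y j" "v \<noteq> Z j" using that j unfolding W_def by blast+
        then have "shift (Y j) (Z j) M v = M v" by (simp add: shift_def)
        then show ?thesis using q that unfolding Q_def by simp
      qed
      moreover have "(\<Sum>i\<in>{1..c}. M (Y i)) = \<alpha> + 1"
        using sum_shift(1)[of "{1..c}" Y Z j M, OF Jc(1,2,4) j pos] q unfolding Q_def by simp
      moreover have "(\<Sum>i\<in>{1..c}. M (Z i)) + 1 = \<beta>"
        using sum_shift(2)[of "{1..c}" Y Z j M, OF Jc(1,2,4) j pos Jc(3)] q
        unfolding Q_def by simp
      moreover have "shift (Y j) (Z j) M (Y c) + shift (Y j) (Z j) M (Z c) = M (Y c) + M (Z c)"
        using pos YZ[OF jn cc(2)] YZ[OF cc(2) jn] YZ[OF cc(2) cc(2)] Yi[OF jn cc(2)]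
          Zi[OF jn cc(2)] by (auto simp: shift_def)
      ultimately show False using False q unfolding Q_def by auto
    qed
    then show ?thesis unfolding polar_def by (intro sum.neutral) auto
  qed
  have dg: "(\<Sum>j=1..c. M (Y j)) = \<alpha> \<and> (\<Sum>j=1..c. M (Z j)) = \<beta>" if "g M \<noteq> 0" for M
    using that unfolding g_def Q_def by (auto split: if_splits)
  define u0 where "u0 v = (if v \<in> W \<and> v \<noteq> Y c then u v else 0)" for v
  have z: "g u0 = 0" by (rule polar_kernel_zero[OF Jc kg dg less])
  have "lift u0 = u" by (rule ext) (use YW[OF cc(2)] in \<open>auto simp: lift_def u0_def\<close>)
  moreover have "Q u0 \<alpha> \<beta>"
  proof -
    have "(\<Sum>j=1..c. u0 (Z j)) = \<beta>"
      unfolding \<beta>_def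
    proof (intro sum.cong refl)
      fix j assume "j \<in> {1..c}"
      then have "j \<in> {1..n}" "j \<le> c" using sub by auto
      then show "u0 (Z j) = u (Z j)" using ZW[of j] YZ[OF cc(2), of j] by (auto simp: u0_def)
    qed
    moreover have "(\<Sum>j=1..c. u0 (Y j)) = \<alpha>"
    proof -
      have "{1..c} = insert c {1..<c}" using c by auto
      then have "(\<Sum>j=1..c. u0 (Y j)) = u0 (Y c) + (\<Sum>j=1..<c. u0 (Y j))" by simp
      also have "\<dots> = \<alpha>"
        unfolding \<alpha>_def
      proof -
        have "u0 (Y j) = u (Y j)" if "j \<in> {1..<c}" for j
        proof -
          have "j \<in> {1..n}" "j \<le> c" "j \<noteq> c" using that sub by auto
          then show ?thesis using YW[of j] Yi[OF _ cc(2), of j] by (auto simp: u0_def)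
        qed
        then show "u0 (Y c) + (\<Sum>j=1..<c. u0 (Y j)) = (\<Sum>j=1..<c. u (Y j))"
          by (simp add: u0_def)
      qed
      finally show ?thesis .
    qed
    moreover have "u0 (Y c) + u0 (Z c) = u (Z c)"
      using ZW[OF cc(2)] YZ[OF cc(2) cc(2)] by (auto simp: u0_def)
    ultimately show ?thesis unfolding Q_def by (auto simp: u0_def)
  qed
  ultimately show False using z Fu unfolding g_def by simp
qed

section \<open>Derivations that replace one row by another\<close>

lemma cpoly_sum_single: "f = (\<Sum>\<alpha>\<in>Poly_Mapping.keys f. Poly_Mapping.single \<alpha> (lk f \<alpha>))"
proof (rule poly_mapping_eqI)
  fix \<beta>
  have "(\<Sum>\<alpha>\<in>Poly_Mapping.keys f. lk f \<alpha> when \<alpha> = \<beta>) = lk f \<beta>"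
    by (cases "\<beta> \<in> Poly_Mapping.keys f") (auto simp: when_def in_keys_iff sum.delta)
  then show "lk f \<beta> = lk (\<Sum>\<alpha>\<in>Poly_Mapping.keys f. Poly_Mapping.single \<alpha> (lk f \<alpha>)) \<beta>"
    by (simp add: lookup_sum lookup_single)
qed

lemma cpoly_induct [case_names single add]:
  assumes "\<And>\<alpha> c. P (Poly_Mapping.single \<alpha> c)" "\<And>f g. P f \<Longrightarrow> P g \<Longrightarrow> P (f + g)"
  shows "P (f :: 'v cpoly)"
proof -
  have "P (\<Sum>\<alpha>\<in>S. Poly_Mapping.single \<alpha> (lk f \<alpha>))" if "finite S" for S
    using that
  proof (induction S)
    case empty
    then show ?case using assms(1)[of 0 0] by simp
  qed (auto intro: assms)
  from this[of "Poly_Mapping.keys f"] show ?thesis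
    using cpoly_sum_single[of f] by simp
qed

lemma Const_add: "Const (a + b) = Const a + Const b"
  and Const_mult: "Const (a * b) = Const a * Const b"
  and Const_0: "Const 0 = 0" and Const_1: "Const 1 = 1"
  and Const_minus: "Const (- a) = - Const a"
  by (simp_all add: Const_def single_add mult_single single_uminus)

lemma lookup_Const_mult: "lk (Const c * p) \<gamma> = c * lk p \<gamma>"
  unfolding Const_def
  by (induction p rule: cpoly_induct) (auto simp: mult_single lookup_single when_def distrib_left lookup_add)

lemma keys_Const_mult: "c \<noteq> 0 \<Longrightarrow> Poly_Mapping.keys (Const c * p) = Poly_Mapping.keys p"
  by (auto simp: in_keys_iff lookup_Const_mult)

lemma keys_Const_mult_subset: "Poly_Mapping.keys (Const c * p) \<subseteq> Poly_Mapping.keys p"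
  by (auto simp: in_keys_iff lookup_Const_mult)

lemma minus_one_power_Const: "(-1) ^ N = Const ((-1) ^ N)"
  by (cases "even N") (simp_all add: Const_1 Const_minus)

definition lin_ext :: "('v monom \<Rightarrow> 'w cpoly) \<Rightarrow> 'v cpoly \<Rightarrow> 'w cpoly" where
  "lin_ext d f = (\<Sum>\<alpha>\<in>Poly_Mapping.keys f. Const (lk f \<alpha>) * d \<alpha>)"

lemma single_Const: "Poly_Mapping.single \<alpha> c = Const c * Poly_Mapping.single \<alpha> 1"
  by (simp add: Const_def mult_single)

lemma lin_ext_superset:
  "finite S \<Longrightarrow> Poly_Mapping.keys f \<subseteq> S \<Longrightarrow> lin_ext d f = (\<Sum>\<alpha>\<in>S. Const (lk f \<alpha>) * d \<alpha>)"
  unfolding lin_ext_def by (rule sum.mono_neutral_left) (auto simp: in_keys_iff Const_0)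

lemma lin_ext_add: "lin_ext d (f + g) = lin_ext d f + lin_ext d g"
proof -
  let ?S = "Poly_Mapping.keys f \<union> Poly_Mapping.keys g"
  have S: "finite ?S" "Poly_Mapping.keys (f + g) \<subseteq> ?S" using Poly_Mapping.keys_add[of f g] by auto
  show ?thesis
    unfolding lin_ext_superset[OF S] lin_ext_superset[OF S(1) Un_upper1] lin_ext_superset[OF S(1) Un_upper2]
    by (simp add: lookup_add Const_add distrib_right sum.distrib)
qed

lemma lin_ext_single: "lin_ext d (Poly_Mapping.single \<alpha> c) = Const c * d \<alpha>"
  by (simp add: lin_ext_def Const_0)

lemma lin_ext_0: "lin_ext d 0 = 0" by (simp add: lin_ext_def)

lemma lin_ext_scale: "lin_ext d (Const c * f) = Const c * lin_ext d f"
proof (induction f rule: cpoly_induct)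
  case (single \<alpha> b)
  have "Const c * Poly_Mapping.single \<alpha> b = Poly_Mapping.single \<alpha> (c * b)"
    by (simp add: Const_def mult_single)
  then show ?case by (simp add: lin_ext_single Const_mult mult.assoc)
next
  case (add f g)
  then show ?case by (simp add: lin_ext_add distrib_left)
qed

lemma lin_ext_uminus: "lin_ext d (- f) = - lin_ext d f"
  using lin_ext_scale[of d "-1" f] by (simp add: Const_minus Const_1)

lemma lin_ext_sum: "lin_ext d (\<Sum>i\<in>S. f i) = (\<Sum>i\<in>S. lin_ext d (f i))"
  by (induction S rule: infinite_finite_induct) (simp_all add: lin_ext_0 lin_ext_add)

lemma lin_ext_Leibniz:
  assumes d: "\<And>\<alpha> \<beta>. d (\<alpha> + \<beta>) = d \<alpha> * Poly_Mapping.single \<beta> 1 + Poly_Mapping.single \<alpha> 1 * d \<beta>"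
  shows "lin_ext d (f * g) = lin_ext d f * g + f * lin_ext d g"
proof (induction f rule: cpoly_induct)
  case (single \<alpha> a)
  show ?case
  proof (induction g rule: cpoly_induct)
    case (single \<beta> b)
    show ?case
      unfolding mult_single lin_ext_single d
      unfolding single_Const[of \<alpha> a] single_Const[of \<beta> b] Const_mult
      by (simp only: algebra_simps)
  next
    case (add f g)
    then show ?case by (simp add: lin_ext_add algebra_simps)
  qed
next
  case (add f g)
  then show ?case by (simp add: lin_ext_add algebra_simps)
qed

text \<open>The derivation \<open>\<Sum>j. x\<^sub>y\<^sub>j \<partial>/\<partial>x\<^sub>z\<^sub>j\<close>.  If \<open>x\<^sub>z\<^sub>j\<close> does not occur in a monomial, the truncated
  subtraction is harmless because the coefficient vanishes.\<close>

definition row_der :: "nat \<Rightarrow> nat \<Rightarrow> nat \<Rightarrow> (nat \<times> nat) cpoly \<Rightarrow> (nat \<times> nat) cpoly" where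
  "row_der n z y = lin_ext (\<lambda>\<alpha>. \<Sum>j=1..n. Const (of_nat (lk \<alpha> (z, j))) *
     Poly_Mapping.single (\<alpha> - Poly_Mapping.single (z, j) 1 + Poly_Mapping.single (y, j) 1) 1)"

lemma row_der_mult: "row_der n z y (f * g) = row_der n z y f * g + f * row_der n z y g"
  unfolding row_der_def
proof (rule lin_ext_Leibniz)
  fix \<alpha> \<beta> :: "(nat \<times> nat) monom"
  let ?m = "\<lambda>\<alpha> j. \<alpha> - Poly_Mapping.single (z, j) 1 + Poly_Mapping.single (y, j) 1"
  let ?d = "\<lambda>\<alpha> j. Const (of_nat (lk \<alpha> (z, j))) * Poly_Mapping.single (?m \<alpha> j) 1"
  have move: "?d \<alpha> j * Poly_Mapping.single \<beta> 1 =
      Const (of_nat (lk \<alpha> (z, j))) * Poly_Mapping.single (?m (\<alpha> + \<beta>) j) 1" for \<alpha> \<beta> j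
  proof (cases "lk \<alpha> (z, j) = 0")
    case True
    then show ?thesis by (simp add: Const_0)
  next
    case False
    have "?m (\<alpha> + \<beta>) j = ?m \<alpha> j + \<beta>"
      using False
      by (intro poly_mapping_eqI) (auto simp: lookup_add lookup_minus lookup_single when_def)
    then show ?thesis by (simp add: mult_single mult.assoc)
  qed
  have "?d (\<alpha> + \<beta>) j = ?d \<alpha> j * Poly_Mapping.single \<beta> 1 + Poly_Mapping.single \<alpha> 1 * ?d \<beta> j" for j
    unfolding move mult.commute[of "Poly_Mapping.single \<alpha> 1"] add.commute[of \<beta> \<alpha>]
    by (simp add: lookup_add Const_add distrib_right)
  then show "(\<Sum>j=1..n. ?d (\<alpha> + \<beta>) j) =
      (\<Sum>j=1..n. ?d \<alpha> j) * Poly_Mapping.single \<beta> 1 + Poly_Mapping.single \<alpha> 1 * (\<Sum>j=1..n. ?d \<beta> j)"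
    by (simp add: sum_distrib_left sum_distrib_right sum.distrib)
qed

lemma row_der_add: "row_der n z y (f + g) = row_der n z y f + row_der n z y g"
  unfolding row_der_def by (rule lin_ext_add)

lemma row_der_scale: "row_der n z y (Const c * f) = Const c * row_der n z y f"
  unfolding row_der_def by (rule lin_ext_scale)

lemma row_der_Const: "row_der n z y (Const c) = 0"
  unfolding row_der_def Const_def[of c] lin_ext_single by (simp add: Const_0)

lemma row_der_Var:
  assumes "j \<in> {1..n}"
  shows "row_der n z y (Var (i, j)) = (if i = z then Var (y, j) else 0)"
proof -
  have "row_der n z y (Var (i, j)) = (\<Sum>l=1..n. if l = j then (if i = z then Var (y, j) else 0) else 0)"
    unfolding row_der_def Var_def[of "(i, j)"] lin_ext_single
    by (simp only: Const_1 mult_1_left, intro sum.cong refl)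
      (auto simp: lookup_single when_def Const_0 Const_1 Var_def)
  then show ?thesis using assms by (simp add: sum.delta)
qed

lemma row_der_prod_zero:
  assumes "finite S" "\<And>a. a \<in> S \<Longrightarrow> row_der n z y (f a) = 0"
  shows "row_der n z y (\<Prod>a\<in>S. f a) = 0"
  using assms
proof (induction S)
  case empty
  then show ?case using row_der_Const[of n z y 1] by (simp add: Const_1)
qed (simp add: row_der_mult)

lemma row_der_prod_Var:
  assumes "finite S" "inj_on f S" "\<And>a. a \<in> S \<Longrightarrow> e a \<in> {1..n}" "z \<in> f ` S"
  shows "row_der n z y (\<Prod>a\<in>S. Var (f a, e a)) = (\<Prod>a\<in>S. Var (if f a = z then y else f a, e a))"
proof -
  obtain s where s: "s \<in> S" "f s = z" using assms(4) by blast
  have ne: "f a \<noteq> z" if "a \<in> S - {s}" for a using that s assms(2) by (auto dest: inj_onD)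
  have "(\<Prod>a\<in>S. Var (f a, e a)) = Var (z, e s) * (\<Prod>a\<in>S - {s}. Var (f a, e a))"
    using prod.remove[OF assms(1) s(1), of "\<lambda>a. Var (f a, e a)"] s(2) by simp
  moreover have "row_der n z y (\<Prod>a\<in>S - {s}. Var (f a, e a)) = 0"
    using assms(1,3) ne by (intro row_der_prod_zero) (auto simp: row_der_Var)
  ultimately have "row_der n z y (\<Prod>a\<in>S. Var (f a, e a)) = Var (y, e s) * (\<Prod>a\<in>S - {s}. Var (f a, e a))"
    using assms(3)[OF s(1)] by (simp add: row_der_mult row_der_Var)
  also have "\<dots> = Var (y, e s) * (\<Prod>a\<in>S - {s}. Var (if f a = z then y else f a, e a))"
    using ne by (intro arg_cong2[of _ _ _ _ "(*)"] prod.cong) auto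
  also have "\<dots> = (\<Prod>a\<in>S. Var (if f a = z then y else f a, e a))"
    using prod.remove[OF assms(1) s(1), of "\<lambda>a. Var (if f a = z then y else f a, e a)"] s(2) by simp
  finally show ?thesis .
qed

lemma bij_betw_nth_elem:
  assumes "finite A" shows "bij_betw (nth_elem A) {..<card A} A"
  unfolding nth_elem_def
  using assms by (intro bij_betw_nth) simp_all

text \<open>Only the factor from row \<open>z\<close> is affected in each term of the determinant, so the result is the
  determinant with row \<open>z\<close> replaced by row \<open>y\<close>, which then occurs twice.\<close>

lemma row_der_minor:
  assumes A: "finite A" and B: "B \<subseteq> {1..n}" "card A = card B"
    and zy: "z \<in> A \<Longrightarrow> y \<in> A" "z \<noteq> y"
  shows "row_der n z y (minor A B) = 0"
proof -
  let ?N = "card A"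
  have fB: "finite B" using B finite_subset by auto
  have bA: "bij_betw (nth_elem A) {..<?N} A" and bB: "bij_betw (nth_elem B) {..<?N} B"
    using bij_betw_nth_elem[OF A] bij_betw_nth_elem[OF fB] B(2) by auto
  let ?P = "{p. p permutes {0..<?N}}"
  let ?f = "\<lambda>a. if nth_elem A a = z then y else nth_elem A a"
  have Nb: "nth_elem B b \<in> {1..n}" if "b < ?N" for b using that bij_betwE[OF bB] B(1) by blast
  have mm: "minor A B = (\<Sum>p\<in>?P. signof p * (\<Prod>a\<in>{0..<?N}. Var (nth_elem A a, nth_elem B (p a))))"
    unfolding minor_def Determinant.det_def using B(2)
    by (auto intro!: sum.cong prod.cong arg_cong2[of _ _ _ _ "(*)"])
  have sg: "row_der n z y (signof p * q) = signof p * row_der n z y q" for p :: "nat \<Rightarrow> nat" and q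
    using lin_ext_uminus unfolding row_der_def by (cases p rule: sign_cases) simp_all
  have "row_der n z y (minor A B) = (\<Sum>p\<in>?P. signof p * row_der n z y (\<Prod>a\<in>{0..<?N}. Var (nth_elem A a, nth_elem B (p a))))"
    unfolding mm sg[symmetric] unfolding row_der_def lin_ext_sum ..
  also have "\<dots> = 0"
  proof (cases "z \<in> A")
    case False
    have "row_der n z y (\<Prod>a\<in>{0..<?N}. Var (nth_elem A a, nth_elem B (p a))) = 0" if "p \<in> ?P" for p
    proof (rule row_der_prod_zero)
      fix a assume a: "a \<in> {0..<?N}"
      have "p a < ?N" using that a permutes_in_image[of p "{0..<?N}" a] by auto
      moreover have "nth_elem A a \<noteq> z" using a bA False by (auto simp: bij_betw_def)
      ultimately show "row_der n z y (Var (nth_elem A a, nth_elem B (p a))) = 0"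
        using Nb by (simp add: row_der_Var)
    qed simp
    then show ?thesis by simp
  next
    case True
    let ?M = "mat ?N ?N (\<lambda>(a, b). Var (?f a, nth_elem B b))"
    have "row_der n z y (\<Prod>a\<in>{0..<?N}. Var (nth_elem A a, nth_elem B (p a))) =
        (\<Prod>a\<in>{0..<?N}. Var (?f a, nth_elem B (p a)))" if "p \<in> ?P" for p
    proof (rule row_der_prod_Var)
      show "inj_on (nth_elem A) {0..<?N}" "z \<in> nth_elem A ` {0..<?N}"
        using bA True by (auto simp: bij_betw_def atLeast0LessThan)
      fix a assume a: "a \<in> {0..<?N}"
      have "p a < ?N" using that a permutes_in_image[of p "{0..<?N}" a] by auto
      then show "nth_elem B (p a) \<in> {1..n}" by (rule Nb)
    qed simp
    then have "(\<Sum>p\<in>?P. signof p * row_der n z y (\<Prod>a\<in>{0..<?N}. Var (nth_elem A a, nth_elem B (p a)))) =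
        (\<Sum>p\<in>?P. signof p * (\<Prod>a\<in>{0..<?N}. Var (?f a, nth_elem B (p a))))"
      by (intro sum.cong refl) simp
    also have "\<dots> = det ?M"
      unfolding Determinant.det_def
      by (auto intro!: sum.cong prod.cong arg_cong2[of _ _ _ _ "(*)"])
    also have "det ?M = 0"
    proof -
      obtain s t where s: "s < ?N" "nth_elem A s = z" and t: "t < ?N" "nth_elem A t = y"
        using bA True zy(1)[OF True] unfolding bij_betw_def by (metis imageE lessThan_iff)
      have "s \<noteq> t" using s t zy(2) by auto
      moreover have "row ?M s = row ?M t" using s t by (intro eq_vecI) auto
      ultimately show ?thesis using s t by (intro det_identical_rows[of ?M ?N s t]) auto
    qed
    finally show ?thesis .
  qed
  finally show ?thesis .
qed

text \<open>The coefficients of a polynomial, indexed by exponent functions instead of finitely supported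
  maps; this links \<open>row_der\<close> to \<open>polar\<close>.\<close>

definition coeff_at :: "'v cpoly \<Rightarrow> ('v \<Rightarrow> nat) \<Rightarrow> complex" where
  "coeff_at f M = (if finite {v. M v \<noteq> 0} then lk f (Abs_poly_mapping M) else 0)"

lemma coeff_at_lookup: "coeff_at f (lk \<alpha>) = lk f \<alpha>"
  by (simp add: coeff_at_def)

lemma coeff_at_cases:
  obtains \<alpha> where "M = lk \<alpha>" "coeff_at f M = lk f \<alpha>" | "infinite {v. M v \<noteq> 0}" "coeff_at f M = 0"
proof (cases "finite {v. M v \<noteq> 0}")
  case True
  then have "M = lk (Abs_poly_mapping M)" by simp
  then show ?thesis using that(1) coeff_at_lookup by metis
qed (use that(2) in \<open>simp add: coeff_at_def\<close>)

lemma polar_coeff_at: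
  assumes "z \<noteq> y"
  shows "polar {1..n} (\<lambda>j. (y, j)) (\<lambda>j. (z, j)) (coeff_at f) M = coeff_at (row_der n z y f) M"
proof (cases M rule: coeff_at_cases[of _ "row_der n z y f"])
  case 2
  have "coeff_at f (shift (y, j) (z, j) M) = 0" for j
  proof -
    have "{v. M v \<noteq> 0} \<subseteq> insert (y, j) {v. shift (y, j) (z, j) M v \<noteq> 0}" by (auto simp: shift_def)
    then have "infinite {v. shift (y, j) (z, j) M v \<noteq> 0}"
      using 2(1) finite_subset by blast
    then show ?thesis by (simp add: coeff_at_def)
  qed
  then show ?thesis using 2(2) unfolding polar_def by (simp add: sum.neutral)
next
  case (1 \<beta>)
  let ?m = "\<lambda>\<alpha> j. \<alpha> - Poly_Mapping.single (z, j) 1 + Poly_Mapping.single (y, j) (1::nat)"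
  let ?b = "\<lambda>j. \<beta> - Poly_Mapping.single (y, j) 1 + Poly_Mapping.single (z, j) (1::nat)"
  have inner: "(\<Sum>\<alpha>\<in>Poly_Mapping.keys f. lk f \<alpha> * (of_nat (lk \<alpha> (z, j)) * (if ?m \<alpha> j = \<beta> then 1 else 0))) =
      (if 0 < lk \<beta> (y, j) then of_nat (lk \<beta> (z, j) + 1) * lk f (?b j) else 0)" for j
  proof -
    have "of_nat (lk \<alpha> (z, j)) * (if ?m \<alpha> j = \<beta> then 1 else 0) =
        (if \<alpha> = ?b j then (if 0 < lk \<beta> (y, j) then of_nat (lk \<beta> (z, j) + 1) else 0) else 0 :: complex)" for \<alpha>
    proof (cases "lk \<alpha> (z, j) = 0")
      case True
      have "\<alpha> \<noteq> ?b j"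
      proof
        assume "\<alpha> = ?b j"
        then have "lk \<alpha> (z, j) = lk (?b j) (z, j)" by simp
        then show False using True by (simp add: lookup_add)
      qed
      then show ?thesis using True by simp
    next
      case False
      have "?m \<alpha> j = \<beta> \<longleftrightarrow> \<alpha> = ?b j \<and> 0 < lk \<beta> (y, j)"
      proof
        assume e: "?m \<alpha> j = \<beta>"
        have "\<alpha> = ?b j"
          unfolding e[symmetric] using False assms
          by (intro poly_mapping_eqI) (auto simp: lookup_add lookup_minus lookup_single when_def)
        moreover have "0 < lk \<beta> (y, j)" unfolding e[symmetric] by (simp add: lookup_add)
        ultimately show "\<alpha> = ?b j \<and> 0 < lk \<beta> (y, j)" by blast
      next
        assume e: "\<alpha> = ?b j \<and> 0 < lk \<beta> (y, j)"
        then have p: "0 < lk \<beta> (y, j)" and a: "\<alpha> = ?b j" by blast+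
        show "?m \<alpha> j = \<beta>"
          unfolding a using p assms
          by (intro poly_mapping_eqI) (auto simp: lookup_add lookup_minus lookup_single when_def)
      qed
      moreover have "lk \<alpha> (z, j) = lk \<beta> (z, j) + 1" if "\<alpha> = ?b j"
        unfolding that using assms by (simp add: lookup_add lookup_minus lookup_single when_def)
      ultimately show ?thesis by auto
    qed
    then have "(\<Sum>\<alpha>\<in>Poly_Mapping.keys f. lk f \<alpha> * (of_nat (lk \<alpha> (z, j)) * (if ?m \<alpha> j = \<beta> then 1 else 0))) =
        (\<Sum>\<alpha>\<in>Poly_Mapping.keys f. if \<alpha> = ?b j then lk f (?b j) * (if 0 < lk \<beta> (y, j) then of_nat (lk \<beta> (z, j) + 1) else 0) else 0)"
      by (intro sum.cong refl) auto
    also have "\<dots> = lk f (?b j) * (if 0 < lk \<beta> (y, j) then of_nat (lk \<beta> (z, j) + 1) else 0)"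
      by (cases "?b j \<in> Poly_Mapping.keys f") (auto simp: sum.delta in_keys_iff)
    finally show ?thesis by (simp add: mult.commute)
  qed
  have "lk (row_der n z y f) \<beta> = (\<Sum>\<alpha>\<in>Poly_Mapping.keys f. lk f \<alpha> * (\<Sum>j=1..n.
      of_nat (lk \<alpha> (z, j)) * (if ?m \<alpha> j = \<beta> then 1 else 0)))"
    unfolding row_der_def lin_ext_def lookup_sum lookup_Const_mult lookup_single when_def ..
  also have "\<dots> = (\<Sum>j=1..n. \<Sum>\<alpha>\<in>Poly_Mapping.keys f. lk f \<alpha> *
      (of_nat (lk \<alpha> (z, j)) * (if ?m \<alpha> j = \<beta> then 1 else 0)))"
    unfolding sum_distrib_left by (rule sum.swap)
  also have "\<dots> = (\<Sum>j=1..n. if 0 < lk \<beta> (y, j) then of_nat (lk \<beta> (z, j) + 1) * lk f (?b j) else 0)"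
    unfolding inner ..
  also have "\<dots> = polar {1..n} (\<lambda>j. (y, j)) (\<lambda>j. (z, j)) (coeff_at f) M"
  proof -
    have "shift (y, j) (z, j) (lk \<beta>) = lk (?b j)" for j
      using assms by (auto simp: fun_eq_iff shift_def lookup_add lookup_minus lookup_single when_def)
    then have "coeff_at f (shift (y, j) (z, j) M) = lk f (?b j)" for j
      unfolding 1(1) using coeff_at_lookup by metis
    then show ?thesis unfolding polar_def 1(1) by (intro sum.cong refl) simp
  qed
  finally show ?thesis using 1(2) by simp
qed

lemma polar_reindex:
  assumes "bij_betw \<tau> J J"
  shows "polar J (\<lambda>j. Y (\<tau> j)) (\<lambda>j. Z (\<tau> j)) g M = polar J Y Z g M"
  unfolding polar_def
  by (rule sum.reindex_bij_betw[OF assms, of "\<lambda>j. if 0 < M (Y j) then of_nat (M (Z j) + 1) * g (shift (Y j) (Z j) M) else 0"])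

section \<open>Leading monomials\<close>

definition is_top :: "('v monom \<Rightarrow> 'v monom \<Rightarrow> bool) \<Rightarrow> 'v cpoly \<Rightarrow> 'v monom \<Rightarrow> bool" where
  "is_top lt f u \<longleftrightarrow> u \<in> Poly_Mapping.keys f \<and> (\<forall>v\<in>Poly_Mapping.keys f. v \<noteq> u \<longrightarrow> lt v u)"

lemma term_orderD:
  assumes "term_order V lt"
  shows "\<alpha> \<in> monoms V \<Longrightarrow> \<not> lt \<alpha> \<alpha>"
    and "\<alpha> \<in> monoms V \<Longrightarrow> \<beta> \<in> monoms V \<Longrightarrow> \<gamma> \<in> monoms V \<Longrightarrow> lt \<alpha> \<beta> \<Longrightarrow> lt \<beta> \<gamma> \<Longrightarrow> lt \<alpha> \<gamma>"
    and "\<alpha> \<in> monoms V \<Longrightarrow> \<beta> \<in> monoms V \<Longrightarrow> \<alpha> \<noteq> \<beta> \<Longrightarrow> lt \<alpha> \<beta> \<or> lt \<beta> \<alpha>"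
    and "\<alpha> \<in> monoms V \<Longrightarrow> \<beta> \<in> monoms V \<Longrightarrow> \<gamma> \<in> monoms V \<Longrightarrow> lt \<alpha> \<beta> \<Longrightarrow> lt (\<alpha> + \<gamma>) (\<beta> + \<gamma>)"
  using assms unfolding term_order_def irreflp_on_def transp_on_def totalp_on_def by blast+

lemma finite_has_top:
  assumes lt: "term_order V lt" and S: "finite S" "S \<noteq> {}" "S \<subseteq> monoms V"
  shows "\<exists>u\<in>S. \<forall>v\<in>S. v \<noteq> u \<longrightarrow> lt v u"
proof -
  have "\<exists>v\<in>S. \<forall>w. lt v w \<and> v \<in> monoms V \<and> w \<in> monoms V \<longrightarrow> w \<notin> S"
    by (rule finite_minimal[of "\<lambda>w v. lt v w \<and> v \<in> monoms V \<and> w \<in> monoms V"])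
      (use term_orderD(1,2)[OF lt] S in blast)+
  then obtain u where u: "u \<in> S" "\<And>w. lt u w \<Longrightarrow> w \<in> S \<Longrightarrow> False" using S(3) by blast
  show ?thesis
  proof (intro bexI[of _ u] ballI impI)
    fix v assume "v \<in> S" "v \<noteq> u"
    then show "lt v u" using term_orderD(3)[OF lt, of v u] u S(3) by blast
  qed (rule u(1))
qed

lemma ex_is_top:
  assumes "term_order V lt" "f \<noteq> 0" "Poly_Mapping.keys f \<subseteq> monoms V"
  shows "\<exists>u. is_top lt f u"
proof -
  have "Poly_Mapping.keys f \<noteq> {}" using assms(2) by simp
  from finite_has_top[OF assms(1) finite_keys this assms(3)] show ?thesis
    unfolding is_top_def by blast
qed

lemma init_is_top:
  assumes lt: "term_order V lt" and f: "Poly_Mapping.keys f \<subseteq> monoms V" and u: "is_top lt f u"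
  shows "init lt f = Poly_Mapping.single u 1"
proof -
  have "(THE \<alpha>. \<alpha> \<in> Poly_Mapping.keys f \<and> (\<forall>\<beta>\<in>Poly_Mapping.keys f. \<beta> \<noteq> \<alpha> \<longrightarrow> lt \<beta> \<alpha>)) = u"
  proof (rule the_equality)
    fix v assume v: "v \<in> Poly_Mapping.keys f \<and> (\<forall>\<beta>\<in>Poly_Mapping.keys f. \<beta> \<noteq> v \<longrightarrow> lt \<beta> v)"
    show "v = u"
    proof (rule ccontr)
      assume "v \<noteq> u"
      have ku: "u \<in> Poly_Mapping.keys f" and kv: "v \<in> Poly_Mapping.keys f"
        using u v by (simp_all add: is_top_def)
      have vu: "lt v u" "lt u v"
        using u v ku kv \<open>v \<noteq> u\<close> by (simp_all add: is_top_def)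
      have m: "v \<in> monoms V" "u \<in> monoms V" using f ku kv by (simp_all add: subsetD)
      from term_orderD(2)[OF lt m(1,2,1) vu] term_orderD(1)[OF lt m(1)] show False by blast
    qed
  qed (use u in \<open>simp add: is_top_def\<close>)
  then show ?thesis unfolding init_def by simp
qed

lemma monoms_add: "\<alpha> \<in> monoms V \<Longrightarrow> \<beta> \<in> monoms V \<Longrightarrow> \<alpha> + \<beta> \<in> monoms V"
  unfolding monoms_def using Poly_Mapping.keys_add[of \<alpha> \<beta>] by auto

lemma is_top_mult:
  assumes lt: "term_order V lt"
    and f: "Poly_Mapping.keys f \<subseteq> monoms V" "is_top lt f u"
    and g: "Poly_Mapping.keys g \<subseteq> monoms V" "is_top lt g v"
  shows "is_top lt (f * g) (u + v)"
proof -
  have le: "(a, b) = (u, v) \<or> lt (a + b) (u + v)" if "a \<in> Poly_Mapping.keys f" "b \<in> Poly_Mapping.keys g" for a b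
  proof -
    have m: "a \<in> monoms V" "b \<in> monoms V" "u \<in> monoms V" "v \<in> monoms V"
      using that f g unfolding is_top_def by auto
    have a: "a = u \<or> lt a u" and b: "b = v \<or> lt b v" using that f(2) g(2) unfolding is_top_def by blast+
    have 1: "lt (a + b) (u + b)" if "lt a u" using term_orderD(4)[OF lt m(1,3,2) that] .
    have 2: "lt (u + b) (u + v)" if "lt b v"
      using term_orderD(4)[OF lt m(2,4,3) that] by (simp add: add.commute)
    have 3: "lt (a + b) (u + v)" if "lt a u" "lt b v"
      using term_orderD(2)[OF lt _ _ _ 1[OF that(1)] 2[OF that(2)]] m by (simp add: monoms_add)
    show ?thesis using a b 1 2 3 by blast
  qed
  have ir: "\<not> lt (u + v) (u + v)"
    using term_orderD(1)[OF lt] f g unfolding is_top_def by (meson monoms_add subsetD)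
  let ?f = "f - Poly_Mapping.single u (lk f u)" and ?g = "g - Poly_Mapping.single v (lk g v)"
  have kf: "Poly_Mapping.keys ?f = Poly_Mapping.keys f - {u}" and kg: "Poly_Mapping.keys ?g = Poly_Mapping.keys g - {v}"
    by (auto simp: in_keys_iff lookup_minus lookup_single when_def split: if_splits)
  have "u + v \<notin> Poly_Mapping.keys (?f * g)"
  proof
    assume "u + v \<in> Poly_Mapping.keys (?f * g)"
    then obtain a b where ab: "u + v = a + b" "a \<in> Poly_Mapping.keys ?f" "b \<in> Poly_Mapping.keys g"
      using Poly_Mapping.keys_mult[of ?f g] by blast
    then have "(a, b) = (u, v) \<or> lt (a + b) (u + v)" unfolding kf by (intro le) auto
    then show False using ab(1,2) kf ir by auto
  qed
  moreover have "u + v \<notin> Poly_Mapping.keys (Poly_Mapping.single u (lk f u) * ?g)"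
  proof
    assume "u + v \<in> Poly_Mapping.keys (Poly_Mapping.single u (lk f u) * ?g)"
    then obtain a b where ab: "u + v = a + b" "a \<in> Poly_Mapping.keys (Poly_Mapping.single u (lk f u))" "b \<in> Poly_Mapping.keys ?g"
      using Poly_Mapping.keys_mult[of "Poly_Mapping.single u (lk f u)" ?g] by blast
    then have "a = u" by (auto split: if_splits)
    then show False using ab kg by auto
  qed
  moreover have "f * g = Poly_Mapping.single (u + v) (lk f u * lk g v) + (?f * g + Poly_Mapping.single u (lk f u) * ?g)"
    by (simp add: algebra_simps mult_single)
  ultimately have "lk (f * g) (u + v) = lk f u * lk g v"
    by (simp only: lookup_add in_keys_iff lookup_single) simp
  then have "u + v \<in> Poly_Mapping.keys (f * g)"
    using f(2) g(2) unfolding is_top_def in_keys_iff by simp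
  moreover have "lt w (u + v)" if "w \<in> Poly_Mapping.keys (f * g)" "w \<noteq> u + v" for w
    using that Poly_Mapping.keys_mult[of f g] le by blast
  ultimately show ?thesis unfolding is_top_def by blast
qed

section \<open>Leading monomials of minors\<close>

definition rowmon :: "nat \<Rightarrow> nat \<Rightarrow> (nat \<Rightarrow> nat) \<Rightarrow> (nat \<times> nat) monom" where
  "rowmon p q e = (\<Sum>i\<in>{Suc p..q}. Poly_Mapping.single (i, e i) 1)"

lemma lk_rowmon: "lk (rowmon p q e) (i, j) = (if i \<in> {Suc p..q} \<and> e i = j then 1 else 0)"
proof -
  have "lk (rowmon p q e) (i, j) = (\<Sum>a\<in>{Suc p..q}. if a = i then (if e i = j then 1 else 0) else 0)"
    unfolding rowmon_def lookup_sum lookup_single when_def by (intro sum.cong) auto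
  then show ?thesis by (simp add: sum.delta)
qed

lemma rowmon_cong: "(\<And>i. i \<in> {Suc p..q} \<Longrightarrow> e i = e' i) \<Longrightarrow> rowmon p q e = rowmon p q e'"
  unfolding rowmon_def by (intro sum.cong) auto

lemma rowmon_inject:
  assumes "rowmon p q e = rowmon p q e'" "i \<in> {Suc p..q}"
  shows "e i = e' i"
proof (rule ccontr)
  assume "e i \<noteq> e' i"
  then have "lk (rowmon p q e) (i, e i) = 1" "lk (rowmon p q e') (i, e i) = 0"
    using assms(2) unfolding lk_rowmon by simp_all
  then show False using assms(1) by simp
qed

lemma rowmon_monoms:
  assumes "\<And>i. i \<in> {Suc p..q} \<Longrightarrow> (i, e i) \<in> V"
  shows "rowmon p q e \<in> monoms V"
proof -
  have "(i, j) \<in> V" if "(i, j) \<in> Poly_Mapping.keys (rowmon p q e)" for i j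
    using that assms[of i] unfolding in_keys_iff lk_rowmon by (simp split: if_splits)
  then show ?thesis unfolding monoms_def by auto
qed

lemma nth_elem_image:
  assumes "strict_mono_on {Suc p..q} g" "a < q - p"
  shows "nth_elem (g ` {Suc p..q}) a = g (Suc p + a)"
proof -
  let ?l = "map g [Suc p..<Suc q]"
  have "sorted_wrt (<) ?l"
    unfolding sorted_wrt_map
    by (rule sorted_wrt_mono_rel[OF _ sorted_wrt_upt]) (use assms(1) in \<open>auto simp: strict_mono_on_def\<close>)
  moreover have "set ?l = g ` {Suc p..q}" by (simp add: atLeastLessThanSuc_atLeastAtMost del: upt_Suc)
  moreover have "length ?l = card (g ` {Suc p..q})"
    using strict_mono_on_imp_inj_on[OF assms(1)] by (simp add: card_image del: upt_Suc)
  ultimately have "sorted_list_of_set (g ` {Suc p..q}) = ?l"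
    by (subst sorted_list_of_set_unique[symmetric]) auto
  then show ?thesis using assms(2) unfolding nth_elem_def by (simp del: upt_Suc)
qed

lemma strict_mono_on_image_unique:
  fixes g h :: "nat \<Rightarrow> nat"
  assumes "strict_mono_on {Suc p..q} g" "strict_mono_on {Suc p..q} h"
    and "g ` {Suc p..q} = h ` {Suc p..q}" "i \<in> {Suc p..q}"
  shows "g i = h i"
proof -
  have i: "i - Suc p < q - p" "Suc p + (i - Suc p) = i" using assms(4) by auto
  have "g i = nth_elem (g ` {Suc p..q}) (i - Suc p)"
    unfolding nth_elem_image[OF assms(1) i(1)] i(2) ..
  also have "\<dots> = h i"
    unfolding assms(3) nth_elem_image[OF assms(2) i(1)] i(2) ..
  finally show ?thesis .
qed

lemma nth_elem_interval: "a < q - p \<Longrightarrow> nth_elem {Suc p..q} a = Suc p + a"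
  using nth_elem_image[of p q "\<lambda>i. i" a] by (simp add: strict_mono_onI)

lemma keys_sum_single:
  assumes "finite S" "inj_on f S" "\<And>x. x \<in> S \<Longrightarrow> c x \<noteq> 0"
  shows "Poly_Mapping.keys (\<Sum>x\<in>S. Poly_Mapping.single (f x) (c x :: complex)) = f ` S"
proof -
  have l: "lk (\<Sum>x\<in>S. Poly_Mapping.single (f x) (c x)) (f y) = c y" if "y \<in> S" for y
  proof -
    have "lk (\<Sum>x\<in>S. Poly_Mapping.single (f x) (c x)) (f y) = (\<Sum>x\<in>S. if x = y then c y else 0)"
      unfolding lookup_sum lookup_single when_def
      by (intro sum.cong) (use that assms(2) in \<open>auto dest: inj_onD\<close>)
    then show ?thesis using that assms(1) by (simp add: sum.delta)
  qed
  have "lk (\<Sum>x\<in>S. Poly_Mapping.single (f x) (c x)) z = 0" if "z \<notin> f ` S" for z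
    unfolding lookup_sum lookup_single when_def using that by (intro sum.neutral) auto
  then show ?thesis using l assms(3) by (auto simp: in_keys_iff) 
qed

text \<open>Distinct permutations contribute distinct monomials, so no terms of the determinant cancel.\<close>

lemma keys_minor:
  assumes C: "finite C" "card C = q - p"
  shows "Poly_Mapping.keys (minor {Suc p..q} C) = rowmon p q ` {e. bij_betw e {Suc p..q} C}"
proof -
  let ?N = "q - p" and ?A = "{Suc p..q}"
  let ?P = "{\<pi>. \<pi> permutes {0..<?N}}"
  define E where "E \<pi> i = nth_elem C (\<pi> (i - Suc p))" for \<pi> :: "nat \<Rightarrow> nat" and i
  have bC: "bij_betw (nth_elem C) {0..<?N} C"
    using bij_betw_nth_elem[OF C(1)] C(2) by (simp add: atLeast0LessThan)
  have bs: "bij_betw (\<lambda>i. i - Suc p) ?A {0..<?N}"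
    by (rule bij_betw_byWitness[where f' = "\<lambda>a. a + Suc p"]) auto
  have pm: "perm_mon ?A C \<pi> = rowmon p q (E \<pi>)" for \<pi>
  proof -
    have "rowmon p q (E \<pi>) = (\<Sum>a\<in>{0..<?N}. Poly_Mapping.single (Suc p + a, nth_elem C (\<pi> a)) 1)"
      unfolding rowmon_def E_def
      by (rule sum.reindex_bij_witness[of _ "\<lambda>a. Suc p + a" "\<lambda>i. i - Suc p"]) auto
    then show ?thesis unfolding perm_mon_def by (simp add: nth_elem_interval atLeast0LessThan)
  qed
  have bE: "bij_betw (E \<pi>) ?A C" if "\<pi> permutes {0..<?N}" for \<pi>
    using bij_betw_trans[OF bij_betw_trans[OF bs permutes_imp_bij[OF that]] bC]
    by (simp add: E_def[abs_def] comp_def)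
  have EP: "\<exists>\<pi>. \<pi> permutes {0..<?N} \<and> rowmon p q e = rowmon p q (E \<pi>)" if e: "bij_betw e ?A C" for e
  proof -
    have bp: "bij_betw (\<lambda>a. Suc p + a) {0..<?N} ?A"
      by (rule bij_betw_byWitness[where f' = "\<lambda>i. i - Suc p"]) auto
    let ?inv = "inv_into {0..<?N} (nth_elem C)"
    let ?\<pi> = "\<lambda>a. if a \<in> {0..<?N} then ?inv (e (Suc p + a)) else a"
    have "bij_betw (?inv \<circ> (e \<circ> (\<lambda>a. Suc p + a))) {0..<?N} {0..<?N}"
      using bij_betw_trans[OF bij_betw_trans[OF bp e] bij_betw_inv_into[OF bC]] .
    then have "bij_betw ?\<pi> {0..<?N} {0..<?N}" by (rule bij_betw_cong[THEN iffD1, rotated]) auto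
    then have "?\<pi> permutes {0..<?N}" by (rule bij_imp_permutes) auto
    moreover have "rowmon p q e = rowmon p q (E ?\<pi>)"
    proof (rule rowmon_cong)
      fix i assume i: "i \<in> ?A"
      then have "i - Suc p \<in> {0..<?N}" "Suc p + (i - Suc p) = i" by auto
      moreover have "nth_elem C (?inv (e i)) = e i"
        using bij_betw_inv_into_right[OF bC] bij_betwE[OF e] i by blast
      ultimately show "e i = E ?\<pi> i" by (simp add: E_def)
    qed
    ultimately show ?thesis by blast
  qed
  have inj: "inj_on (perm_mon ?A C) ?P"
  proof (rule inj_onI)
    fix \<pi> \<pi>' assume P: "\<pi> \<in> ?P" "\<pi>' \<in> ?P" and eq: "perm_mon ?A C \<pi> = perm_mon ?A C \<pi>'"
    show "\<pi> = \<pi>'"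
    proof
      fix a
      show "\<pi> a = \<pi>' a"
      proof (cases "a < ?N")
        case True
        have "E \<pi> (Suc p + a) = E \<pi>' (Suc p + a)"
          by (rule rowmon_inject[OF eq[unfolded pm]]) (use True in auto)
        then have "nth_elem C (\<pi> a) = nth_elem C (\<pi>' a)" by (simp add: E_def)
        moreover have "\<pi> a \<in> {0..<?N}" "\<pi>' a \<in> {0..<?N}" using P True by (simp_all add: permutes_in_image)
        ultimately show ?thesis using bC unfolding bij_betw_def by (auto dest: inj_onD)
      next
        case False
        then show ?thesis using P by (simp add: permutes_def)
      qed
    qed
  qed
  have "Poly_Mapping.keys (minor ?A C) = perm_mon ?A C ` ?P"
  proof -
    have cA: "card ?A = ?N" "card ?A = card C" using C by auto
    show ?thesis unfolding minor_eq[OF cA(2)] cA(1)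
      by (rule keys_sum_single[OF _ inj]) (auto simp: finite_permutations sign_def)
  qed
  also have "\<dots> = rowmon p q ` {e. bij_betw e ?A C}"
    unfolding pm using bE EP by (auto simp: image_iff) 
  finally show ?thesis .
qed

lemma strict_mono_on_interval:
  assumes "\<And>i. Suc p \<le> i \<Longrightarrow> i < q \<Longrightarrow> g i < (g (Suc i) :: nat)"
  shows "strict_mono_on {Suc p..q} g"
proof (rule strict_mono_onI)
  fix i j assume i: "i \<in> {Suc p..q}" and j: "j \<in> {Suc p..q}" and "i < j"
  from \<open>i < j\<close> j show "g i < g j"
  proof (induction j)
    case (Suc j)
    then show ?case using assms[of j] i by (cases "i = j") auto
  qed simp
qed

text \<open>It suffices to compare the two ways of pairing two adjacent rows with two columns.  The leading
  monomial of the minor comes from a bijection between rows and columns; if this bijection had a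
  descent, exchanging the two values would give a larger monomial of the minor.  So it is
  increasing, and there is only one increasing bijection.\<close>

lemma minor_top_if_exchange:
  assumes lt: "term_order (entries m n) lt" and \<sigma>: "\<sigma> permutes {1..n}"
    and two: "\<And>a j l. a \<in> {1..<m} \<Longrightarrow> j \<in> {1..n} \<Longrightarrow> l \<in> {1..n} \<Longrightarrow> j < l \<Longrightarrow>
      lt (Poly_Mapping.single (a, \<sigma> l) 1 + Poly_Mapping.single (Suc a, \<sigma> j) 1)
         (Poly_Mapping.single (a, \<sigma> j) 1 + Poly_Mapping.single (Suc a, \<sigma> l) 1)"
    and q: "q \<le> m" and g: "strict_mono_on {Suc p..q} g" "g ` {Suc p..q} \<subseteq> {1..n}"
  shows "is_top lt (minor {Suc p..q} (\<sigma> ` g ` {Suc p..q})) (rowmon p q (\<lambda>i. \<sigma> (g i)))"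
proof -
  let ?A = "{Suc p..q}" and ?C = "\<sigma> ` g ` {Suc p..q}" and ?h = "\<lambda>i. \<sigma> (g i)"
  let ?K = "Poly_Mapping.keys (minor ?A ?C)"
  have inj\<sigma>: "inj \<sigma>" using \<sigma> by (rule permutes_inj)
  have bg: "bij_betw ?h ?A ?C"
    using strict_mono_on_imp_inj_on[OF g(1)] inj\<sigma>
    by (auto simp: bij_betw_def inj_on_def image_image dest: injD)
  have C: "finite ?C" "card ?C = q - p" using bij_betw_same_card[OF bg] by simp_all
  note K = keys_minor[OF C]
  have hK: "rowmon p q ?h \<in> ?K" unfolding K using bg by blast
  have Cn: "?C \<subseteq> {1..n}" using g(2) permutes_image[OF \<sigma>] by blast
  have mon: "rowmon p q e \<in> monoms (entries m n)" if "bij_betw e ?A ?C" for e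
  proof (rule rowmon_monoms)
    fix i assume i: "i \<in> ?A"
    then have "e i \<in> {1..n}" using bij_betwE[OF that] Cn by blast
    then show "(i, e i) \<in> entries m n" using i q by auto
  qed
  have Km: "?K \<subseteq> monoms (entries m n)" unfolding K using mon by blast
  obtain v where v: "v \<in> ?K" "\<And>w. w \<in> ?K \<Longrightarrow> w \<noteq> v \<Longrightarrow> lt w v"
  proof -
    have "?K \<noteq> {}" using hK by blast
    from finite_has_top[OF lt finite_keys this Km] show ?thesis using that by blast
  qed
  obtain e where e: "bij_betw e ?A ?C" "v = rowmon p q e" using v(1) unfolding K by blast
  define e' where "e' i = inv_into UNIV \<sigma> (e i)" for i
  have \<sigma>e: "\<sigma> (e' i) = e i" for i
    unfolding e'_def using permutes_inverses(1)[OF \<sigma>] .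
  have e'g: "e' ` ?A = g ` ?A"
  proof -
    have "\<sigma> ` e' ` ?A = \<sigma> ` g ` ?A" using e(1) by (simp add: image_image \<sigma>e bij_betw_def)
    then show ?thesis using inj\<sigma> by (simp add: inj_image_eq_iff)
  qed
  have "strict_mono_on ?A e'"
  proof (rule strict_mono_on_interval, rule ccontr)
    fix i assume i: "Suc p \<le> i" "i < q" and n: "\<not> e' i < e' (Suc i)"
    have iA: "i \<in> ?A" "Suc i \<in> ?A" using i by auto
    have "e i \<noteq> e (Suc i)" using e(1) iA unfolding bij_betw_def by (auto dest: inj_onD)
    then have "e' i \<noteq> e' (Suc i)" using \<sigma>e by metis
    then have l: "e' (Suc i) < e' i" using n by simp
    have mem: "e' i \<in> {1..n}" "e' (Suc i) \<in> {1..n}" using e'g iA g(2) by blast+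
    let ?s = "Transposition.transpose i (Suc i)"
    define e2 where "e2 = e \<circ> ?s"
    have "bij_betw ?s ?A ?A" using iA by (simp add: permutes_imp_bij permutes_swap_id)
    then have b2: "bij_betw e2 ?A ?C" unfolding e2_def by (rule bij_betw_trans[OF _ e(1)])
    let ?R = "\<Sum>a\<in>?A - {i} - {Suc i}. Poly_Mapping.single (a, e a) (1::nat)"
    have split: "rowmon p q e = (Poly_Mapping.single (i, e i) 1 + Poly_Mapping.single (Suc i, e (Suc i)) 1) +
        (\<Sum>a\<in>?A - {i} - {Suc i}. Poly_Mapping.single (a, e a) 1)" for e
      unfolding rowmon_def using iA by (simp add: sum.remove[of ?A i] sum.remove[of "?A - {i}" "Suc i"] add.assoc)
    have r: "(\<Sum>a\<in>?A - {i} - {Suc i}. Poly_Mapping.single (a, e2 a) (1::nat)) = ?R"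
      by (intro sum.cong refl) (auto simp: e2_def transpose_def)
    have "e2 i = e (Suc i)" "e2 (Suc i) = e i" by (simp_all add: e2_def)
    then have s2: "rowmon p q e2 = (Poly_Mapping.single (i, e (Suc i)) 1 + Poly_Mapping.single (Suc i, e i) 1) + ?R"
      unfolding split[of e2] r by simp
    have en: "e a \<in> {1..n}" if "a \<in> ?A" for a using bij_betwE[OF e(1)] Cn that by blast
    have "lt (Poly_Mapping.single (i, e i) 1 + Poly_Mapping.single (Suc i, e (Suc i)) 1)
        (Poly_Mapping.single (i, e (Suc i)) 1 + Poly_Mapping.single (Suc i, e i) 1)"
      using two[of i "e' (Suc i)" "e' i"] i q mem l unfolding \<sigma>e by auto
    then have less: "lt (rowmon p q e) (rowmon p q e2)"
      unfolding split[of e] s2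
    proof (rule term_orderD(4)[OF lt, rotated 3])
      show "?R \<in> monoms (entries m n)"
      proof -
        have "rowmon p q e \<in> monoms (entries m n)" by (rule mon[OF e(1)])
        moreover have "Poly_Mapping.keys ?R \<subseteq> Poly_Mapping.keys (rowmon p q e)"
          unfolding split[of e] by (auto simp: in_keys_iff lookup_add)
        ultimately show ?thesis unfolding monoms_def by blast
      qed
    qed (use i q en iA in \<open>auto simp: monoms_def in_keys_iff lookup_add lookup_single when_def split: if_splits\<close>)
    have k2: "rowmon p q e2 \<in> ?K" unfolding K using b2 by blast
    have ne: "rowmon p q e2 \<noteq> v"
      using less term_orderD(1)[OF lt mon[OF e(1)]] e(2) by auto
    have "lt (rowmon p q e2) (rowmon p q e)" using v(2)[OF k2 ne] e(2) by simp
    then show False using less term_orderD(1,2)[OF lt] mon[OF e(1)] mon[OF b2] by blast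
  qed
  then have "e' i = g i" if "i \<in> ?A" for i
    by (rule strict_mono_on_image_unique[OF _ g(1) e'g that])
  then have "v = rowmon p q ?h"
    unfolding e(2) by (intro rowmon_cong) (metis \<sigma>e)
  then show ?thesis using v unfolding is_top_def by blast
qed

text \<open>For \<open>diagonal_order\<close> the leading monomial is known by definition; it only remains to read it off
  from \<open>init\<close>.\<close>

lemma minor_top_if_diagonal_order:
  assumes lt: "term_order (entries m n) lt" and dg: "diagonal_order m n lt"
    and q: "q \<le> m" and g: "strict_mono_on {Suc p..q} g" "g ` {Suc p..q} \<subseteq> {1..n}"
  shows "is_top lt (minor {Suc p..q} (g ` {Suc p..q})) (rowmon p q g)"
proof -
  let ?A = "{Suc p..q}" and ?C = "g ` {Suc p..q}"
  have bg: "bij_betw g ?A ?C" using strict_mono_on_imp_inj_on[OF g(1)] by (simp add: bij_betw_def)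
  have C: "finite ?C" "card ?C = q - p" using bij_betw_same_card[OF bg] by simp_all
  note K = keys_minor[OF C]
  have Km: "Poly_Mapping.keys (minor ?A ?C) \<subseteq> monoms (entries m n)"
    unfolding K
  proof safe
    fix e assume e: "bij_betw e ?A ?C"
    show "rowmon p q e \<in> monoms (entries m n)"
    proof (rule rowmon_monoms)
      fix i assume i: "i \<in> ?A"
      then have "e i \<in> {1..n}" using bij_betwE[OF e] g(2) by blast
      then show "(i, e i) \<in> entries m n" using i q by auto
    qed
  qed
  have "rowmon p q g \<in> Poly_Mapping.keys (minor ?A ?C)" unfolding K using bg by blast
  then obtain w where w: "is_top lt (minor ?A ?C) w" using ex_is_top[OF lt _ Km] by fastforce
  have "Poly_Mapping.single w 1 = init lt (minor ?A ?C)" using init_is_top[OF lt Km w] by simp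
  also have "\<dots> = (\<Prod>a<card ?A. Var (nth_elem ?A a, nth_elem ?C a))"
  proof -
    have "?A \<subseteq> {1..m}" "card ?A = card ?C" using q C by auto
    with dg g(2) show ?thesis unfolding diagonal_order_def by blast
  qed
  also have "\<dots> = Poly_Mapping.single (\<Sum>a<q - p. Poly_Mapping.single (Suc p + a, g (Suc p + a)) 1) 1"
    by (subst prod_Var) (simp_all add: nth_elem_interval nth_elem_image[OF g(1)])
  also have "(\<Sum>a<q - p. Poly_Mapping.single (Suc p + a, g (Suc p + a)) 1) = rowmon p q g"
    unfolding rowmon_def
    by (rule sum.reindex_bij_witness[of _ "\<lambda>i. i - Suc p" "\<lambda>a. Suc p + a"]) auto
  finally have "w = rowmon p q g" by (rule single_one_inject)
  then show ?thesis using w by simp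
qed

section \<open>Column reversal and a term order adapted to the two blocks of rows\<close>

definition rev_col :: "nat \<Rightarrow> nat \<Rightarrow> nat" where
  "rev_col n j = (if j \<in> {1..n} then n + 1 - j else j)"

lemma rev_col_involution: "rev_col n (rev_col n j) = j"
proof (cases "1 \<le> j \<and> j \<le> n")
  case True
  then have "1 \<le> n + 1 - j \<and> n + 1 - j \<le> n" by arith
  then show ?thesis using True by (simp add: rev_col_def)
next
  case False
  then have "rev_col n j = j" by (auto simp: rev_col_def)
  then show ?thesis by simp
qed

lemma rev_col_permutes: "rev_col n permutes {1..n}"
proof (rule bij_imp_permutes)
  have "rev_col n ` {1..n} \<subseteq> {1..n}" by (auto simp: rev_col_def)
  then show "bij_betw (rev_col n) {1..n} {1..n}"
    by (intro bij_betw_byWitness[where f' = "rev_col n"]) (simp_all add: rev_col_involution)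
  show "rev_col n j = j" if "j \<notin> {1..n}" for j using that by (simp only: rev_col_def if_False)
qed

text \<open>The last variable in which the two products differ is in the lower row, in the larger column.
  The product that contains it is the smaller one, so \<open>revlex\<close> prefers decreasing pairings.\<close>

lemma revlex_exchange:
  assumes "x < y"
  shows "revlex (Poly_Mapping.single (a, x) 1 + Poly_Mapping.single (Suc a, y) 1)
    (Poly_Mapping.single (a, y) 1 + Poly_Mapping.single (Suc a, x) 1)"
    (is "revlex ?\<alpha> ?\<beta>")
proof -
  have "mdeg (Poly_Mapping.single v 1) = 1" for v :: "nat \<times> nat" by (simp add: mdeg_def)
  then have "mdeg ?\<alpha> = mdeg ?\<beta>" unfolding mdeg_add by simp
  moreover have "lk ?\<beta> (Suc a, y) < lk ?\<alpha> (Suc a, y)"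
    using assms by (simp add: lookup_add lookup_single)
  moreover have "lk ?\<alpha> w = lk ?\<beta> w" if "row_major (Suc a, y) w" for w
    using that assms by (cases w) (auto simp: lookup_add lookup_single when_def row_major_def)
  ultimately show ?thesis unfolding revlex_def by blast
qed

text \<open>The variables in the rows up to \<open>r\<close> come first, row by row from the left; then those of the
  remaining rows from the last variable backwards.  The direction changes at row \<open>r\<close> because the
  derivations that are available do.\<close>

definition block_before :: "nat \<Rightarrow> nat \<times> nat \<Rightarrow> nat \<times> nat \<Rightarrow> bool" where
  "block_before r w v \<longleftrightarrow> (if fst v \<le> r then row_major w v else fst w \<le> r \<or> row_major v w)"

lemma block_before_trans:
  assumes "block_before r u v" "block_before r v w"
  shows "block_before r u w"
proof (cases "fst w \<le> r")
  case True
  then have vw: "row_major v w" using assms(2) by (simp add: block_before_def)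
  then have "fst v \<le> r" using True by (auto simp: row_major_def)
  then show ?thesis using True vw assms(1) row_major_trans by (auto simp: block_before_def)
next
  case w: False
  show ?thesis
  proof (cases "fst u \<le> r")
    case False
    then have "\<not> fst v \<le> r"
      using assms(1) by (auto simp: block_before_def row_major_def split: if_splits)
    then show ?thesis using w False assms row_major_trans by (auto simp: block_before_def)
  qed (use w in \<open>simp add: block_before_def\<close>)
qed

lemma block_before_irrefl: "\<not> block_before r u u"
  by (simp add: block_before_def row_major_irrefl)

lemma block_before_total: "u \<noteq> v \<Longrightarrow> block_before r u v \<or> block_before r v u"
  using row_major_total[of u v] by (auto simp: block_before_def)

text \<open>The lexicographic order for the enumeration \<open>block_before\<close> of the variables, after the columns
  have been permuted.\<close>

definition block_lex :: "nat \<Rightarrow> (nat \<Rightarrow> nat) \<Rightarrow> (nat \<times> nat) monom \<Rightarrow> (nat \<times> nat) monom \<Rightarrow> bool" where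
  "block_lex r \<sigma> \<alpha> \<beta> \<longleftrightarrow> (\<exists>v. lk \<alpha> v < lk \<beta> v \<and>
     (\<forall>w. block_before r (fst w, \<sigma> (snd w)) (fst v, \<sigma> (snd v)) \<longrightarrow> lk \<alpha> w = lk \<beta> w))"

lemma block_lex_term_order:
  assumes "inj \<sigma>"
  shows "term_order V (block_lex r \<sigma>)"
proof -
  let ?R = "\<lambda>w v. block_before r (fst w, \<sigma> (snd w)) (fst v, \<sigma> (snd v))"
  have R1: "?R u v \<Longrightarrow> ?R v w \<Longrightarrow> ?R u w" for u v w by (rule block_before_trans)
  have R2: "\<not> ?R u u" for u by (rule block_before_irrefl)
  have R3: "?R u v \<or> ?R v u" if "u \<noteq> v" for u v
  proof (rule block_before_total)
    show "(fst u, \<sigma> (snd u)) \<noteq> (fst v, \<sigma> (snd v))"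
      using that assms by (auto simp: prod_eq_iff dest: injD)
  qed
  have tot: "block_lex r \<sigma> \<alpha> \<beta> \<or> block_lex r \<sigma> \<beta> \<alpha>" if "\<alpha> \<noteq> \<beta>" for \<alpha> \<beta>
    unfolding block_lex_def by (rule first_diff_total[where R = ?R, OF R1 R2 that])
  have tr: "block_lex r \<sigma> \<alpha> \<beta> \<Longrightarrow> block_lex r \<sigma> \<beta> \<gamma> \<Longrightarrow> block_lex r \<sigma> \<alpha> \<gamma>" for \<alpha> \<beta> \<gamma>
    unfolding block_lex_def by (rule first_diff_trans[where R = ?R, OF R1 R3])
  show ?thesis
    unfolding term_order_def
  proof (intro conjI ballI impI)
    show "irreflp_on (monoms V) (block_lex r \<sigma>)" by (auto simp: irreflp_on_def block_lex_def)
    show "transp_on (monoms V) (block_lex r \<sigma>)" unfolding transp_on_def using tr by blast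
    show "totalp_on (monoms V) (block_lex r \<sigma>)" unfolding totalp_on_def using tot by blast
    show "block_lex r \<sigma> 0 \<alpha>" if "\<alpha> \<noteq> 0" for \<alpha> using tot[OF that] by (auto simp: block_lex_def)
    show "block_lex r \<sigma> (\<alpha> + \<gamma>) (\<beta> + \<gamma>)" if "block_lex r \<sigma> \<alpha> \<beta>" for \<alpha> \<beta> \<gamma>
      using that by (auto simp: block_lex_def lookup_add)
  qed
qed

text \<open>In the first block the exchange is decided by the leftmost variable of the upper row, in the
  second by the rightmost variable of the lower row; both favour the increasing pairing.\<close>

lemma block_lex_exchange:
  assumes "inj \<sigma>" "\<And>j. \<sigma> (\<sigma> j) = j" "j < l"
  shows "block_lex r \<sigma> (Poly_Mapping.single (a, \<sigma> l) 1 + Poly_Mapping.single (Suc a, \<sigma> j) 1)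
    (Poly_Mapping.single (a, \<sigma> j) 1 + Poly_Mapping.single (Suc a, \<sigma> l) 1)"
    (is "block_lex r \<sigma> ?\<alpha> ?\<beta>")
proof -
  have ne: "\<sigma> j \<noteq> \<sigma> l" using assms(1,3) by (auto dest: injD)
  define v where "v = (if a \<le> r then (a, \<sigma> j) else (Suc a, \<sigma> l))"
  have "lk ?\<alpha> v < lk ?\<beta> v"
    using ne by (simp add: v_def lookup_add lookup_single when_def)
  moreover have "lk ?\<alpha> w = lk ?\<beta> w"
    if "block_before r (fst w, \<sigma> (snd w)) (fst v, \<sigma> (snd v))" for w
  proof -
    have "w \<notin> {(a, \<sigma> j), (a, \<sigma> l), (Suc a, \<sigma> j), (Suc a, \<sigma> l)}"
      using that assms(2,3) by (cases w) (auto simp: v_def block_before_def row_major_def split: if_splits)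
    then show ?thesis by (auto simp: lookup_add lookup_single when_def)
  qed
  ultimately show ?thesis unfolding block_lex_def by blast
qed

section \<open>Decomposing monomials into increasing columns\<close>

definition rowsum :: "nat \<Rightarrow> (nat \<times> nat) monom \<Rightarrow> nat \<Rightarrow> nat" where
  "rowsum n u i = (\<Sum>j=1..n. lk u (i, j))"

lemma rowsum_permute: "\<sigma> permutes {1..n} \<Longrightarrow> rowsum n u i = (\<Sum>j=1..n. lk u (i, \<sigma> j))"
  unfolding rowsum_def by (drule sum.permute[of _ _ "\<lambda>j. lk u (i, j)"]) (simp only: comp_def)

lemma rowsum_add: "rowsum n (u + v) i = rowsum n u i + rowsum n v i"
  by (simp add: rowsum_def lookup_add sum.distrib)

text \<open>The column of the first nonzero entry increases strictly from row to row: up to that column, row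
  \<open>i + 1\<close> has an entry, so by the ballot inequality row \<open>i\<close> has one strictly before it.\<close>

lemma row_minima:
  fixes w :: "nat \<Rightarrow> nat \<Rightarrow> nat"
  assumes pos: "\<And>i. i \<in> {Suc p..q} \<Longrightarrow> 0 < (\<Sum>j=1..n. w i j)"
    and pre: "\<And>i c. Suc p \<le> i \<Longrightarrow> i < q \<Longrightarrow> c \<in> {1..n} \<Longrightarrow>
      (\<Sum>j=1..c. w (Suc i) j) \<le> (\<Sum>j=1..<c. w i j)"
  obtains g where "strict_mono_on {Suc p..q} g" "g ` {Suc p..q} \<subseteq> {1..n}"
    "\<And>i. i \<in> {Suc p..q} \<Longrightarrow> 0 < w i (g i)"
    "\<And>i j. i \<in> {Suc p..q} \<Longrightarrow> 1 \<le> j \<Longrightarrow> j < g i \<Longrightarrow> w i j = 0"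
proof
  define g where "g i = (LEAST j. j \<in> {1..n} \<and> 0 < w i j)" for i
  have ex: "\<exists>j. j \<in> {1..n} \<and> 0 < w i j" if "i \<in> {Suc p..q}" for i
  proof (rule ccontr)
    assume "\<not> ?thesis"
    then have "(\<Sum>j=1..n. w i j) = 0" by (intro sum.neutral) auto
    then show False using pos[OF that] by simp
  qed
  have g: "g i \<in> {1..n} \<and> 0 < w i (g i)" if "i \<in> {Suc p..q}" for i
    unfolding g_def by (rule LeastI_ex[OF ex[OF that]])
  have le: "g i \<le> j" if "j \<in> {1..n}" "0 < w i j" for i j
    unfolding g_def using that by (intro Least_le) simp
  show "g ` {Suc p..q} \<subseteq> {1..n}" using g by blast
  show "0 < w i (g i)" if "i \<in> {Suc p..q}" for i using g[OF that] by simp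
  show "w i j = 0" if "i \<in> {Suc p..q}" "1 \<le> j" "j < g i" for i j
  proof (rule ccontr)
    assume "w i j \<noteq> 0"
    moreover have "j \<in> {1..n}" using that g[OF that(1)] by simp
    ultimately show False using le[of j i] that by simp
  qed
  show "strict_mono_on {Suc p..q} g"
  proof (rule strict_mono_on_interval)
    fix i assume i: "Suc p \<le> i" "i < q"
    then have S: "Suc i \<in> {Suc p..q}" by simp
    let ?c = "g (Suc i)"
    have c: "?c \<in> {1..n}" "0 < w (Suc i) ?c" using g[OF S] by auto
    have "w (Suc i) ?c \<le> (\<Sum>j=1..?c. w (Suc i) j)"
      by (rule member_le_sum) (use c in auto)
    then have "(\<Sum>j=1..<?c. w i j) \<noteq> 0" using pre[OF i c(1)] c(2) by linarith
    then obtain j where "j \<in> {1..<?c}" "w i j \<noteq> 0" by (rule sum.not_neutral_contains_not_neutral)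
    then have "g i \<le> j" "j < ?c" using c(1) by (auto intro!: le)
    then show "g i < ?c" by simp
  qed
qed

text \<open>Removal of the first entry of each row, recorded by its effect on partial row sums.\<close>

lemma peel_column:
  assumes \<sigma>: "\<sigma> permutes {1..n}"
    and u: "Poly_Mapping.keys u \<subseteq> entries m n"
    and pos: "\<And>i. i \<in> {Suc p..q} \<Longrightarrow> 0 < rowsum n u i"
    and pre: "\<And>i c. Suc p \<le> i \<Longrightarrow> i < q \<Longrightarrow> c \<in> {1..n} \<Longrightarrow>
      (\<Sum>j=1..c. lk u (Suc i, \<sigma> j)) \<le> (\<Sum>j=1..<c. lk u (i, \<sigma> j))"
  obtains g u' where "strict_mono_on {Suc p..q} g" "g ` {Suc p..q} \<subseteq> {1..n}"
    "u = u' + rowmon p q (\<lambda>i. \<sigma> (g i))" "Poly_Mapping.keys u' \<subseteq> entries m n"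
    "\<And>i S. finite S \<Longrightarrow> (\<Sum>j\<in>S. lk u (i, \<sigma> j)) =
      (\<Sum>j\<in>S. lk u' (i, \<sigma> j)) + of_bool (i \<in> {Suc p..q} \<and> g i \<in> S)"
    "\<And>i c. i \<in> {Suc p..q} \<Longrightarrow> c < g i \<Longrightarrow> (\<Sum>j=1..c. lk u (i, \<sigma> j)) = 0"
proof -
  obtain g where g: "strict_mono_on {Suc p..q} g" "g ` {Suc p..q} \<subseteq> {1..n}"
    "\<And>i. i \<in> {Suc p..q} \<Longrightarrow> 0 < lk u (i, \<sigma> (g i))"
    "\<And>i j. i \<in> {Suc p..q} \<Longrightarrow> 1 \<le> j \<Longrightarrow> j < g i \<Longrightarrow> lk u (i, \<sigma> j) = 0"
    by (rule row_minima[where p = p and q = q and n = n and w = "\<lambda>i j. lk u (i, \<sigma> j)"])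
      (use pos pre rowsum_permute[OF \<sigma>] in auto)
  define u' where "u' = u - rowmon p q (\<lambda>i. \<sigma> (g i))"
  have uu: "u = u' + rowmon p q (\<lambda>i. \<sigma> (g i))"
  proof (rule poly_mapping_eqI)
    fix v :: "nat \<times> nat"
    obtain i j where v: "v = (i, j)" by fastforce
    have "lk (rowmon p q (\<lambda>i. \<sigma> (g i))) v \<le> lk u v"
      unfolding v lk_rowmon using g(3)[of i] by auto
    then show "lk u v = lk (u' + rowmon p q (\<lambda>i. \<sigma> (g i))) v"
      by (simp add: u'_def lookup_add lookup_minus)
  qed
  have "\<sigma> j = \<sigma> l \<longleftrightarrow> j = l" for j l using permutes_inj[OF \<sigma>] by (auto dest: injD)
  then have "lk u (i, \<sigma> j) = lk u' (i, \<sigma> j) + (if j = g i then of_bool (i \<in> {Suc p..q}) else 0)" for i j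
    by (subst uu) (auto simp: lookup_add lk_rowmon)
  then have s: "(\<Sum>j\<in>S. lk u (i, \<sigma> j)) =
      (\<Sum>j\<in>S. lk u' (i, \<sigma> j)) + of_bool (i \<in> {Suc p..q} \<and> g i \<in> S)" if "finite S" for i S
    using that by (simp add: sum.distrib sum.delta')
  have z: "(\<Sum>j=1..c. lk u (i, \<sigma> j)) = 0" if "i \<in> {Suc p..q}" "c < g i" for i c
    using g(4)[OF that(1)] that(2) by (intro sum.neutral) auto
  have "Poly_Mapping.keys u' \<subseteq> Poly_Mapping.keys u"
    by (auto simp: u'_def in_keys_iff lookup_minus)
  with u have ku: "Poly_Mapping.keys u' \<subseteq> entries m n" by (rule order_trans[rotated])
  show ?thesis by (rule that[OF g(1,2) uu ku s z])
qed

lemma finite_bounded_monoms: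
  assumes "finite V"
  shows "finite {u :: 'v monom. Poly_Mapping.keys u \<subseteq> V \<and> (\<forall>v. lk u v \<le> N)}" (is "finite ?S")
proof (rule finite_imageD)
  have "lk ` ?S \<subseteq> {f. \<forall>v. (v \<in> V \<longrightarrow> f v \<in> {..N}) \<and> (v \<notin> V \<longrightarrow> f v = 0)}"
    by (auto simp: in_keys_iff subset_iff)
  then show "finite (lk ` ?S)"
    by (rule finite_subset) (rule finite_set_of_finite_funs[OF assms], simp)
  show "inj_on lk ?S" by (simp add: inj_on_def lookup_inject)
qed

text \<open>The two blocks of rows are \<open>1..k\<close> and \<open>r + 1..m\<close>.  They overlap in \<open>r + 1..k\<close>, which may be empty.\<close>

locale bracket_shape =
  fixes k n r m :: nat and \<sigma> :: "nat \<Rightarrow> nat"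
  assumes r_le: "r \<le> k" and k_le: "k \<le> m"
    and \<sigma>: "\<sigma> permutes {1..n}" and \<sigma>_involution: "\<sigma> (\<sigma> j) = j"
begin

text \<open>\<open>tableau d e u P\<close>: the polynomial \<open>P\<close> is a product of \<open>d\<close> minors of the first and \<open>e\<close> minors of the
  second block, and \<open>u\<close> is the product of their diagonals, as seen through \<open>\<sigma>\<close>.\<close>

inductive tableau :: "nat \<Rightarrow> nat \<Rightarrow> (nat \<times> nat) monom \<Rightarrow> (nat \<times> nat) cpoly \<Rightarrow> bool" where
  empty: "tableau 0 0 0 1"
| angle: "tableau d e u P \<Longrightarrow> strict_mono_on {Suc 0..k} g \<Longrightarrow> g ` {Suc 0..k} \<subseteq> {1..n} \<Longrightarrow>
    tableau (Suc d) e (u + rowmon 0 k (\<lambda>i. \<sigma> (g i))) (P * minor {Suc 0..k} (\<sigma> ` g ` {Suc 0..k}))"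
| square: "tableau d e u P \<Longrightarrow> strict_mono_on {Suc r..m} g \<Longrightarrow> g ` {Suc r..m} \<subseteq> {1..n} \<Longrightarrow>
    tableau d (Suc e) (u + rowmon r m (\<lambda>i. \<sigma> (g i))) (P * minor {Suc r..m} (\<sigma> ` g ` {Suc r..m}))"

text \<open>The row sums of the exponents in a product of \<open>d\<close> minors of the first and \<open>e\<close> minors of the second
  block.\<close>

definition shape :: "nat \<Rightarrow> nat \<Rightarrow> nat \<Rightarrow> nat" where
  "shape d e i = d * of_bool (i \<in> {Suc 0..k}) + e * of_bool (i \<in> {Suc r..m})"

text \<open>A monomial with the right row sums that satisfies the ballot inequalities between consecutive
  rows is the content of a tableau.  The columns of the second block sit to the left in the skew
  shape, so they are peeled off first, which preserves the inequalities; in row \<open>r\<close> the shape is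
  indented by \<open>e\<close>, hence the weaker inequality there.  Once \<open>e = 0\<close> the rows below \<open>k\<close> are empty, all
  rows of the first block start in the same column, and peeling continues with that block.\<close>

lemma tableau_exists:
  assumes "Poly_Mapping.keys u \<subseteq> entries m n" "\<And>i. rowsum n u i = shape d e i"
    and "\<And>i c. 1 \<le> i \<Longrightarrow> i < m \<Longrightarrow> i \<noteq> r \<Longrightarrow> c \<in> {1..n} \<Longrightarrow>
      (\<Sum>j=1..c. lk u (Suc i, \<sigma> j)) \<le> (\<Sum>j=1..<c. lk u (i, \<sigma> j))"
    and "\<And>c. 1 \<le> r \<Longrightarrow> r < k \<Longrightarrow> c \<in> {1..n} \<Longrightarrow>
      (\<Sum>j=1..c. lk u (Suc r, \<sigma> j)) \<le> e + (\<Sum>j=1..<c. lk u (r, \<sigma> j))"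
  shows "\<exists>P. tableau d e u P"
  using assms
proof (induction "d + e" arbitrary: d e u)
  case 0
  have "lk u v = 0" for v
  proof (rule ccontr)
    assume a: "lk u v \<noteq> 0"
    then have "v \<in> entries m n" using 0(2) by (auto simp: in_keys_iff)
    moreover obtain i j where v: "v = (i, j)" by fastforce
    ultimately have "j \<in> {1..n}" by simp
    then have "lk u (i, j) \<le> rowsum n u i" unfolding rowsum_def by (intro member_le_sum) auto
    moreover have "rowsum n u i = 0" using 0(1,3) by (simp add: shape_def)
    ultimately show False using a v by simp
  qed
  then have "u = 0" by (intro poly_mapping_eqI) simp
  then show ?case using 0(1) empty by auto
next
  case (Suc N)
  note keys = Suc.prems(1) and rs = Suc.prems(2) and A = Suc.prems(3) and B = Suc.prems(4)
  show ?case
  proof (cases e)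
    case (Suc e')
    have pos: "0 < rowsum n u i" if "i \<in> {Suc r..m}" for i using that Suc unfolding rs shape_def by simp
    have pre: "(\<Sum>j=1..c. lk u (Suc i, \<sigma> j)) \<le> (\<Sum>j=1..<c. lk u (i, \<sigma> j))"
      if "Suc r \<le> i" "i < m" "c \<in> {1..n}" for i c using A[OF _ that(2) _ that(3)] that(1) by simp
    obtain g u' where g: "strict_mono_on {Suc r..m} g" "g ` {Suc r..m} \<subseteq> {1..n}"
      and u': "u = u' + rowmon r m (\<lambda>i. \<sigma> (g i))" "Poly_Mapping.keys u' \<subseteq> entries m n"
      and s: "\<And>i S. finite S \<Longrightarrow> (\<Sum>j\<in>S. lk u (i, \<sigma> j)) =
        (\<Sum>j\<in>S. lk u' (i, \<sigma> j)) + of_bool (i \<in> {Suc r..m} \<and> g i \<in> S)"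
      and z: "\<And>i c. i \<in> {Suc r..m} \<Longrightarrow> c < g i \<Longrightarrow> (\<Sum>j=1..c. lk u (i, \<sigma> j)) = 0"
      by (rule peel_column[OF \<sigma> keys pos pre]) (assumption | blast)+
    have "\<exists>P. tableau d e' u' P"
    proof (rule Suc.hyps(1))
      show "N = d + e'" using Suc.hyps(2) Suc by simp
      show "Poly_Mapping.keys u' \<subseteq> entries m n" by (rule u'(2))
      show "rowsum n u' i = shape d e' i" for i
        using rs[of i] s[of "{1..n}" i] g(2) Suc unfolding rowsum_permute[OF \<sigma>]
        by (auto simp: shape_def image_subset_iff)
      show "(\<Sum>j=1..c. lk u' (Suc i, \<sigma> j)) \<le> (\<Sum>j=1..<c. lk u' (i, \<sigma> j))"
        if i: "1 \<le> i" "i < m" "i \<noteq> r" and c: "c \<in> {1..n}" for i c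
      proof (cases "r < i")
        case True
        then have S: "Suc i \<in> {Suc r..m}" using i by simp
        have gp: "1 \<le> g (Suc i)" using g(2) S by (auto simp: image_subset_iff)
        show ?thesis
          using A[OF i c] s[of "{1..c}" "Suc i"] s[of "{1..<c}" i] z[OF S, of c] S gp
          by (cases "g (Suc i) \<le> c") (auto simp: of_bool_def split: if_splits)
      next
        case False
        then show ?thesis using A[OF i c] s[of "{1..c}" "Suc i"] s[of "{1..<c}" i] i by simp
      qed
      show "(\<Sum>j=1..c. lk u' (Suc r, \<sigma> j)) \<le> e' + (\<Sum>j=1..<c. lk u' (r, \<sigma> j))"
        if rk: "1 \<le> r" "r < k" and c: "c \<in> {1..n}" for c
      proof -
        have S: "Suc r \<in> {Suc r..m}" using rk k_le by simp
        have gp: "1 \<le> g (Suc r)" using g(2) S by (auto simp: image_subset_iff)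
        show ?thesis
          using B[OF rk c] s[of "{1..c}" "Suc r"] s[of "{1..<c}" r] z[OF S, of c] S gp Suc
          by (cases "g (Suc r) \<le> c") auto
      qed
    qed
    then show ?thesis unfolding u'(1) Suc using square[OF _ g] by blast
  next
    case 0
    then obtain d' where d': "d = Suc d'" using Suc.hyps(2) by (cases d) auto
    have AB: "(\<Sum>j=1..c. lk u (Suc i, \<sigma> j)) \<le> (\<Sum>j=1..<c. lk u (i, \<sigma> j))"
      if "Suc 0 \<le> i" "i < k" "c \<in> {1..n}" for i c
      using A[of i c] B[of c] that k_le 0 by (cases "i = r") auto
    have pos: "0 < rowsum n u i" if "i \<in> {Suc 0..k}" for i using that d' unfolding rs shape_def by simp
    obtain g u' where g: "strict_mono_on {Suc 0..k} g" "g ` {Suc 0..k} \<subseteq> {1..n}"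
      and u': "u = u' + rowmon 0 k (\<lambda>i. \<sigma> (g i))" "Poly_Mapping.keys u' \<subseteq> entries m n"
      and s: "\<And>i S. finite S \<Longrightarrow> (\<Sum>j\<in>S. lk u (i, \<sigma> j)) =
        (\<Sum>j\<in>S. lk u' (i, \<sigma> j)) + of_bool (i \<in> {Suc 0..k} \<and> g i \<in> S)"
      and z: "\<And>i c. i \<in> {Suc 0..k} \<Longrightarrow> c < g i \<Longrightarrow> (\<Sum>j=1..c. lk u (i, \<sigma> j)) = 0"
      by (rule peel_column[OF \<sigma> keys pos AB]) (assumption | blast)+
    have rs': "rowsum n u' i = shape d' e i" for i
      using rs[of i] s[of "{1..n}" i] g(2) d' unfolding rowsum_permute[OF \<sigma>]
      by (auto simp: shape_def image_subset_iff)
    have main: "(\<Sum>j=1..c. lk u' (Suc i, \<sigma> j)) \<le> (\<Sum>j=1..<c. lk u' (i, \<sigma> j))"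
      if i: "1 \<le> i" and c: "c \<in> {1..n}" for i c
    proof (cases "i < k")
      case True
      then have S: "Suc i \<in> {Suc 0..k}" using i by simp
      have gp: "1 \<le> g (Suc i)" using g(2) S by (auto simp: image_subset_iff)
      show ?thesis
        using AB[OF _ True c] i s[of "{1..c}" "Suc i"] s[of "{1..<c}" i] z[OF S, of c] S gp
        by (cases "g (Suc i) \<le> c") (auto simp: of_bool_def split: if_splits)
    next
      case False
      have "(\<Sum>j=1..c. lk u' (Suc i, \<sigma> j)) \<le> (\<Sum>j=1..n. lk u' (Suc i, \<sigma> j))"
        by (rule sum_mono2) (use c in auto)
      also have "\<dots> = 0"
        using rs'[of "Suc i"] False 0 unfolding rowsum_permute[OF \<sigma>] shape_def by simp
      finally show ?thesis by simp
    qed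
    have "\<exists>P. tableau d' e u' P"
    proof (rule Suc.hyps(1))
      show "N = d' + e" using Suc.hyps(2) d' by simp
      show "Poly_Mapping.keys u' \<subseteq> entries m n" by (rule u'(2))
      show "rowsum n u' i = shape d' e i" for i by (rule rs')
      show "(\<Sum>j=1..c. lk u' (Suc i, \<sigma> j)) \<le> (\<Sum>j=1..<c. lk u' (i, \<sigma> j))"
        if "1 \<le> i" "c \<in> {1..n}" for i c using main[OF that] .
      show "(\<Sum>j=1..c. lk u' (Suc r, \<sigma> j)) \<le> e + (\<Sum>j=1..<c. lk u' (r, \<sigma> j))"
        if "1 \<le> r" "c \<in> {1..n}" for c using main[OF that] by simp
    qed
    then show ?thesis unfolding u'(1) d' using angle[OF _ g] by blast
  qed
qed

section \<open>Kernels of the row derivations\<close>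

abbreviation V where "V \<equiv> entries m n"

text \<open>Polynomials that are homogeneous in each row and lie in the kernels of all derivations that kill
  both kinds of minors.\<close>

definition admissible :: "(nat \<Rightarrow> nat) \<Rightarrow> (nat \<times> nat) cpoly set" where
  "admissible s = {f.
     (\<forall>v\<in>Poly_Mapping.keys f. Poly_Mapping.keys v \<subseteq> entries m n \<and> (\<forall>i. rowsum n v i = s i)) \<and>
     (\<forall>i. r < i \<longrightarrow> i < m \<longrightarrow> row_der n (Suc i) i f = 0) \<and>
     (\<forall>i. 1 \<le> i \<longrightarrow> i \<le> r \<longrightarrow> i < k \<longrightarrow> row_der n i (Suc i) f = 0)}"

lemma admissible_monoms: "f \<in> admissible s \<Longrightarrow> Poly_Mapping.keys f \<subseteq> monoms V"
  unfolding admissible_def monoms_def by blast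

lemma admissible_mult:
  assumes "f \<in> admissible s" "g \<in> admissible t"
  shows "f * g \<in> admissible (\<lambda>i. s i + t i)"
  unfolding admissible_def
proof (intro CollectI conjI ballI allI impI)
  fix v assume "v \<in> Poly_Mapping.keys (f * g)"
  then obtain a b where v: "v = a + b" "a \<in> Poly_Mapping.keys f" "b \<in> Poly_Mapping.keys g"
    using Poly_Mapping.keys_mult[of f g] by blast
  have ab: "Poly_Mapping.keys a \<subseteq> V" "Poly_Mapping.keys b \<subseteq> V" "\<And>i. rowsum n a i = s i" "\<And>i. rowsum n b i = t i"
    using assms v(2,3) unfolding admissible_def by blast+
  show "Poly_Mapping.keys v \<subseteq> V"
    using Poly_Mapping.keys_add[of a b] ab(1,2) unfolding v(1) by (meson Un_least order_trans)
  show "rowsum n v i = s i + t i" for i unfolding v(1) rowsum_add ab ..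
next
  fix i assume "r < i" "i < m"
  then have "row_der n (Suc i) i f = 0" "row_der n (Suc i) i g = 0"
    using assms unfolding admissible_def by blast+
  then show "row_der n (Suc i) i (f * g) = 0" by (simp add: row_der_mult)
next
  fix i assume "1 \<le> i" "i \<le> r" "i < k"
  then have "row_der n i (Suc i) f = 0" "row_der n i (Suc i) g = 0"
    using assms unfolding admissible_def by blast+
  then show "row_der n i (Suc i) (f * g) = 0" by (simp add: row_der_mult)
qed

lemma admissible_add:
  assumes "f \<in> admissible s" "g \<in> admissible s"
  shows "f + g \<in> admissible s"
  unfolding admissible_def
proof (intro CollectI conjI ballI allI impI)
  fix v assume "v \<in> Poly_Mapping.keys (f + g)"
  then have "v \<in> Poly_Mapping.keys f \<or> v \<in> Poly_Mapping.keys g"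
    using Poly_Mapping.keys_add[of f g] by blast
  then show "Poly_Mapping.keys v \<subseteq> V" "rowsum n v i = s i" for i
    using assms unfolding admissible_def by blast+
next
  fix i assume "r < i" "i < m"
  then have "row_der n (Suc i) i f = 0" "row_der n (Suc i) i g = 0"
    using assms unfolding admissible_def by blast+
  then show "row_der n (Suc i) i (f + g) = 0" by (simp add: row_der_add)
next
  fix i assume "1 \<le> i" "i \<le> r" "i < k"
  then have "row_der n i (Suc i) f = 0" "row_der n i (Suc i) g = 0"
    using assms unfolding admissible_def by blast+
  then show "row_der n i (Suc i) (f + g) = 0" by (simp add: row_der_add)
qed

lemma admissible_scale:
  assumes "f \<in> admissible s"
  shows "Const c * f \<in> admissible s"
  unfolding admissible_def
proof (intro CollectI conjI ballI allI impI)
  fix v assume "v \<in> Poly_Mapping.keys (Const c * f)"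
  then have "v \<in> Poly_Mapping.keys f" using keys_Const_mult_subset by blast
  then show "Poly_Mapping.keys v \<subseteq> V" "rowsum n v i = s i" for i
    using assms unfolding admissible_def by blast+
next
  fix i assume "r < i" "i < m"
  then have "row_der n (Suc i) i f = 0" using assms unfolding admissible_def by blast
  then show "row_der n (Suc i) i (Const c * f) = 0" by (simp add: row_der_scale)
next
  fix i assume "1 \<le> i" "i \<le> r" "i < k"
  then have "row_der n i (Suc i) f = 0" using assms unfolding admissible_def by blast
  then show "row_der n i (Suc i) (Const c * f) = 0" by (simp add: row_der_scale)
qed

lemma admissible_Const: "Const c \<in> admissible (\<lambda>_. 0)"
proof -
  have z: "v = 0" if "v \<in> Poly_Mapping.keys (Const c)" for v :: "(nat \<times> nat) monom"
    using that by (auto simp: Const_def split: if_splits)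
  have "Poly_Mapping.keys v \<subseteq> V \<and> (\<forall>i. rowsum n v i = 0)"
    if "v \<in> Poly_Mapping.keys (Const c)" for v
    unfolding z[OF that] by (simp add: rowsum_def)
  then show ?thesis unfolding admissible_def by (simp add: row_der_Const)
qed

text \<open>The hypotheses \<open>down\<close> and \<open>up\<close> say that each derivation replaces a row of the minor by another
  of its rows, if it affects the minor at all.\<close>

lemma minor_admissible:
  assumes C: "C \<subseteq> {1..n}" "card C = q - p" and q: "q \<le> m"
    and down: "\<And>i. r < i \<Longrightarrow> i < m \<Longrightarrow> Suc i \<in> {Suc p..q} \<Longrightarrow> i \<in> {Suc p..q}"
    and up: "\<And>i. 1 \<le> i \<Longrightarrow> i \<le> r \<Longrightarrow> i < k \<Longrightarrow> i \<in> {Suc p..q} \<Longrightarrow> Suc i \<in> {Suc p..q}"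
  shows "minor {Suc p..q} C \<in> admissible (\<lambda>i. of_bool (i \<in> {Suc p..q}))"
  unfolding admissible_def
proof (intro CollectI conjI ballI allI impI)
  have fC: "finite C" using C(1) finite_subset by blast
  fix v assume "v \<in> Poly_Mapping.keys (minor {Suc p..q} C)"
  then obtain e where e: "bij_betw e {Suc p..q} C" "v = rowmon p q e"
    unfolding keys_minor[OF fC C(2)] by blast
  have en: "e i \<in> {1..n}" if "i \<in> {Suc p..q}" for i using bij_betwE[OF e(1)] C(1) that by blast
  have "v \<in> monoms V"
    unfolding e(2)
  proof (rule rowmon_monoms)
    fix i assume "i \<in> {Suc p..q}"
    then show "(i, e i) \<in> V" using en[of i] q by simp
  qed
  then show "Poly_Mapping.keys v \<subseteq> V" by (simp add: monoms_def)
  show "rowsum n v i = of_bool (i \<in> {Suc p..q})" for i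
  proof (cases "i \<in> {Suc p..q}")
    case True
    then have "rowsum n v i = (\<Sum>j=1..n. if j = e i then 1 else 0)"
      unfolding rowsum_def e(2) lk_rowmon by (intro sum.cong) auto
    also have "\<dots> = 1" using en[OF True] by (simp add: sum.delta)
    finally show ?thesis using True by simp
  next
    case False
    then have "rowsum n v i = 0" unfolding rowsum_def e(2) lk_rowmon by (intro sum.neutral) auto
    then show ?thesis using False by simp
  qed
next
  have c: "card {Suc p..q} = card C" using C(2) by simp
  fix i assume i: "r < i" "i < m"
  show "row_der n (Suc i) i (minor {Suc p..q} C) = 0"
    by (rule row_der_minor[OF _ C(1) c down[OF i]]) simp_all
next
  have c: "card {Suc p..q} = card C" using C(2) by simp
  fix i assume i: "1 \<le> i" "i \<le> r" "i < k"
  show "row_der n i (Suc i) (minor {Suc p..q} C) = 0"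
    by (rule row_der_minor[OF _ C(1) c up[OF i]]) simp_all
qed

lemma angle_admissible: "C \<subseteq> {1..n} \<Longrightarrow> card C = k \<Longrightarrow> minor {Suc 0..k} C \<in> admissible (shape 1 0)"
  using minor_admissible[of C k 0] k_le by (simp add: shape_def[abs_def])

lemma square_admissible: "C \<subseteq> {1..n} \<Longrightarrow> card C = m - r \<Longrightarrow> minor {Suc r..m} C \<in> admissible (shape 0 1)"
  using minor_admissible[of C m r] r_le by (simp add: shape_def[abs_def])

lemma column_set:
  assumes "strict_mono_on {Suc p..q} g" "g ` {Suc p..q} \<subseteq> {1..n}"
  shows "\<sigma> ` g ` {Suc p..q} \<subseteq> {1..n}" "card (\<sigma> ` g ` {Suc p..q}) = q - p"
proof -
  show "\<sigma> ` g ` {Suc p..q} \<subseteq> {1..n}" using assms(2) permutes_image[OF \<sigma>] by blast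
  have "inj_on \<sigma> (g ` {Suc p..q})" using permutes_inj[OF \<sigma>] by (rule inj_on_subset) simp
  then show "card (\<sigma> ` g ` {Suc p..q}) = q - p"
    using strict_mono_on_imp_inj_on[OF assms(1)] by (simp add: card_image)
qed

lemma shape_add: "shape d e i + shape d' e' i = shape (d + d') (e + e') i"
  by (simp add: shape_def distrib_right)

lemma tableau_admissible: "tableau d e u P \<Longrightarrow> P \<in> admissible (shape d e)"
proof (induction rule: tableau.induct)
  case empty
  then show ?case using admissible_Const[of 1] by (simp add: Const_1 shape_def[abs_def])
next
  case (angle d e u P g)
  have "minor {Suc 0..k} (\<sigma> ` g ` {Suc 0..k}) \<in> admissible (shape 1 0)"
    using column_set[OF angle(2,3)] by (intro angle_admissible) simp_all
  from admissible_mult[OF angle.IH this] show ?case unfolding shape_add by (simp add: eta_contract_eq)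
next
  case (square d e u P g)
  have "minor {Suc r..m} (\<sigma> ` g ` {Suc r..m}) \<in> admissible (shape 0 1)"
    using column_set[OF square(2,3)] by (intro square_admissible) simp_all
  from admissible_mult[OF square.IH this] show ?case unfolding shape_add by (simp add: eta_contract_eq)
qed

text \<open>The property of a term order on which everything rests: minors have their \<open>\<sigma>\<close>-diagonal as
  leading monomial.\<close>

definition diagonal_tops :: "((nat \<times> nat) monom \<Rightarrow> (nat \<times> nat) monom \<Rightarrow> bool) \<Rightarrow> bool" where
  "diagonal_tops lt \<longleftrightarrow> (\<forall>p q g. q \<le> m \<longrightarrow> strict_mono_on {Suc p..q} g \<longrightarrow> g ` {Suc p..q} \<subseteq> {1..n} \<longrightarrow>
     is_top lt (minor {Suc p..q} (\<sigma> ` g ` {Suc p..q})) (rowmon p q (\<lambda>i. \<sigma> (g i))))"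

lemma tableau_is_top:
  assumes lt: "term_order V lt" "diagonal_tops lt"
  shows "tableau d e u P \<Longrightarrow> is_top lt P u"
proof (induction rule: tableau.induct)
  case empty
  have "Poly_Mapping.keys (1 :: (nat \<times> nat) cpoly) = {0}" by simp
  then show ?case by (simp add: is_top_def)
next
  case (angle d e u P g)
  show ?case
  proof (rule is_top_mult[OF lt(1) _ angle.IH])
    show "Poly_Mapping.keys P \<subseteq> monoms V"
      using tableau_admissible[OF angle(1)] by (rule admissible_monoms)
    show "Poly_Mapping.keys (minor {Suc 0..k} (\<sigma> ` g ` {Suc 0..k})) \<subseteq> monoms V"
      using column_set[OF angle(2,3)] by (intro admissible_monoms[OF angle_admissible]) simp_all
    show "is_top lt (minor {Suc 0..k} (\<sigma> ` g ` {Suc 0..k})) (rowmon 0 k (\<lambda>i. \<sigma> (g i)))"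
      using lt(2) angle(2,3) k_le unfolding diagonal_tops_def by blast
  qed
next
  case (square d e u P g)
  show ?case
  proof (rule is_top_mult[OF lt(1) _ square.IH])
    show "Poly_Mapping.keys P \<subseteq> monoms V"
      using tableau_admissible[OF square(1)] by (rule admissible_monoms)
    show "Poly_Mapping.keys (minor {Suc r..m} (\<sigma> ` g ` {Suc r..m})) \<subseteq> monoms V"
      using column_set[OF square(2,3)] by (intro admissible_monoms[OF square_admissible]) simp_all
    show "is_top lt (minor {Suc r..m} (\<sigma> ` g ` {Suc r..m})) (rowmon r m (\<lambda>i. \<sigma> (g i)))"
      using lt(2) square(2,3) unfolding diagonal_tops_def by blast
  qed
qed

lemma block_lex_diagonal_tops: "diagonal_tops (block_lex r \<sigma>)"
  unfolding diagonal_tops_def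
proof (intro allI impI)
  fix p q and g :: "nat \<Rightarrow> nat"
  assume q: "q \<le> m" and g: "strict_mono_on {Suc p..q} g" "g ` {Suc p..q} \<subseteq> {1..n}"
  have inj: "inj \<sigma>" by (rule permutes_inj[OF \<sigma>])
  show "is_top (block_lex r \<sigma>) (minor {Suc p..q} (\<sigma> ` g ` {Suc p..q})) (rowmon p q (\<lambda>i. \<sigma> (g i)))"
    by (rule minor_top_if_exchange[OF block_lex_term_order[OF inj] \<sigma> block_lex_exchange[OF inj \<sigma>_involution] q g])
qed

section \<open>Ballot inequalities for leading monomials\<close>

text \<open>The bridge to \<open>kernel_top_ballot\<close>: condition \<open>ord\<close> expresses that \<open>block_lex\<close>, restricted to the
  rows \<open>y\<close> and \<open>z\<close>, compares the exponents in row \<open>z\<close> from the end of the enumeration \<open>\<tau>\<close> of the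
  columns.\<close>

lemma row_der_kernel_ballot:
  assumes zy: "z \<noteq> y" "row_der n z y f = 0" and \<tau>: "\<tau> permutes {1..n}"
    and u: "is_top (block_lex r \<sigma>) f u"
    and ord: "\<And>a b c. c \<in> {1..n} \<Longrightarrow> block_before r (a, \<sigma> b) (z, \<sigma> (\<tau> c)) \<Longrightarrow>
      (a \<noteq> y \<and> a \<noteq> z) \<or> b \<notin> {1..n} \<or> (a = z \<and> b \<in> \<tau> ` {c<..n})"
    and c: "c \<in> {1..n}"
  shows "(\<Sum>j=1..c. lk u (z, \<tau> j)) \<le> (\<Sum>j=1..<c. lk u (y, \<tau> j))"
proof (rule kernel_top_ballot[of "\<lambda>j. (y, \<tau> j)" n "\<lambda>j. (z, \<tau> j)" "coeff_at f" "lk u"])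
  have inj: "inj \<tau>" by (rule permutes_inj[OF \<tau>])
  then show "inj_on (\<lambda>j. (y, \<tau> j)) {1..n}" "inj_on (\<lambda>j. (z, \<tau> j)) {1..n}"
    by (auto simp: inj_on_def)
  show "(\<lambda>j. (y, \<tau> j)) ` {1..n} \<inter> (\<lambda>j. (z, \<tau> j)) ` {1..n} = {}" using zy(1) by auto
  show "polar {1..n} (\<lambda>j. (y, \<tau> j)) (\<lambda>j. (z, \<tau> j)) (coeff_at f) M = 0" for M
    unfolding polar_reindex[OF permutes_imp_bij[OF \<tau>], of "\<lambda>j. (y, j)" "\<lambda>j. (z, j)"]
      polar_coeff_at[OF zy(1)] zy(2) by (simp add: coeff_at_def)
  show "coeff_at f (lk u) \<noteq> 0" using u by (simp add: coeff_at_lookup is_top_def in_keys_iff)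
  show "c \<in> {1..n}" by (rule c)
  fix M c
  assume c: "c \<in> {1..n}"
    and out: "\<And>v. v \<notin> (\<lambda>j. (y, \<tau> j)) ` {1..n} \<union> (\<lambda>j. (z, \<tau> j)) ` {1..n} \<Longrightarrow> M v = lk u v"
    and eq: "\<And>l. l \<in> {c<..n} \<Longrightarrow> M (z, \<tau> l) = lk u (z, \<tau> l)"
    and less: "lk u (z, \<tau> c) < M (z, \<tau> c)"
  show "coeff_at f M = 0"
  proof (cases M rule: coeff_at_cases[of _ f])
    case (1 \<alpha>)
    have "block_lex r \<sigma> u \<alpha>"
      unfolding block_lex_def
    proof (intro exI[of _ "(z, \<tau> c)"] conjI allI impI)
      show "lk u (z, \<tau> c) < lk \<alpha> (z, \<tau> c)" using less 1(1) by simp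
      fix w :: "nat \<times> nat"
      obtain a b where w: "w = (a, b)" by fastforce
      assume "block_before r (fst w, \<sigma> (snd w)) (fst (z, \<tau> c), \<sigma> (snd (z, \<tau> c)))"
      then have "(a \<noteq> y \<and> a \<noteq> z) \<or> b \<notin> {1..n} \<or> (a = z \<and> b \<in> \<tau> ` {c<..n})"
        using ord[OF c] w by simp
      moreover have "\<tau> ` {1..n} = {1..n}" by (rule permutes_image[OF \<tau>])
      ultimately show "lk u w = lk \<alpha> w"
        using out[of w] eq 1(1) w by fastforce
    qed
    moreover have "\<not> block_lex r \<sigma> u \<alpha>" if "\<alpha> \<in> Poly_Mapping.keys f"
    proof
      assume l: "block_lex r \<sigma> u \<alpha>"
      have "term_order UNIV (block_lex r \<sigma>)" by (rule block_lex_term_order[OF permutes_inj[OF \<sigma>]])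
      note t = term_orderD[OF this, unfolded monoms_def, simplified]
      have "\<alpha> \<noteq> u" using l t(1) by blast
      then have "block_lex r \<sigma> \<alpha> u" using u that by (simp add: is_top_def)
      then show False using l t(1,2) by blast
    qed
    ultimately show ?thesis using 1(2) by (auto simp: in_keys_iff)
  qed
qed

text \<open>Below row \<open>r\<close> the derivations give ballot inequalities for initial segments of the columns.  From
  row \<open>1\<close> up to row \<open>r\<close> the derivations go the other way and the columns are enumerated backwards, so
  the inequalities are about final segments; subtracting them from the row sums turns them into
  inequalities for initial segments.  If \<open>r = k\<close>, the two blocks are disjoint and no relation
  between the rows \<open>r\<close> and \<open>r + 1\<close> is available or required.\<close>

lemma admissible_top_tableau:
  assumes f: "f \<in> admissible (shape d e)" and u: "is_top (block_lex r \<sigma>) f u"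
  shows "\<exists>P. tableau d e u P"
proof (rule tableau_exists)
  have uf: "u \<in> Poly_Mapping.keys f" using u by (simp add: is_top_def)
  then show "Poly_Mapping.keys u \<subseteq> entries m n" and rs: "rowsum n u i = shape d e i" for i
    using f unfolding admissible_def by blast+
  have \<sigma>0: "\<sigma> b \<in> {1..n} \<longleftrightarrow> b \<in> {1..n}" for b by (rule permutes_in_image[OF \<sigma>])
  have low: "(\<Sum>j=1..c. lk u (Suc i, \<sigma> j)) \<le> (\<Sum>j=1..<c. lk u (i, \<sigma> j))"
    if i: "r < i" "i < m" and c: "c \<in> {1..n}" for i c
  proof (rule row_der_kernel_ballot[OF _ _ \<sigma> u _ c])
    show "row_der n (Suc i) i f = 0" using f i unfolding admissible_def by blast
    fix a b c assume c: "c \<in> {1..n}" and s: "block_before r (a, \<sigma> b) (Suc i, \<sigma> (\<sigma> c))"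
    show "(a \<noteq> i \<and> a \<noteq> Suc i) \<or> b \<notin> {1..n} \<or> (a = Suc i \<and> b \<in> \<sigma> ` {c<..n})"
    proof (cases "a = Suc i \<and> b \<in> {1..n}")
      case True
      then have "c < \<sigma> b" using s i by (auto simp: block_before_def row_major_def \<sigma>_involution)
      moreover have "\<sigma> b \<le> n" using True \<sigma>0[of b] by simp
      ultimately have "b \<in> \<sigma> ` {c<..n}" using \<sigma>_involution[of b] by (intro image_eqI[of _ _ "\<sigma> b"]) auto
      then show ?thesis using True by simp
    next
      case False
      then show ?thesis using s i by (auto simp: block_before_def row_major_def)
    qed
  qed simp
  have up: "rowsum n u i + (\<Sum>j=1..c. lk u (Suc i, \<sigma> j)) \<le> rowsum n u (Suc i) + (\<Sum>j=1..<c. lk u (i, \<sigma> j))"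
    if i: "1 \<le> i" "i \<le> r" "i < k" and c: "c \<in> {1..n}" for i c
  proof -
    \<comment> \<open>Columns are enumerated from the last to the first.\<close>
    let ?\<tau> = "\<lambda>j. \<sigma> (rev_col n j)"
    let ?c = "rev_col n c"
    have c': "?c \<in> {1..n}" using permutes_in_image[OF rev_col_permutes] c by blast
    have \<tau>: "?\<tau> permutes {1..n}" using permutes_compose[OF rev_col_permutes \<sigma>] by (simp add: comp_def)
    have "(\<Sum>j=1..?c. lk u (i, ?\<tau> j)) \<le> (\<Sum>j=1..<?c. lk u (Suc i, ?\<tau> j))"
    proof (rule row_der_kernel_ballot[OF _ _ \<tau> u _ c'])
      show "row_der n i (Suc i) f = 0" using f i unfolding admissible_def by blast
      fix a b c assume c: "c \<in> {1..n}" and s: "block_before r (a, \<sigma> b) (i, \<sigma> (?\<tau> c))"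
      show "(a \<noteq> Suc i \<and> a \<noteq> i) \<or> b \<notin> {1..n} \<or> (a = i \<and> b \<in> ?\<tau> ` {c<..n})"
      proof (cases "a = i \<and> b \<in> {1..n}")
        case True
        then have l: "\<sigma> b < rev_col n c" using s i by (auto simp: block_before_def row_major_def \<sigma>_involution)
        have b: "\<sigma> b \<in> {1..n}" using True \<sigma>0[of b] by simp
        have "rev_col n (\<sigma> b) \<in> {c<..n}" using l b c by (auto simp: rev_col_def)
        moreover have "b = ?\<tau> (rev_col n (\<sigma> b))" by (simp add: rev_col_involution \<sigma>_involution)
        ultimately show ?thesis using True by blast
      next
        case False
        then show ?thesis using s i by (auto simp: block_before_def row_major_def)
      qed
    qed simp
    moreover have "(\<Sum>j=1..?c. lk u (i, ?\<tau> j)) = (\<Sum>j=c..n. lk u (i, \<sigma> j))"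
      by (rule sum.reindex_bij_witness[of _ "rev_col n" "rev_col n"])
        (use c in \<open>auto simp: rev_col_involution\<close>, auto simp: rev_col_def split: if_splits)
    moreover have "(\<Sum>j=1..<?c. lk u (Suc i, ?\<tau> j)) = (\<Sum>j=Suc c..n. lk u (Suc i, \<sigma> j))"
      by (rule sum.reindex_bij_witness[of _ "rev_col n" "rev_col n"])
        (use c in \<open>auto simp: rev_col_involution\<close>, auto simp: rev_col_def split: if_splits)
    moreover have "rowsum n u i = (\<Sum>j=1..<c. lk u (i, \<sigma> j)) + (\<Sum>j=c..n. lk u (i, \<sigma> j))"
      unfolding rowsum_permute[OF \<sigma>] using c
      by (subst sum.union_disjoint[symmetric]) (auto intro!: sum.cong)
    moreover have "rowsum n u (Suc i) = (\<Sum>j=1..c. lk u (Suc i, \<sigma> j)) + (\<Sum>j=Suc c..n. lk u (Suc i, \<sigma> j))"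
      unfolding rowsum_permute[OF \<sigma>] using c
      by (subst sum.union_disjoint[symmetric]) (auto intro!: sum.cong)
    ultimately show ?thesis by simp
  qed
  show "(\<Sum>j=1..c. lk u (Suc i, \<sigma> j)) \<le> (\<Sum>j=1..<c. lk u (i, \<sigma> j))"
    if i: "1 \<le> i" "i < m" "i \<noteq> r" and c: "c \<in> {1..n}" for i c
  proof (cases "r < i")
    case False
    then have "rowsum n u i = rowsum n u (Suc i)" using i r_le unfolding rs shape_def by simp
    then show ?thesis using up[of i c] False i c r_le by simp
  qed (use low i c in simp)
  show "(\<Sum>j=1..c. lk u (Suc r, \<sigma> j)) \<le> e + (\<Sum>j=1..<c. lk u (r, \<sigma> j))"
    if "1 \<le> r" "r < k" "c \<in> {1..n}" for c
    using up[of r c] that k_le unfolding rs shape_def by simp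
qed

section \<open>Expansion into products of minors\<close>

definition tableau_monoms :: "(nat \<times> nat) monom set" where
  "tableau_monoms = {u. \<exists>d e P. tableau d e u P}"

text \<open>Several products of minors may have the same leading monomial; one of them is fixed, so that the
  products in a linear combination are indexed by their leading monomials.\<close>

definition minor_product :: "(nat \<times> nat) monom \<Rightarrow> (nat \<times> nat) cpoly" where
  "minor_product u = (SOME P. \<exists>d e. tableau d e u P)"

lemma minor_product:
  assumes "u \<in> tableau_monoms"
  obtains d e where "tableau d e u (minor_product u)"
proof -
  have "\<exists>P d e. tableau d e u P" using assms unfolding tableau_monoms_def by blast
  then have "\<exists>d e. tableau d e u (minor_product u)" unfolding minor_product_def by (rule someI_ex)
  then show ?thesis using that by blast
qed

text \<open>Linear combinations with at most one product of minors for each tableau monomial.\<close>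

definition product_comb :: "(nat \<times> nat) cpoly \<Rightarrow> bool" where
  "product_comb f \<longleftrightarrow> (\<exists>S c. finite S \<and> S \<subseteq> tableau_monoms \<and> f = (\<Sum>u\<in>S. Const (c u) * minor_product u))"

lemma product_comb_0: "product_comb 0"
  unfolding product_comb_def by (intro exI[of _ "{}"]) simp

lemma product_comb_minor_product: "u \<in> tableau_monoms \<Longrightarrow> product_comb (Const c * minor_product u)"
  unfolding product_comb_def by (intro exI[of _ "{u}"] exI[of _ "\<lambda>_. c"]) simp

lemma product_comb_add:
  assumes "product_comb f" "product_comb g"
  shows "product_comb (f + g)"
proof -
  obtain S a T b where S: "finite S" "S \<subseteq> tableau_monoms" "f = (\<Sum>u\<in>S. Const (a u) * minor_product u)"
    and T: "finite T" "T \<subseteq> tableau_monoms" "g = (\<Sum>u\<in>T. Const (b u) * minor_product u)"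
    using assms unfolding product_comb_def by blast
  let ?a = "\<lambda>u. if u \<in> S then a u else 0" and ?b = "\<lambda>u. if u \<in> T then b u else 0"
  have "f = (\<Sum>u\<in>S \<union> T. Const (?a u) * minor_product u)"
    unfolding S(3) using S(1) T(1) by (intro sum.mono_neutral_cong_left) (auto simp: Const_0)
  moreover have "g = (\<Sum>u\<in>S \<union> T. Const (?b u) * minor_product u)"
    unfolding T(3) using S(1) T(1) by (intro sum.mono_neutral_cong_left) (auto simp: Const_0)
  ultimately have "f + g = (\<Sum>u\<in>S \<union> T. Const (?a u + ?b u) * minor_product u)"
    by (simp only: Const_add distrib_right sum.distrib)
  then show ?thesis
    unfolding product_comb_def using S(1,2) T(1,2)
    by (intro exI[of _ "S \<union> T"] exI[of _ "\<lambda>u. ?a u + ?b u"]) simp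
qed

lemma product_comb_sum: "(\<And>x. x \<in> S \<Longrightarrow> product_comb (f x)) \<Longrightarrow> product_comb (\<Sum>x\<in>S. f x)"
  by (induction S rule: infinite_finite_induct) (auto intro: product_comb_0 product_comb_add)

text \<open>The leading monomial for \<open>block_lex\<close> is that of a product of minors, which can be subtracted.
  Only finitely many monomials have the given row sums, so the process ends.\<close>

lemma admissible_product_comb: "f \<in> admissible (shape d e) \<Longrightarrow> product_comb f"
proof -
  let ?lt = "block_lex r \<sigma>"
  have tU: "term_order UNIV ?lt" and tV: "term_order V ?lt"
    by (rule block_lex_term_order[OF permutes_inj[OF \<sigma>]])+
  note t = term_orderD[OF tU, unfolded monoms_def, simplified]
  define T where "T = {v. Poly_Mapping.keys v \<subseteq> V \<and> (\<forall>i. rowsum n v i = shape d e i)}"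
  have "T \<subseteq> {v. Poly_Mapping.keys v \<subseteq> V \<and> (\<forall>x. lk v x \<le> d + e)}"
  proof
    fix v assume v: "v \<in> T"
    have "lk v x \<le> d + e" for x
    proof (cases "lk v x = 0")
      case False
      obtain i j where x: "x = (i, j)" by fastforce
      have "x \<in> V" using v False unfolding T_def by (auto simp: in_keys_iff)
      then have "lk v x \<le> rowsum n v i" unfolding rowsum_def x by (intro member_le_sum) auto
      also have "\<dots> \<le> d + e" using v unfolding T_def shape_def by (simp add: of_bool_def)
      finally show ?thesis .
    qed simp
    then show "v \<in> {v. Poly_Mapping.keys v \<subseteq> V \<and> (\<forall>x. lk v x \<le> d + e)}" using v by (simp add: T_def)
  qed
  then have finT: "finite T" by (rule finite_subset) (rule finite_bounded_monoms, simp)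
  define below where "below f = {v \<in> T. \<exists>w\<in>Poly_Mapping.keys f. v = w \<or> ?lt v w}" for f :: "(nat \<times> nat) cpoly"
  show "product_comb f" if "f \<in> admissible (shape d e)" for f
    using that
  proof (induction "card (below f)" arbitrary: f rule: less_induct)
    case less
    show ?case
    proof (cases "f = 0")
      case False
      then obtain u where u: "is_top ?lt f u"
        using ex_is_top[OF tV False admissible_monoms[OF less.prems]] by blast
      then have uf: "u \<in> Poly_Mapping.keys f" by (simp add: is_top_def)
      have us: "u \<in> tableau_monoms" using admissible_top_tableau[OF less.prems u] unfolding tableau_monoms_def by blast
      obtain d' e' where P: "tableau d' e' u (minor_product u)" using us by (rule minor_product)
      let ?P = "minor_product u"
      have Pu: "is_top ?lt ?P u" by (rule tableau_is_top[OF tV block_lex_diagonal_tops P])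
      have uT: "u \<in> T" using less.prems uf unfolding admissible_def T_def by blast
      have "shape d' e' = shape d e"
      proof
        fix i
        have "rowsum n u i = shape d' e' i"
          using tableau_admissible[OF P] Pu unfolding admissible_def is_top_def by blast
        then show "shape d' e' i = shape d e i" using uT by (simp add: T_def)
      qed
      then have PK: "?P \<in> admissible (shape d e)" using tableau_admissible[OF P] by simp
      have a: "lk ?P u \<noteq> 0" using Pu by (simp add: is_top_def in_keys_iff)
      define c where "c = lk f u / lk ?P u"
      define f' where "f' = f + Const (- c) * ?P"
      have f'K: "f' \<in> admissible (shape d e)"
        unfolding f'_def by (rule admissible_add[OF less.prems admissible_scale[OF PK]])
      have l0: "lk f' u = 0" using a by (simp add: f'_def c_def lookup_add lookup_Const_mult)
      have lt: "?lt w u" if "w \<in> Poly_Mapping.keys f'" for w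
      proof -
        have "w \<noteq> u" using that l0 by (auto simp: in_keys_iff)
        moreover have "w \<in> Poly_Mapping.keys f \<or> w \<in> Poly_Mapping.keys ?P"
          using that by (auto simp: in_keys_iff f'_def lookup_add lookup_Const_mult)
        ultimately show ?thesis using u Pu by (auto simp: is_top_def)
      qed
      have "below f' \<subset> below f"
      proof (rule psubsetI)
        show "below f' \<subseteq> below f"
        proof
          fix v assume "v \<in> below f'"
          then obtain w where v: "v \<in> T" "w \<in> Poly_Mapping.keys f'" "v = w \<or> ?lt v w"
            unfolding below_def by blast
          have "?lt v u" using v(3) lt[OF v(2)] t(2) by blast
          then show "v \<in> below f" using v(1) uf unfolding below_def by blast
        qed
        have "u \<in> below f" using uT uf unfolding below_def by blast
        moreover have "u \<notin> below f'"
        proof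
          assume "u \<in> below f'"
          then obtain w where w: "w \<in> Poly_Mapping.keys f'" "u = w \<or> ?lt u w"
            unfolding below_def by blast
          then show False using lt[OF w(1)] t(1,2) by blast
        qed
        ultimately show "below f' \<noteq> below f" by blast
      qed
      then have "card (below f') < card (below f)"
        using finT by (intro psubset_card_mono) (auto simp: below_def)
      then have "product_comb f'" by (rule less.hyps[OF _ f'K])
      moreover have "f = f' + Const c * ?P" by (simp add: f'_def Const_minus)
      ultimately show ?thesis
        using product_comb_add product_comb_minor_product[OF us] by metis
    qed (simp add: product_comb_0)
  qed
qed

text \<open>The products in the combination have pairwise distinct leading monomials, so the largest of them
  is not cancelled.\<close>

lemma product_comb_top:
  assumes lt: "term_order V lt" "diagonal_tops lt" and f: "product_comb f" "f \<noteq> 0"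
  shows "Poly_Mapping.keys f \<subseteq> monoms V" and "\<exists>u\<in>tableau_monoms. is_top lt f u"
proof -
  obtain S c where S: "finite S" "S \<subseteq> tableau_monoms" "f = (\<Sum>u\<in>S. Const (c u) * minor_product u)"
    using f(1) unfolding product_comb_def by blast
  define S0 where "S0 = {u \<in> S. c u \<noteq> 0}"
  have S0: "finite S0" "S0 \<subseteq> tableau_monoms" "\<And>u. u \<in> S0 \<Longrightarrow> c u \<noteq> 0"
    using S(1,2) unfolding S0_def by auto
  have fS: "f = (\<Sum>u\<in>S0. Const (c u) * minor_product u)"
    unfolding S(3) S0_def using S(1) by (intro sum.mono_neutral_right) (auto simp: Const_0)
  have "S0 \<noteq> {}" using f(2) fS by auto
  have top: "is_top lt (minor_product u) u" and mon: "Poly_Mapping.keys (minor_product u) \<subseteq> monoms V"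
    if u: "u \<in> S0" for u
  proof -
    obtain d e where P: "tableau d e u (minor_product u)"
      by (rule minor_product) (use u S0(2) in blast)
    show "is_top lt (minor_product u) u" by (rule tableau_is_top[OF lt P])
    show "Poly_Mapping.keys (minor_product u) \<subseteq> monoms V" by (rule admissible_monoms[OF tableau_admissible[OF P]])
  qed
  have S0m: "S0 \<subseteq> monoms V" using top mon unfolding is_top_def by blast
  have kf: "\<exists>u\<in>S0. w \<in> Poly_Mapping.keys (minor_product u)" if "w \<in> Poly_Mapping.keys f" for w
  proof -
    have "(\<Sum>u\<in>S0. lk (Const (c u) * minor_product u) w) \<noteq> 0"
      using that unfolding in_keys_iff fS lookup_sum .
    then obtain u where "u \<in> S0" "lk (Const (c u) * minor_product u) w \<noteq> 0"
      by (rule sum.not_neutral_contains_not_neutral)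
    then show ?thesis by (intro bexI[of _ u]) (simp_all add: lookup_Const_mult in_keys_iff)
  qed
  then show "Poly_Mapping.keys f \<subseteq> monoms V" using mon by blast
  obtain u where u: "u \<in> S0" "\<And>v. v \<in> S0 \<Longrightarrow> v \<noteq> u \<Longrightarrow> lt v u"
    using finite_has_top[OF lt(1) S0(1) \<open>S0 \<noteq> {}\<close> S0m] by blast
  have um: "u \<in> monoms V" using u(1) S0m by blast
  have less: "lt w u" if "v \<in> S0" "w \<in> Poly_Mapping.keys (minor_product v)" "(v, w) \<noteq> (u, u)" for v w
  proof -
    have w: "w = v \<or> lt w v" using top[OF that(1)] that(2) unfolding is_top_def by blast
    have m: "w \<in> monoms V" "v \<in> monoms V" using that mon S0m by blast+
    show ?thesis using w u(2)[OF that(1)] that(3) term_orderD(2)[OF lt(1) m um] by blast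
  qed
  have "lk f u = (\<Sum>v\<in>S0. if v = u then c u * lk (minor_product u) u else 0)"
    unfolding fS lookup_sum lookup_Const_mult
  proof (intro sum.cong refl)
    fix v assume v: "v \<in> S0"
    have "u \<notin> Poly_Mapping.keys (minor_product v)" if "v \<noteq> u"
      using less[OF v, of u] that term_orderD(1)[OF lt(1) um] by blast
    then show "c v * lk (minor_product v) u = (if v = u then c u * lk (minor_product u) u else 0)"
      by (auto simp: in_keys_iff)
  qed
  also have "\<dots> = c u * lk (minor_product u) u" using u(1) S0(1) by (simp add: sum.delta)
  finally have "u \<in> Poly_Mapping.keys f"
    using S0(3)[OF u(1)] top[OF u(1)] by (simp add: is_top_def in_keys_iff)
  moreover have "lt w u" if w: "w \<in> Poly_Mapping.keys f" "w \<noteq> u" for w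
  proof -
    obtain v where "v \<in> S0" "w \<in> Poly_Mapping.keys (minor_product v)" using kf[OF w(1)] by blast
    then show ?thesis using less w(2) by blast
  qed
  ultimately show "\<exists>u\<in>tableau_monoms. is_top lt f u"
    using u(1) S0(2) unfolding is_top_def by blast
qed

section \<open>The Khovanskii basis\<close>

text \<open>A tableau monomial is the product of its columns, which are leading monomials of minors.\<close>

lemma tableau_in_subalgebra:
  assumes A: "is_subalgebra A"
    and gen: "\<And>g. strict_mono_on {Suc 0..k} g \<Longrightarrow> g ` {Suc 0..k} \<subseteq> {1..n} \<Longrightarrow>
        Poly_Mapping.single (rowmon 0 k (\<lambda>i. \<sigma> (g i))) 1 \<in> A"
      "\<And>g. strict_mono_on {Suc r..m} g \<Longrightarrow> g ` {Suc r..m} \<subseteq> {1..n} \<Longrightarrow>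
        Poly_Mapping.single (rowmon r m (\<lambda>i. \<sigma> (g i))) 1 \<in> A"
  shows "tableau d e u P \<Longrightarrow> Poly_Mapping.single u 1 \<in> A"
proof (induction rule: tableau.induct)
  have mult: "Poly_Mapping.single (u + v) 1 \<in> A"
    if "Poly_Mapping.single u 1 \<in> A" "Poly_Mapping.single v 1 \<in> A" for u v
  proof -
    have "Poly_Mapping.single (u + v) (1 :: complex) = Poly_Mapping.single u 1 * Poly_Mapping.single v 1"
      by (simp add: mult_single)
    then show ?thesis using A that unfolding is_subalgebra_def by simp
  qed
  {
    case empty
    then show ?case using A unfolding is_subalgebra_def Const_def by blast
  next
    case (angle d e u P g)
    then show ?case using mult gen(1) by blast
  next
    case (square d e u P g)
    then show ?case using mult gen(2) by blast
  }
qed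

lemma bracket_image_admissible:
  assumes m: "m = n - k + r" and kn: "k \<le> n" and b: "b \<in> brackets k n"
  shows "\<exists>d e. bracket_image k n r b \<in> admissible (shape d e)"
proof (cases b)
  case (Angle I)
  then have "I \<subseteq> {1..n}" "card I = k" using b unfolding brackets_def index_sets_def by auto
  then show ?thesis using angle_admissible[of I] Angle by auto
next
  case (Square J)
  then have J: "J \<subseteq> {1..n}" "card J = k" using b unfolding brackets_def index_sets_def by auto
  have "card ({1..n} - J) = m - r" using J m kn by (simp add: card_Diff_subset finite_subset)
  then have "minor {Suc r..m} ({1..n} - J) \<in> admissible (shape 0 1)" by (intro square_admissible) auto
  then have "Const ((-1) ^ \<Sum> J) * minor {Suc r..m} ({1..n} - J) \<in> admissible (shape 0 1)"
    by (rule admissible_scale)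
  moreover have "bracket_image k n r b = Const ((-1) ^ \<Sum> J) * minor {Suc r..m} ({1..n} - J)"
    by (simp add: Square m minus_one_power_Const)
  ultimately have "bracket_image k n r b \<in> admissible (shape 0 1)" by simp
  then show ?thesis by blast
qed

lemma SH_ring_product_comb:
  assumes m: "m = n - k + r" and kn: "k \<le> n" and f: "f \<in> SH_ring k n r"
  shows "product_comb f"
proof -
  define H where "H = (\<Union>d e. admissible (shape d e))"
  have H_mult: "f * g \<in> H" if fg: "f \<in> H" "g \<in> H" for f g
  proof -
    obtain d e d' e' where "f \<in> admissible (shape d e)" "g \<in> admissible (shape d' e')"
      using fg unfolding H_def by blast
    from admissible_mult[OF this] have "f * g \<in> admissible (shape (d + d') (e + e'))"
      unfolding shape_add by (simp add: eta_contract_eq)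
    then show ?thesis unfolding H_def by blast
  qed
  have "Const c \<in> admissible (shape 0 0)" for c
    using admissible_Const[of c] by (simp add: shape_def[abs_def])
  then have H_Const: "Const c \<in> H" for c unfolding H_def by blast
  then have H_1: "1 \<in> H" using Const_1 by metis
  have H_power: "f ^ N \<in> H" if "f \<in> H" for f N
    by (induction N) (simp_all add: H_1 H_mult that)
  have H_prod: "(\<Prod>x\<in>S. f x) \<in> H" if "\<And>x. x \<in> S \<Longrightarrow> f x \<in> H" for S :: "bracket set" and f
    using that by (induction S rule: infinite_finite_induct) (simp_all add: H_1 H_mult)
  have H_comb: "product_comb f" if "f \<in> H" for f
    using that admissible_product_comb unfolding H_def by blast
  obtain p where p: "p \<in> poly_ring (brackets k n)" "f = \<phi> k n r p" using f unfolding SH_ring_def by blast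
  show ?thesis
    unfolding p(2) \<phi>_def subst_hom_def
  proof (intro product_comb_sum H_comb H_mult H_Const H_prod H_power)
    fix \<alpha> b assume "\<alpha> \<in> Poly_Mapping.keys p" "b \<in> Poly_Mapping.keys \<alpha>"
    then have "b \<in> brackets k n" using p(1) unfolding poly_ring_def monoms_def by blast
    then obtain d e where "bracket_image k n r b \<in> admissible (shape d e)"
      using bracket_image_admissible[OF m kn] by metis
    then show "bracket_image k n r b \<in> H" unfolding H_def by (intro UN_I[of d] UN_I[of e]) simp_all
  qed
qed

lemma SH_minors_subset: "SH_minors k n r \<subseteq> SH_ring k n r"
proof -
  have "Var b \<in> poly_ring (brackets k n)" if "b \<in> brackets k n" for b
    using that unfolding poly_ring_def monoms_def Var_def by simp
  then show ?thesis unfolding SH_minors_def SH_ring_def brackets_def by blast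
qed

text \<open>The sign in the image of a square bracket does not affect its leading monomial, so every column
  of a tableau is the leading monomial of one of the generators.\<close>

lemma khovanskii_basis_if_diagonal_tops:
  assumes m: "m = n - k + r" and kn: "k \<le> n"
    and lt: "term_order V lt" "diagonal_tops lt"
  shows "khovanskii_basis lt (SH_ring k n r) (SH_minors k n r)"
proof -
  let ?X = "{init lt f | f. f \<in> SH_minors k n r \<and> f \<noteq> 0}"
  let ?Y = "{init lt f | f. f \<in> SH_ring k n r \<and> f \<noteq> 0}"
  have gen_sub: "X \<subseteq> algebra_gen X" for X :: "(nat \<times> nat) cpoly set"
    unfolding algebra_gen_def by (rule hull_subset)
  have alg: "is_subalgebra (algebra_gen X)" for X :: "(nat \<times> nat) cpoly set"
    unfolding algebra_gen_def by (rule hull_in) (auto simp: is_subalgebra_def)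
  have topX: "Poly_Mapping.single u 1 \<in> algebra_gen ?X"
    if f: "f \<in> SH_minors k n r" "is_top lt f u" "Poly_Mapping.keys f \<subseteq> monoms V" for f u
  proof -
    have "f \<noteq> 0" using f(2) by (auto simp: is_top_def)
    moreover have "init lt f = Poly_Mapping.single u 1" by (rule init_is_top[OF lt(1) f(3,2)])
    ultimately have "Poly_Mapping.single u 1 \<in> ?X" 
      using f(1) by (intro CollectI exI[of _ f]) simp
    then show ?thesis by (rule subsetD[OF gen_sub])
  qed
  have sub: "Poly_Mapping.single u 1 \<in> algebra_gen ?X" if us: "u \<in> tableau_monoms" for u
  proof -
    obtain d e P where P: "tableau d e u P" using us unfolding tableau_monoms_def by blast
    show ?thesis
    proof (rule tableau_in_subalgebra[OF alg _ _ P])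
      fix g :: "nat \<Rightarrow> nat"
      assume g: "strict_mono_on {Suc 0..k} g" "g ` {Suc 0..k} \<subseteq> {1..n}"
      let ?I = "\<sigma> ` g ` {Suc 0..k}"
      have I: "?I \<subseteq> {1..n}" "card ?I = k" using column_set[OF g] by simp_all
      then have "\<phi> k n r (Var (Angle ?I)) \<in> SH_minors k n r"
        unfolding SH_minors_def index_sets_def by blast
      moreover have "\<phi> k n r (Var (Angle ?I)) = minor {Suc 0..k} ?I" unfolding \<phi>_Var by simp
      ultimately have "minor {Suc 0..k} ?I \<in> SH_minors k n r" by simp
      moreover have "is_top lt (minor {Suc 0..k} ?I) (rowmon 0 k (\<lambda>i. \<sigma> (g i)))"
        using lt(2) g k_le unfolding diagonal_tops_def by blast
      ultimately show "Poly_Mapping.single (rowmon 0 k (\<lambda>i. \<sigma> (g i))) 1 \<in> algebra_gen ?X"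
        using admissible_monoms[OF angle_admissible[OF I]] by (rule topX)
    next
      fix g :: "nat \<Rightarrow> nat"
      assume g: "strict_mono_on {Suc r..m} g" "g ` {Suc r..m} \<subseteq> {1..n}"
      let ?C = "\<sigma> ` g ` {Suc r..m}"
      have C: "?C \<subseteq> {1..n}" "card ?C = m - r" using column_set[OF g] by simp_all
      define J where "J = {1..n} - ?C"
      define s :: complex where "s = (-1) ^ (\<Sum>J)"
      have JC: "{1..n} - J = ?C" using C(1) unfolding J_def by blast
      have "card J = k"
        unfolding J_def using C m kn by (subst card_Diff_subset) (auto intro: finite_subset)
      then have "\<phi> k n r (Var (Square J)) \<in> SH_minors k n r"
        unfolding SH_minors_def index_sets_def J_def by blast
      moreover have "\<phi> k n r (Var (Square J)) = Const s * minor {Suc r..m} ?C"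
        unfolding \<phi>_Var bracket_image.simps JC m s_def minus_one_power_Const by simp
      ultimately have mem: "Const s * minor {Suc r..m} ?C \<in> SH_minors k n r" by simp
      have "is_top lt (minor {Suc r..m} ?C) (rowmon r m (\<lambda>i. \<sigma> (g i)))"
        using lt(2) g unfolding diagonal_tops_def by blast
      moreover have keys: "Poly_Mapping.keys (Const s * minor {Suc r..m} ?C) = Poly_Mapping.keys (minor {Suc r..m} ?C)"
        by (rule keys_Const_mult) (simp add: s_def)
      ultimately have "is_top lt (Const s * minor {Suc r..m} ?C) (rowmon r m (\<lambda>i. \<sigma> (g i)))"
        by (simp add: is_top_def)
      with mem show "Poly_Mapping.single (rowmon r m (\<lambda>i. \<sigma> (g i))) 1 \<in> algebra_gen ?X"
        by (rule topX) (use keys admissible_monoms[OF square_admissible[OF C]] in simp)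
    qed
  qed
  have "?Y \<subseteq> algebra_gen ?X"
  proof
    fix h assume "h \<in> ?Y"
    then obtain f where f: "h = init lt f" "f \<in> SH_ring k n r" "f \<noteq> 0" by blast
    have comb: "product_comb f" by (rule SH_ring_product_comb[OF m kn f(2)])
    obtain u where u: "u \<in> tableau_monoms" "is_top lt f u" using product_comb_top(2)[OF lt comb f(3)] by blast
    have "h = Poly_Mapping.single u 1"
      unfolding f(1) by (rule init_is_top[OF lt(1) product_comb_top(1)[OF lt comb f(3)] u(2)])
    then show "h \<in> algebra_gen ?X" using sub[OF u(1)] by simp
  qed
  then have "algebra_gen ?Y \<subseteq> algebra_gen ?X"
    using alg unfolding algebra_gen_def[of ?Y] by (rule hull_minimal)
  moreover have "?X \<subseteq> ?Y" using SH_minors_subset by blast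
  then have "algebra_gen ?X \<subseteq> algebra_gen ?Y" unfolding algebra_gen_def by (rule hull_mono)
  ultimately show ?thesis
    unfolding khovanskii_basis_def init_algebra_def using SH_minors_subset by blast
qed

end

theorem theorem3p5:
  fixes k n r :: nat
  assumes "r \<le> k" and "2 * k \<le> r + n"
  shows "khovanskii_basis revlex (SH_ring k n r) (SH_minors k n r) \<and>
    (\<forall>lt. term_order (entries (n - k + r) n) lt \<and> diagonal_order (n - k + r) n lt \<longrightarrow>
       khovanskii_basis lt (SH_ring k n r) (SH_minors k n r))"
proof (intro conjI allI impI)
  let ?m = "n - k + r"
  have kn: "k \<le> n" and km: "k \<le> ?m" using assms by simp_all
  show "khovanskii_basis revlex (SH_ring k n r) (SH_minors k n r)"
  proof -
    \<comment> \<open>Antidiagonals are diagonals after reversal of the columns.\<close>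
    interpret bracket_shape k n r ?m "rev_col n"
      by unfold_locales (use assms km rev_col_permutes rev_col_involution in auto)
    show ?thesis
    proof (rule khovanskii_basis_if_diagonal_tops[OF refl kn revlex_term_order])
      show "diagonal_tops revlex"
        unfolding diagonal_tops_def
      proof (intro allI impI)
        fix p q and g :: "nat \<Rightarrow> nat"
        assume q: "q \<le> ?m" and g: "strict_mono_on {Suc p..q} g" "g ` {Suc p..q} \<subseteq> {1..n}"
        show "is_top revlex (minor {Suc p..q} (rev_col n ` g ` {Suc p..q})) (rowmon p q (\<lambda>i. rev_col n (g i)))"
        proof (rule minor_top_if_exchange[OF revlex_term_order rev_col_permutes revlex_exchange q g])
          show "rev_col n l < rev_col n j" if "j \<in> {1..n}" "l \<in> {1..n}" "j < l" for j l
            using that by (auto simp: rev_col_def)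
        qed
      qed
    qed
  qed
  fix lt assume lt: "term_order (entries ?m n) lt \<and> diagonal_order ?m n lt"
  interpret bracket_shape k n r ?m id
    by unfold_locales (use assms km in \<open>auto simp: permutes_id\<close>)
  show "khovanskii_basis lt (SH_ring k n r) (SH_minors k n r)"
  proof (rule khovanskii_basis_if_diagonal_tops[OF refl kn])
    show "term_order (entries ?m n) lt" using lt by blast
    show "diagonal_tops lt"
      unfolding diagonal_tops_def using lt minor_top_if_diagonal_order[of ?m n lt] by simp
  qed
qed

end
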